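(* Suppose that $S$ satisfies the no-arbitrage condition (NA), that Assumption A (well-posedness) holds, that $U$ satisfies either Assumption B or Assumption C, and in addition that $U$ is strictly concave. Let $c\in\mathbb{R}$. Then there is a unique optimal strategy $\phi^*$ (that is, a strategy $\phi^*\in\Phi(U,c)$ with $EU(V_T^{c,\phi^*})=u(c):=\sup_{\phi\in\Phi(U,c)}EU(V_T^{c,\phi})$) which satisfies $$\phi^*_t\in D_t\quad\text{a.s., for all }1\le t\le T.$$
   Context: Market: $(\Omega,\mathcal F,P)$ is a probability space with a filtration $(\mathcal F_t)_{0\le t\le T}$ ($T$ a finite integer horizon), $\mathcal F_0$ contains all $P$-null sets, and $(S_t)_{0\le t\le T}$ is an $\mathbb{R}^d$-valued adapted process; $\Delta S_t:=S_t-S_{t-1}$. $\Xi_t$ is the set of $\mathcal F_t$-measurable $\mathbb{R}^d$-valued random variables. A strategy is a predictable process $\phi=(\phi_t)_{1\le t\le T}$, i.e. $\phi_t\in\Xi_{t-1}$; $\Phi$ is the set of all strategies; strategies that are almost surely equal are identified. For $c\in\mathbb{R}$, $V_t^{c,\phi}:=c+\sum_{i=1}^t\langle\phi_i,\Delta S_i\rangle$. $U:\mathbb{R}\to\mathbb{R}$ is a concave nondecreasing function. $\Phi(U,c)$ is the set of $\phi\in\Phi$ for which the expectation $EU(V_T^{c,\phi})$ is well defined. Conditional expectations are in the generalized sense ($E(X|\mathcal G)=E(X^+|\mathcal G)-E(X^-|\mathcal G)$ whenever this is not $\infty-\infty$). $D_t(\omega)\subset\mathbb{R}^d$ is the smallest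 affine subspace containing the support of the regular conditional distribution of $\Delta S_t$ with respect to $\mathcal F_{t-1}$. (NA): for all $\phi\in\Phi$, if $V_T^{0,\phi}\ge 0$ a.s. then $V_T^{0,\phi}=0$ a.s. Assumption A: the following random functions are well defined: $U_T(x):=U(x)$, and for $0\le t<T$, $x\in\mathbb{R}$, $U_t(x):=\operatorname{ess\,sup}_{\xi\in\Xi_t}E(U_{t+1}(x+\langle\xi,\Delta S_{t+1}\rangle)|\mathcal F_t)<\infty$ a.s. (where regular versions of $U_{t+1}$, i.e. a.s. nondecreasing, concave and finite-valued in $x$, are used), and $EU_0(x)<\infty$ for all $x\in\mathbb{R}$. Assumption B: $U$ is concave, nondecreasing, $U(0)=0$, and there exist $\tilde x>0$ and $0<\gamma<1$ such that $U(\lambda x)\le\lambda^\gamma U(x)$ for all $x\ge\tilde x$ and all $\lambda\ge1$. Assumption C: $U$ is concave, nondecreasing, $U(0)=0$, and there exist $\alpha>0$ and $\tilde x\le0$ such that $U(\lambda x)\le\lambda^{1+\alpha}U(x)$ for all $x\le\tilde x$ and all $\lambda\ge1$. *)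

theory Defs
  imports "HOL-Probability.Probability"
begin

section \<open>Generalized expectations and essential suprema\<close>

text \<open>Extended-real (conditional) expectations of real random variables. The values are meaningful
  only if the corresponding predicate excludes \<open>\<infinity> - \<infinity>\<close>; note that \<open>ennreal\<close> truncates negative
  reals to \<open>0\<close>, so \<open>ennreal (f \<omega>)\<close> and \<open>ennreal (- f \<omega>)\<close> are the positive and the negative part.\<close>

definition expectation_defined :: "'a measure \<Rightarrow> ('a \<Rightarrow> real) \<Rightarrow> bool" where
  "expectation_defined M f \<longleftrightarrow>
     f \<in> borel_measurable M \<and>
     \<not> ((\<integral>\<^sup>+\<omega>. ennreal (f \<omega>) \<partial>M) = \<infinity> \<and> (\<integral>\<^sup>+\<omega>. ennreal (- f \<omega>) \<partial>M) = \<infinity>)"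

definition gen_expectation :: "'a measure \<Rightarrow> ('a \<Rightarrow> real) \<Rightarrow> ereal" where
  "gen_expectation M f =
     enn2ereal (\<integral>\<^sup>+\<omega>. ennreal (f \<omega>) \<partial>M) - enn2ereal (\<integral>\<^sup>+\<omega>. ennreal (- f \<omega>) \<partial>M)"

definition cond_exp_defined :: "'a measure \<Rightarrow> 'a measure \<Rightarrow> ('a \<Rightarrow> real) \<Rightarrow> bool" where
  "cond_exp_defined M G f \<longleftrightarrow>
     f \<in> borel_measurable M \<and>
     (AE \<omega> in M. \<not> (nn_cond_exp M G (\<lambda>\<omega>. ennreal (f \<omega>)) \<omega> = \<infinity> \<and>
                     nn_cond_exp M G (\<lambda>\<omega>. ennreal (- f \<omega>)) \<omega> = \<infinity>))"

definition gen_cond_exp :: "'a measure \<Rightarrow> 'a measure \<Rightarrow> ('a \<Rightarrow> real) \<Rightarrow> 'a \<Rightarrow> ereal" where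
  "gen_cond_exp M G f \<omega> =
     enn2ereal (nn_cond_exp M G (\<lambda>\<omega>. ennreal (f \<omega>)) \<omega>) -
     enn2ereal (nn_cond_exp M G (\<lambda>\<omega>. ennreal (- f \<omega>)) \<omega>)"

text \<open>\<open>g\<close> is a version of the essential supremum of the (possibly uncountable) family \<open>X\<close>, i.e. its
  least upper bound with respect to almost sure domination.\<close>

definition is_ess_sup :: "'a measure \<Rightarrow> ('a \<Rightarrow> ereal) set \<Rightarrow> ('a \<Rightarrow> ereal) \<Rightarrow> bool" where
  "is_ess_sup M X g \<longleftrightarrow>
     g \<in> borel_measurable M \<and>
     (\<forall>f\<in>X. AE \<omega> in M. f \<omega> \<le> g \<omega>) \<and>
     (\<forall>h\<in>borel_measurable M. (\<forall>f\<in>X. AE \<omega> in M. f \<omega> \<le> h \<omega>) \<longrightarrow> (AE \<omega> in M. g \<omega> \<le> h \<omega>))"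

section \<open>The market\<close>

locale market = prob_space M
  for M :: "'a measure" +
  fixes F :: "nat \<Rightarrow> 'a measure"
    and S :: "nat \<Rightarrow> 'a \<Rightarrow> real ^ 'd"
    and T :: nat
  assumes subalgebra_F: "\<And>t. t \<le> T \<Longrightarrow> subalgebra M (F t)"
    and filtration_F: "\<And>s t. s \<le> t \<Longrightarrow> t \<le> T \<Longrightarrow> sets (F s) \<subseteq> sets (F t)"
    and null_sets_F: "null_sets M \<subseteq> sets (F 0)"
    and adapted_S: "\<And>t. t \<le> T \<Longrightarrow> S t \<in> borel_measurable (F t)"

definition increment :: "(nat \<Rightarrow> 'a \<Rightarrow> real ^ 'd) \<Rightarrow> nat \<Rightarrow> 'a \<Rightarrow> real ^ 'd" where
  "increment S t \<omega> = S t \<omega> - S (t - 1) \<omega>"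

text \<open>A process is a function on all of \<^typ>\<open>nat\<close>; only its values at the times \<open>1, \<dots>, T\<close> matter for
  a strategy.\<close>

definition strategies :: "(nat \<Rightarrow> 'a measure) \<Rightarrow> nat \<Rightarrow> (nat \<Rightarrow> 'a \<Rightarrow> real ^ 'd) set" where
  "strategies F T = {\<phi>. \<forall>t\<in>{1..T}. \<phi> t \<in> borel_measurable (F (t - 1))}"

definition wealth ::
  "(nat \<Rightarrow> 'a \<Rightarrow> real ^ 'd) \<Rightarrow> real \<Rightarrow> (nat \<Rightarrow> 'a \<Rightarrow> real ^ 'd) \<Rightarrow> nat \<Rightarrow> 'a \<Rightarrow> real" where
  "wealth S c \<phi> t \<omega> = c + (\<Sum>i=1..t. \<phi> i \<omega> \<bullet> increment S i \<omega>)"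

definition no_arbitrage ::
  "'a measure \<Rightarrow> (nat \<Rightarrow> 'a measure) \<Rightarrow> (nat \<Rightarrow> 'a \<Rightarrow> real ^ 'd) \<Rightarrow> nat \<Rightarrow> bool" where
  "no_arbitrage M F S T \<longleftrightarrow>
     (\<forall>\<phi>\<in>strategies F T.
        (AE \<omega> in M. wealth S 0 \<phi> T \<omega> \<ge> 0) \<longrightarrow> (AE \<omega> in M. wealth S 0 \<phi> T \<omega> = 0))"

section \<open>Supports of conditional laws\<close>

text \<open>\<open>\<kappa>\<close> is a version of the regular conditional distribution of \<open>X\<close> with respect to \<open>G\<close>.\<close>

definition regular_cond_distr ::
  "'a measure \<Rightarrow> 'a measure \<Rightarrow> ('a \<Rightarrow> 'b::topological_space) \<Rightarrow> ('a \<Rightarrow> 'b measure) \<Rightarrow> bool" where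
  "regular_cond_distr M G X \<kappa> \<longleftrightarrow>
     \<kappa> \<in> G \<rightarrow>\<^sub>M prob_algebra borel \<and>
     (\<forall>B\<in>sets borel.
        AE \<omega> in M. emeasure (\<kappa> \<omega>) B = nn_cond_exp M G (\<lambda>\<omega>. indicator B (X \<omega>)) \<omega>)"

definition measure_support :: "'b::topological_space measure \<Rightarrow> 'b set" where
  "measure_support \<mu> = {x. \<forall>V. open V \<and> x \<in> V \<longrightarrow> emeasure \<mu> V > 0}"

text \<open>The random affine subspace \<open>D\<^sub>t(\<omega>)\<close>, for given versions \<open>\<kappa> t\<close> of the conditional laws of the
  price increments.\<close>

definition support_space :: "(nat \<Rightarrow> 'a \<Rightarrow> (real ^ 'd) measure) \<Rightarrow> nat \<Rightarrow> 'a \<Rightarrow> (real ^ 'd) set" where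
  "support_space \<kappa> t \<omega> = affine hull measure_support (\<kappa> t \<omega>)"

section \<open>Utility functions\<close>

definition strictly_concave :: "(real \<Rightarrow> real) \<Rightarrow> bool" where
  "strictly_concave U \<longleftrightarrow>
     (\<forall>x y s. x \<noteq> y \<and> 0 < s \<and> s < 1 \<longrightarrow> U ((1 - s) * x + s * y) > (1 - s) * U x + s * U y)"

definition assumption_B :: "(real \<Rightarrow> real) \<Rightarrow> bool" where
  "assumption_B U \<longleftrightarrow>
     concave_on UNIV U \<and> mono U \<and> U 0 = 0 \<and>
     (\<exists>x0 \<gamma>. x0 > 0 \<and> 0 < \<gamma> \<and> \<gamma> < 1 \<and>
        (\<forall>x l. x \<ge> x0 \<and> l \<ge> 1 \<longrightarrow> U (l * x) \<le> l powr \<gamma> * U x))"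

definition assumption_C :: "(real \<Rightarrow> real) \<Rightarrow> bool" where
  "assumption_C U \<longleftrightarrow>
     concave_on UNIV U \<and> mono U \<and> U 0 = 0 \<and>
     (\<exists>x0 \<alpha>. x0 \<le> 0 \<and> \<alpha> > 0 \<and>
        (\<forall>x l. x \<le> x0 \<and> l \<ge> 1 \<longrightarrow> U (l * x) \<le> l powr (1 + \<alpha>) * U x))"

section \<open>The utility maximization problem\<close>

text \<open>\<open>V t x \<omega>\<close> is the random function \<open>U\<^sub>t(x)\<close> of the dynamic programming recursion, in a regular
  version. Finiteness of the essential supremum is expressed by \<open>V\<close> being real-valued. Monotonicity
  and concavity hold only almost surely, so they do not imply measurability of the substituted
  function \<open>V t (Y \<omega>) \<omega>\<close> when \<open>M\<close> is incomplete; this is why joint measurability is required.\<close>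

definition regular_value_functions ::
  "'a measure \<Rightarrow> (nat \<Rightarrow> 'a measure) \<Rightarrow> (nat \<Rightarrow> 'a \<Rightarrow> real ^ 'd) \<Rightarrow> nat \<Rightarrow> (real \<Rightarrow> real) \<Rightarrow>
   (nat \<Rightarrow> real \<Rightarrow> 'a \<Rightarrow> real) \<Rightarrow> bool" where
  "regular_value_functions M F S T U V \<longleftrightarrow>
     (\<forall>x \<omega>. V T x \<omega> = U x) \<and>
     (\<forall>t<T.
        (\<lambda>(x, \<omega>). V t x \<omega>) \<in> borel_measurable (borel \<Otimes>\<^sub>M F t) \<and>
        (AE \<omega> in M. mono (\<lambda>x. V t x \<omega>) \<and> concave_on UNIV (\<lambda>x. V t x \<omega>)) \<and>
        (\<forall>x.
           (\<forall>\<xi>\<in>borel_measurable (F t).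
              cond_exp_defined M (F t)
                (\<lambda>\<omega>. V (t + 1) (x + \<xi> \<omega> \<bullet> increment S (t + 1) \<omega>) \<omega>)) \<and>
           is_ess_sup M
             ((\<lambda>\<xi>. gen_cond_exp M (F t)
                (\<lambda>\<omega>. V (t + 1) (x + \<xi> \<omega> \<bullet> increment S (t + 1) \<omega>) \<omega>)) ` borel_measurable (F t))
             (\<lambda>\<omega>. ereal (V t x \<omega>))))"

definition assumption_A ::
  "'a measure \<Rightarrow> (nat \<Rightarrow> 'a measure) \<Rightarrow> (nat \<Rightarrow> 'a \<Rightarrow> real ^ 'd) \<Rightarrow> nat \<Rightarrow> (real \<Rightarrow> real) \<Rightarrow> bool" where
  "assumption_A M F S T U \<longleftrightarrow>
     (\<exists>V. regular_value_functions M F S T U V \<and>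
        (\<forall>x. expectation_defined M (V 0 x) \<and> gen_expectation M (V 0 x) < \<infinity>))"

definition admissible ::
  "'a measure \<Rightarrow> (nat \<Rightarrow> 'a measure) \<Rightarrow> (nat \<Rightarrow> 'a \<Rightarrow> real ^ 'd) \<Rightarrow> nat \<Rightarrow> (real \<Rightarrow> real) \<Rightarrow> real \<Rightarrow>
   (nat \<Rightarrow> 'a \<Rightarrow> real ^ 'd) set" where
  "admissible M F S T U c =
     {\<phi>\<in>strategies F T. expectation_defined M (\<lambda>\<omega>. U (wealth S c \<phi> T \<omega>))}"

definition optimal_value ::
  "'a measure \<Rightarrow> (nat \<Rightarrow> 'a measure) \<Rightarrow> (nat \<Rightarrow> 'a \<Rightarrow> real ^ 'd) \<Rightarrow> nat \<Rightarrow> (real \<Rightarrow> real) \<Rightarrow> real \<Rightarrow>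
   ereal" where
  "optimal_value M F S T U c =
     (SUP \<phi>\<in>admissible M F S T U c. gen_expectation M (\<lambda>\<omega>. U (wealth S c \<phi> T \<omega>)))"

definition optimal_strategy ::
  "'a measure \<Rightarrow> (nat \<Rightarrow> 'a measure) \<Rightarrow> (nat \<Rightarrow> 'a \<Rightarrow> real ^ 'd) \<Rightarrow> nat \<Rightarrow> (real \<Rightarrow> real) \<Rightarrow> real \<Rightarrow>
   (nat \<Rightarrow> 'a \<Rightarrow> real ^ 'd) \<Rightarrow> bool" where
  "optimal_strategy M F S T U c \<phi> \<longleftrightarrow>
     \<phi> \<in> admissible M F S T U c \<and>
     gen_expectation M (\<lambda>\<omega>. U (wealth S c \<phi> T \<omega>)) = optimal_value M F S T U c"

end

theory Submission
  imports Defs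
begin

text \<open>Halving a wealth reduces large gains by a smaller factor than large losses (this is what the two
  growth conditions say), and the expected utility from half the initial capital is bounded by
  \<open>E U\<^sub>0(c/2) < \<infinity>\<close>; so along a maximising sequence the expected losses stay bounded. Its strategies may
  be projected onto the spans of the supports of the conditional laws. On such strategies no-arbitrage
  makes the map from strategies to terminal wealth an embedding for convergence in probability, already
  when only the negative parts of the wealths are known to be small. Hence the terminal wealths are
  bounded in probability, strict concavity makes them Cauchy, and the strategies converge along a
  subsequence. The supermartingale property of the value functions supplies the domination needed for
  upper semicontinuity, so the limit is optimal. Uniqueness follows from strict concavity and the
  embedding. No optimiser of the one-step problems is ever selected.\<close>

section \<open>Supports and truncated first moments\<close>

text \<open>Increments need not be integrable, so the conditional laws are tested with moments
  divided by \<open>1 + norm y\<close>; these exist for every law and see the same signs and null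
  sets. Compactness of the unit sphere in the span turns no-arbitrage into a coercivity constant for
  each \<open>w\<close>, but as a random variable it need not be bounded away from 0. Hence
  estimates carry a weight \<open>m\<close>, and limits of wealths and positions are taken in
  probability instead of in mean.

  The work is done in the linear span of the support and not in its affine hull: differences,
  midpoints and multiples of strategies then stay in the class, and no-arbitrage makes the two sets
  agree almost surely.

  The limit filter is left arbitrary because the embedding is needed along rescaled sequences
  (boundedness), along pairs of indices (Cauchy property) and for a constant sequence (uniqueness).

  The value functions may fail to be integrable at intermediate times. Inequalities between
  conditional expectations are therefore kept as sums of non-negative extended reals on both sides,
  and a term is cancelled only where it is finite.\<close>

lemma AE_measure_support:
  fixes \<mu> :: "'b::second_countable_topology measure"
  assumes "sets \<mu> = sets borel"
  shows "AE y in \<mu>. y \<in> measure_support \<mu>"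
proof -
  obtain B :: "'b set set" where B: "countable B" "topological_basis B"
    using ex_countable_basis by blast
  \<comment> \<open>Second countability makes the complement of the support a countable union of
    null basic open sets.\<close>
  define N where "N = \<Union>{V\<in>B. emeasure \<mu> V = 0}"
  have op: "open V" if "V \<in> B" for V
    using B(2) that by (rule topological_basis_open)
  have "N \<in> null_sets \<mu>"
    unfolding N_def using B(1) op assms
    by (intro null_sets_UN'[where N="\<lambda>x. x", simplified]) (auto simp: null_sets_def)
  moreover have "y \<in> N" if "y \<notin> measure_support \<mu>" for y
  proof -
    have "\<exists>V. open V \<and> y \<in> V \<and> \<not> emeasure \<mu> V > 0"
      using that by (simp add: measure_support_def)
    then obtain V where V: "open V" "y \<in> V" "emeasure \<mu> V = 0"
      by (auto simp: zero_less_iff_neq_zero)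
    obtain W where W: "W \<in> B" "y \<in> W" "W \<subseteq> V"
      using topological_basisE[OF B(2) V(1,2)] by blast
    have "emeasure \<mu> W \<le> emeasure \<mu> V"
      using W V assms by (intro emeasure_mono) auto
    with V(3) W show ?thesis by (auto simp: N_def)
  qed
  ultimately show ?thesis
    by (intro AE_I'[of N]) auto
qed

lemma measure_support_closed_set:
  fixes \<mu> :: "'b::topological_space measure"
  assumes "sets \<mu> = sets borel" "closed C" "AE y in \<mu>. y \<in> C"
  shows "measure_support \<mu> \<subseteq> C"
proof (rule subsetI, rule ccontr)
  fix y assume y: "y \<in> measure_support \<mu>" "y \<notin> C"
  have sp: "space \<mu> = UNIV" using sets_eq_imp_space_eq[OF assms(1)] by simp
  have "emeasure \<mu> (- C) > 0"
    using y assms(2) by (auto simp: measure_support_def open_Compl)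
  moreover have "emeasure \<mu> (- C) = 0"
  proof (rule AE_iff_measurable[THEN iffD1, OF _ _ assms(3)])
    show "- C \<in> sets \<mu>" using assms(1,2) by simp
  qed (use sp in auto)
  ultimately show False by simp
qed

text \<open>Dividing by \<open>1 + norm y\<close> bounds the integrand by \<open>norm x\<close>, so
  the moment exists for every law, while the sign of \<open>x \<bullet> y\<close> is
  unchanged.\<close>

definition lower_moment :: "'b::real_inner measure \<Rightarrow> 'b \<Rightarrow> real" where
  "lower_moment \<mu> x = (\<integral>y. max 0 (- (x \<bullet> y)) / (1 + norm y) \<partial>\<mu>)"

definition abs_moment :: "'b::real_inner measure \<Rightarrow> 'b \<Rightarrow> real" where
  "abs_moment \<mu> x = (\<integral>y. \<bar>x \<bullet> y\<bar> / (1 + norm y) \<partial>\<mu>)"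

text \<open>The target is the span and not the affine hull of \<open>support_space\<close>, which
  makes this an orthogonal projection onto a linear subspace.\<close>

definition support_proj :: "'b::euclidean_space measure \<Rightarrow> 'b \<Rightarrow> 'b" where
  "support_proj \<mu> x = closest_point (span (measure_support \<mu>)) x"

lemma truncated_inner_le:
  fixes x y :: "'b::real_inner"
  shows "\<bar>x \<bullet> y\<bar> / (1 + norm y) \<le> norm x"
proof -
  have "\<bar>x \<bullet> y\<bar> \<le> norm x * norm y" by (rule Cauchy_Schwarz_ineq2)
  also have "\<dots> \<le> norm x * (1 + norm y)" by (intro mult_left_mono) auto
  finally show ?thesis
    by (subst pos_divide_le_eq) (auto intro: add_pos_nonneg)
qed

locale borel_prob = prob_space \<mu> for \<mu> :: "'b::euclidean_space measure" +
  assumes sets_eq[measurable_cong]: "sets \<mu> = sets borel"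
begin

abbreviation "D \<equiv> span (measure_support \<mu>)"

lemma integrable_abs_moment [simp]: "integrable \<mu> (\<lambda>y. \<bar>x \<bullet> y\<bar> / (1 + norm y))"
  by (intro integrable_const_bound[where B="norm x"])
     (auto intro!: AE_I2 truncated_inner_le)

lemma integrable_lower_moment [simp]: "integrable \<mu> (\<lambda>y. max 0 (- (x \<bullet> y)) / (1 + norm y))"
  by (rule Bochner_Integration.integrable_bound[OF integrable_abs_moment[of x]])
     (auto simp: divide_simps add_nonneg_eq_0_iff abs_if)

lemma lower_moment_nonneg: "lower_moment \<mu> x \<ge> 0"
  unfolding lower_moment_def by (intro Bochner_Integration.integral_nonneg) auto

lemma abs_moment_nonneg: "abs_moment \<mu> x \<ge> 0"
  unfolding abs_moment_def by (intro Bochner_Integration.integral_nonneg) auto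

lemma abs_moment_le: "abs_moment \<mu> x \<le> norm x"
  unfolding abs_moment_def
  using integral_mono[OF integrable_abs_moment[of x] integrable_const[of "norm x"]]
  by (simp add: truncated_inner_le prob_space)

text \<open>The bound by \<open>abs_moment\<close> instead of the norm serves twice: it gives
  Lipschitz continuity, and it shows that the lower moment ignores directions orthogonal to the
  support.\<close>

lemma lower_moment_diff_le: "lower_moment \<mu> x - lower_moment \<mu> x' \<le> abs_moment \<mu> (x - x')"
proof -
  have "lower_moment \<mu> x - lower_moment \<mu> x' =
        (\<integral>y. max 0 (- (x \<bullet> y)) / (1 + norm y) - max 0 (- (x' \<bullet> y)) / (1 + norm y) \<partial>\<mu>)"
    unfolding lower_moment_def by (rule Bochner_Integration.integral_diff[symmetric]) simp_all
  also have "\<dots> \<le> (\<integral>y. \<bar>(x - x') \<bullet> y\<bar> / (1 + norm y) \<partial>\<mu>)"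
  proof (rule integral_mono)
    fix y
    have "max 0 (- (x \<bullet> y)) - max 0 (- (x' \<bullet> y)) \<le> \<bar>(x - x') \<bullet> y\<bar>"
      by (auto simp: inner_diff_left)
    then show "max 0 (- (x \<bullet> y)) / (1 + norm y) - max 0 (- (x' \<bullet> y)) / (1 + norm y)
          \<le> \<bar>(x - x') \<bullet> y\<bar> / (1 + norm y)"
      unfolding diff_divide_distrib[symmetric] by (intro divide_right_mono) auto
  qed simp_all
  finally show ?thesis by (simp add: abs_moment_def)
qed

lemma abs_moment_diff_le: "abs_moment \<mu> x - abs_moment \<mu> x' \<le> abs_moment \<mu> (x - x')"
proof -
  have "abs_moment \<mu> x - abs_moment \<mu> x' =
        (\<integral>y. \<bar>x \<bullet> y\<bar> / (1 + norm y) - \<bar>x' \<bullet> y\<bar> / (1 + norm y) \<partial>\<mu>)"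
    unfolding abs_moment_def by (rule Bochner_Integration.integral_diff[symmetric]) simp_all
  also have "\<dots> \<le> (\<integral>y. \<bar>(x - x') \<bullet> y\<bar> / (1 + norm y) \<partial>\<mu>)"
  proof (rule integral_mono)
    fix y
    have "\<bar>x \<bullet> y\<bar> - \<bar>x' \<bullet> y\<bar> \<le> \<bar>(x - x') \<bullet> y\<bar>"
      by (auto simp: inner_diff_left)
    then show "\<bar>x \<bullet> y\<bar> / (1 + norm y) - \<bar>x' \<bullet> y\<bar> / (1 + norm y)
          \<le> \<bar>(x - x') \<bullet> y\<bar> / (1 + norm y)"
      unfolding diff_divide_distrib[symmetric] by (intro divide_right_mono) auto
  qed simp_all
  finally show ?thesis by (simp add: abs_moment_def)
qed

lemma abs_moment_minus: "abs_moment \<mu> (x - x') = abs_moment \<mu> (x' - x)"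
  unfolding abs_moment_def by (simp add: inner_diff_left abs_minus_commute)

lemma continuous_on_of_moment_bound:
  assumes "\<And>x x'. f x - f x' \<le> abs_moment \<mu> (x - x')"
  shows "continuous_on A f"
proof -
  have "1-lipschitz_on A f"
  proof (rule lipschitz_onI)
    fix x x'
    show "dist (f x) (f x') \<le> 1 * dist x x'"
      using assms[of x x'] assms[of x' x] abs_moment_le[of "x - x'"] abs_moment_minus[of x x']
      by (auto simp: dist_norm dist_real_def)
  qed simp
  then show ?thesis by (rule lipschitz_on_continuous_on)
qed

lemma continuous_on_lower_moment: "continuous_on A (lower_moment \<mu>)"
  by (rule continuous_on_of_moment_bound[OF lower_moment_diff_le])

lemma continuous_on_abs_moment: "continuous_on A (abs_moment \<mu>)"
  by (rule continuous_on_of_moment_bound[OF abs_moment_diff_le])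

lemma lower_moment_scale: "c \<ge> 0 \<Longrightarrow> lower_moment \<mu> (c *\<^sub>R x) = c * lower_moment \<mu> x"
proof -
  assume c: "c \<ge> 0"
  have "max 0 (- (c * (x \<bullet> y))) = c * max 0 (- (x \<bullet> y))" for y
    using c by (auto simp: max_def mult_le_0_iff zero_le_mult_iff)
  then show ?thesis
    unfolding lower_moment_def by (simp flip: times_divide_eq_right)
qed

lemma abs_moment_eq_0_iff_AE: "abs_moment \<mu> x = 0 \<longleftrightarrow> (AE y in \<mu>. x \<bullet> y = 0)"
proof -
  have "abs_moment \<mu> x = 0 \<longleftrightarrow> (AE y in \<mu>. \<bar>x \<bullet> y\<bar> / (1 + norm y) = 0)"
    unfolding abs_moment_def by (rule integral_nonneg_eq_0_iff_AE) auto
  also have "\<dots> \<longleftrightarrow> (AE y in \<mu>. x \<bullet> y = 0)"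
    by (intro AE_cong) (auto simp: add_nonneg_eq_0_iff)
  finally show ?thesis .
qed

text \<open>Orthogonality to \<open>x\<close> is a closed linear condition on \<open>y\<close>, so
  when it holds almost surely it passes to the support and from there to its span. Conversely almost
  every point lies in the support.\<close>

lemma abs_moment_eq_0_iff: "abs_moment \<mu> x = 0 \<longleftrightarrow> (\<forall>y\<in>D. x \<bullet> y = 0)"
proof
  assume "abs_moment \<mu> x = 0"
  then have "measure_support \<mu> \<subseteq> {y. x \<bullet> y = 0}"
    unfolding abs_moment_eq_0_iff_AE
    by (intro measure_support_closed_set sets_eq closed_hyperplane) auto
  then have "D \<subseteq> {y. x \<bullet> y = 0}"
    by (intro span_minimal subspace_hyperplane)
  then show "\<forall>y\<in>D. x \<bullet> y = 0" by auto
next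
  assume "\<forall>y\<in>D. x \<bullet> y = 0"
  then show "abs_moment \<mu> x = 0"
    unfolding abs_moment_eq_0_iff_AE
    by (intro eventually_mono[OF AE_measure_support[OF sets_eq]]) (auto intro: span_base)
qed

section \<open>Orthogonal projection onto the span of the support\<close>

lemma D_closed: "closed D" and D_convex: "convex D" and D_ne: "D \<noteq> {}"
  using span_zero by (auto intro: closed_subspace subspace_imp_convex)

lemma support_proj_in: "support_proj \<mu> x \<in> D"
  unfolding support_proj_def by (rule closest_point_in_set[OF D_closed D_ne])

lemma support_proj_orth: "y \<in> D \<Longrightarrow> (x - support_proj \<mu> x) \<bullet> y = 0"
proof -
  assume y: "y \<in> D"
  let ?p = "support_proj \<mu> x"
  have *: "(x - ?p) \<bullet> (z - ?p) \<le> 0" if "z \<in> D" for z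
    unfolding support_proj_def by (rule closest_point_dot[OF D_convex D_closed that])
  have "(x - ?p) \<bullet> y \<le> 0"
    using *[of "?p + y"] y support_proj_in[of x] by (simp add: span_add)
  moreover have "(x - ?p) \<bullet> (- y) \<le> 0"
    using *[of "?p - y"] y support_proj_in[of x] by (simp add: span_diff)
  ultimately show ?thesis by simp
qed

lemma support_proj_unique:
  assumes "p \<in> D" "\<And>y. y \<in> D \<Longrightarrow> (x - p) \<bullet> y = 0"
  shows "support_proj \<mu> x = p"
proof -
  let ?q = "support_proj \<mu> x"
  have d: "p - ?q \<in> D" using assms(1) support_proj_in by (rule span_diff)
  have "(p - ?q) \<bullet> (p - ?q) = 0"
    using assms(2)[OF d] support_proj_orth[OF d, of x] by (simp add: inner_diff_left)
  then show ?thesis by simp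
qed

lemma support_proj_scale: "support_proj \<mu> (c *\<^sub>R x) = c *\<^sub>R support_proj \<mu> x"
  using support_proj_in[of x] support_proj_orth[of _ x]
  by (intro support_proj_unique) (auto simp: span_scale simp flip: scaleR_right_diff_distrib)

lemma support_proj_self: "x \<in> D \<Longrightarrow> support_proj \<mu> x = x"
  by (rule support_proj_unique) auto

lemma abs_moment_proj: "abs_moment \<mu> (x - support_proj \<mu> x) = 0"
  by (simp add: abs_moment_eq_0_iff support_proj_orth)

lemma lower_moment_proj: "lower_moment \<mu> (support_proj \<mu> x) = lower_moment \<mu> x"
  using lower_moment_diff_le[of x "support_proj \<mu> x"] lower_moment_diff_le[of "support_proj \<mu> x" x]
    abs_moment_proj[of x] abs_moment_minus[of x "support_proj \<mu> x"] by simp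

lemma continuous_on_support_proj: "continuous_on A (support_proj \<mu>)"
  unfolding support_proj_def
  by (rule continuous_on_closest_point[OF D_convex D_closed D_ne])

text \<open>The zeros of \<open>abs_moment\<close> form the orthogonal complement of the span, so by
  Pythagoras the one nearest to \<open>x\<close> is the residual. In this form the projection is
  accessible to measurable minimisation over zeros.\<close>

lemma norm_diff_support_proj:
  assumes "abs_moment \<mu> z = 0" "norm (x - z) \<le> norm (support_proj \<mu> x)"
  shows "z = x - support_proj \<mu> x"
proof -
  let ?p = "support_proj \<mu> x"
  have z: "z \<bullet> ?p = 0" and w: "(x - ?p) \<bullet> ?p = 0"
    using assms(1) support_proj_in[of x] support_proj_orth[of ?p x]
    by (auto simp: abs_moment_eq_0_iff)
  have "orthogonal ?p (x - ?p - z)"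
    using z w by (simp add: orthogonal_def inner_diff_right inner_commute inner_diff_left)
  then have "norm (?p + (x - ?p - z)) ^ 2 = norm ?p ^ 2 + norm (x - ?p - z) ^ 2"
    by (rule norm_add_Pythagorean)
  moreover have "norm (x - z) ^ 2 \<le> norm ?p ^ 2" using assms(2) by (intro power_mono) auto
  ultimately have "norm (x - ?p - z) ^ 2 \<le> 0" by simp
  then show ?thesis by simp
qed

lemma norm_residual_le: "norm (x - support_proj \<mu> x) \<le> norm x"
proof -
  let ?p = "support_proj \<mu> x"
  have "orthogonal ?p (x - ?p)"
    using support_proj_orth[OF support_proj_in, of x x] by (simp add: orthogonal_def inner_commute)
  then have "norm (?p + (x - ?p)) ^ 2 = norm ?p ^ 2 + norm (x - ?p) ^ 2"
    by (rule norm_add_Pythagorean)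
  then have "norm (x - ?p) ^ 2 \<le> norm x ^ 2" by simp
  then show ?thesis by (rule power2_le_imp_le) simp
qed

text \<open>The hypothesis is the pointwise form of no-arbitrage: a direction without loss has no
  gain either. On the unit sphere of the span it excludes zeros of the continuous function
  \<open>lower_moment\<close>, compactness gives a positive minimum, and homogeneity extends the
  bound to all vectors.\<close>

lemma lower_moment_coercive:
  assumes "\<And>x. norm x \<le> 1 \<Longrightarrow> lower_moment \<mu> x = 0 \<Longrightarrow> abs_moment \<mu> x = 0"
  obtains \<delta> where "\<delta> > 0" "\<And>x. \<delta> * norm (support_proj \<mu> x) \<le> lower_moment \<mu> x"
proof -
  have comp: "compact (sphere 0 1 \<inter> D)" by (intro compact_Int_closed compact_sphere D_closed)
  have "\<exists>\<delta>>0. \<forall>x\<in>sphere 0 1 \<inter> D. \<delta> \<le> lower_moment \<mu> x"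
  proof (cases "sphere 0 1 \<inter> D = {}")
    case False
    obtain u where u: "u \<in> sphere 0 1 \<inter> D" "\<forall>x\<in>sphere 0 1 \<inter> D. lower_moment \<mu> u \<le> lower_moment \<mu> x"
      using continuous_attains_inf[OF comp False continuous_on_lower_moment] by blast
    have "abs_moment \<mu> u \<noteq> 0"
    proof
      assume "abs_moment \<mu> u = 0"
      then have "u \<bullet> u = 0" using u(1) by (auto simp: abs_moment_eq_0_iff)
      then show False using u(1) by auto
    qed
    then have "lower_moment \<mu> u \<noteq> 0" using assms[of u] u(1) by auto
    then show ?thesis using u lower_moment_nonneg[of u] by (intro exI[of _ "lower_moment \<mu> u"]) auto
  qed (auto intro: exI[of _ 1])
  then obtain \<delta> where \<delta>: "\<delta> > 0" "\<And>x. x \<in> sphere 0 1 \<inter> D \<Longrightarrow> \<delta> \<le> lower_moment \<mu> x" by blast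
  have "\<delta> * norm (support_proj \<mu> x) \<le> lower_moment \<mu> x" for x
  proof (cases "support_proj \<mu> x = 0")
    case False
    let ?p = "support_proj \<mu> x"
    have "\<delta> \<le> lower_moment \<mu> ((1 / norm ?p) *\<^sub>R ?p)"
      using False by (intro \<delta>(2)) (auto intro!: span_scale support_proj_in)
    also have "\<dots> = lower_moment \<mu> x / norm ?p"
      by (subst lower_moment_scale) (auto simp: lower_moment_proj)
    finally show ?thesis using False by (simp add: field_simps)
  qed (simp add: lower_moment_nonneg)
  with \<delta>(1) show thesis by (rule that)
qed

text \<open>Otherwise the point \<open>a\<close> of the hull nearest to 0 satisfies
  \<open>a \<bullet> y \<ge> a \<bullet> a > 0\<close> on the whole support. Such a direction never
  loses, and coercivity forces \<open>a = 0\<close>.\<close>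

lemma zero_in_affine_hull_support:
  assumes "\<And>x. norm x \<le> 1 \<Longrightarrow> lower_moment \<mu> x = 0 \<Longrightarrow> abs_moment \<mu> x = 0"
  shows "0 \<in> affine hull measure_support \<mu>"
proof (rule ccontr)
  let ?A = "affine hull measure_support \<mu>"
  assume 0: "0 \<notin> ?A"
  obtain \<delta> where \<delta>: "\<delta> > 0" "\<And>x. \<delta> * norm (support_proj \<mu> x) \<le> lower_moment \<mu> x"
    using lower_moment_coercive[OF assms] by blast
  have "measure_support \<mu> \<noteq> {}"
    using AE_measure_support[OF sets_eq] AE_False by auto
  then have ne: "?A \<noteq> {}" by simp
  define a where "a = closest_point ?A 0"
  have a: "a \<in> ?A" unfolding a_def by (rule closest_point_in_set[OF closed_affine_hull ne])
  have aD: "a \<in> D" using a affine_hull_subset_span by blast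
  have "a \<bullet> y \<ge> 0" if "y \<in> measure_support \<mu>" for y
  proof -
    have "(0 - a) \<bullet> (y - a) \<le> 0"
      unfolding a_def using that
      by (intro closest_point_dot affine_imp_convex affine_affine_hull closed_affine_hull) (auto intro: hull_inc)
    then have "a \<bullet> a \<le> a \<bullet> y" by (simp add: inner_diff_right)
    then show ?thesis using inner_ge_zero[of a] by linarith
  qed
  then have "AE y in \<mu>. max 0 (- (a \<bullet> y)) / (1 + norm y) = 0"
    by (intro eventually_mono[OF AE_measure_support[OF sets_eq]]) (auto simp: max_absorb1)
  then have "lower_moment \<mu> a = 0"
    unfolding lower_moment_def by (subst integral_cong_AE[where g="\<lambda>_. 0"]) auto
  with \<delta>(2)[of a] \<delta>(1) have "norm a \<le> 0"
    by (simp add: support_proj_self[OF aD] mult_le_0_iff)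
  with a 0 show False by simp
qed

text \<open>For a unit vector the integrand of the lower moment is at most 1 and vanishes where the
  vector gains, so the moment is at most the probability of the half-space. The \<open>min 1\<close>
  covers \<open>x = 0\<close>, where the half-space is everything and \<delta> may be large.\<close>

lemma emeasure_halfspace_ge:
  assumes "\<And>x. \<delta> * norm (support_proj \<mu> x) \<le> lower_moment \<mu> x" "x \<in> D"
  shows "ennreal (min 1 \<delta>) \<le> emeasure \<mu> {y. x \<bullet> y \<le> 0}"
proof (cases "x = 0")
  case True
  then show ?thesis using emeasure_space_1 sets_eq_imp_space_eq[OF sets_eq]
    by (simp flip: ennreal_1 add: ennreal_leI)
next
  case False
  let ?u = "(1 / norm x) *\<^sub>R x"
  have u: "?u \<in> D" by (intro span_scale assms)
  have "\<delta> \<le> lower_moment \<mu> ?u"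
    using assms(1)[of ?u] False by (simp add: support_proj_self[OF u])
  also have "\<dots> \<le> (\<integral>y. indicator {y. x \<bullet> y \<le> 0} y \<partial>\<mu>)"
    unfolding lower_moment_def
  proof (rule integral_mono)
    fix y
    have "max 0 (- (?u \<bullet> y)) \<le> \<bar>?u \<bullet> y\<bar>" by linarith
    then have "max 0 (- (?u \<bullet> y)) / (1 + norm y) \<le> \<bar>?u \<bullet> y\<bar> / (1 + norm y)"
      by (intro divide_right_mono) auto
    also have "\<dots> \<le> 1" using truncated_inner_le[of ?u y] False by simp
    finally have "max 0 (- (?u \<bullet> y)) / (1 + norm y) \<le> 1" .
    then show "max 0 (- (?u \<bullet> y)) / (1 + norm y) \<le> indicat_real {y. x \<bullet> y \<le> 0} y"
      by (auto simp: indicator_def max_def zero_le_divide_iff divide_le_0_iff not_le)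
  next
    show "integrable \<mu> (\<lambda>y. max 0 (- (?u \<bullet> y)) / (1 + norm y))" by (rule integrable_lower_moment)
  qed (auto intro!: integrable_real_indicator simp: emeasure_eq_measure)
  also have "\<dots> = measure \<mu> {y. x \<bullet> y \<le> 0}"
    using sets_eq_imp_space_eq[OF sets_eq] by simp
  finally show ?thesis
    unfolding emeasure_eq_measure by (intro ennreal_leI) auto
qed

end

section \<open>Measurable selection of minimisers\<close>

definition caratheodory :: "'a measure \<Rightarrow> 'b::topological_space set \<Rightarrow> ('a \<Rightarrow> 'b \<Rightarrow> real) \<Rightarrow> bool" where
  "caratheodory G K h \<longleftrightarrow>
     (\<forall>x\<in>K. (\<lambda>w. h w x) \<in> borel_measurable G) \<and> (\<forall>w\<in>space G. continuous_on K (h w))"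

text \<open>Encodes a random non-empty relatively closed subset of \<open>K\<close> as a zero set.
  Since the functions are non-negative, imposing a further condition amounts to adding another
  function.\<close>

definition constraint :: "'a measure \<Rightarrow> 'b::topological_space set \<Rightarrow> ('a \<Rightarrow> 'b \<Rightarrow> real) \<Rightarrow> bool" where
  "constraint G K h \<longleftrightarrow> caratheodory G K h \<and>
     (\<forall>w\<in>space G. (\<forall>x\<in>K. h w x \<ge> 0) \<and> (\<exists>x\<in>K. h w x = 0))"

text \<open>On a compact set a continuous non-negative function has a zero exactly when its infimum
  is 0, and the infimum can be tested on a countable dense subset.\<close>

lemma zero_exists_sets:
  fixes K :: "'b::euclidean_space set"
  assumes K: "compact K" and h: "caratheodory G K h"
    and pos: "\<And>w x. w \<in> space G \<Longrightarrow> x \<in> K \<Longrightarrow> h w x \<ge> 0"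
  shows "{w\<in>space G. \<exists>x\<in>K. h w x = 0} \<in> sets G"
proof -
  obtain D where D: "countable D" "D \<subseteq> K" "K \<subseteq> closure D"
    using separable[of K] by blast
  have "{w\<in>space G. \<exists>x\<in>K. h w x = 0} = {w\<in>space G. \<forall>n::nat. \<exists>x\<in>D. h w x < 1 / Suc n}"
  proof safe
    fix w x and n :: nat assume w: "w \<in> space G" and x: "x \<in> K" "h w x = 0"
    have "continuous_on K (h w)" using h w by (auto simp: caratheodory_def)
    then obtain \<delta> where \<delta>: "\<delta> > 0" "\<And>z. z \<in> K \<Longrightarrow> dist z x < \<delta> \<Longrightarrow> dist (h w z) (h w x) < 1 / Suc n"
      using x(1) unfolding continuous_on_iff
      by (elim ballE[of _ _ x] allE[of _ "1 / real (Suc n)"]) (auto simp: dist_commute)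
    obtain d where "d \<in> D" "dist d x < \<delta>"
      using D(3) x(1) \<delta>(1) closure_approachable by blast
    with \<delta>(2)[of d] D(2) x(2) show "\<exists>x\<in>D. h w x < 1 / Suc n"
      by (intro bexI[of _ d]) (auto simp: dist_real_def)
  next
    fix w assume w: "w \<in> space G" and *: "\<forall>n::nat. \<exists>x\<in>D. h w x < 1 / Suc n"
    have cont: "continuous_on K (h w)" using h w by (auto simp: caratheodory_def)
    have "K \<noteq> {}" using * D(2) by auto
    then obtain x where x: "x \<in> K" "\<And>z. z \<in> K \<Longrightarrow> h w x \<le> h w z"
      using continuous_attains_inf[OF K _ cont] by blast
    have "h w x < 1 / Suc n" for n :: nat
    proof -
      obtain d where "d \<in> D" "h w d < 1 / Suc n" using * by blast
      with x(2)[of d] D(2) show ?thesis by auto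
    qed
    then have "\<not> h w x > 0"
      by (meson nat_approx_posE order_less_asym)
    with x(1) pos[OF w, of x] show "\<exists>x\<in>K. h w x = 0" by (intro bexI[of _ x]) auto
  qed
  also have "\<dots> \<in> sets G"
  proof -
    have [measurable]: "(\<lambda>w. h w x) \<in> borel_measurable G" if "x \<in> D" for x
      using h D(2) that by (auto simp: caratheodory_def)
    have "{w\<in>space G. \<exists>x\<in>D. h w x < 1 / Suc n} \<in> sets G" for n :: nat
      using D(1) by measurable
    then show ?thesis by (intro sets.sets_Collect_countable_All)
  qed
  finally show ?thesis .
qed

text \<open>The minimal value is at most \<open>a\<close> exactly when
  \<open>h w x + max 0 (r w x - a)\<close> has a zero in \<open>K\<close>, so its sublevel sets are
  covered by \<open>zero_exists_sets\<close>. The minimiser \<open>z\<close> itself is chosen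
  without regard to measurability; only the value attained at it is claimed to be
  measurable.\<close>

lemma constrained_min_measurable:
  fixes K :: "'b::euclidean_space set"
  assumes K: "compact K" and h: "constraint G K h" and r: "caratheodory G K r"
  shows "\<exists>s\<in>borel_measurable G. \<forall>w\<in>space G.
           (\<exists>x\<in>K. h w x = 0 \<and> r w x = s w) \<and> (\<forall>x\<in>K. h w x = 0 \<longrightarrow> s w \<le> r w x)"
proof -
  have pos: "h w x \<ge> 0" if "w \<in> space G" "x \<in> K" for w x
    using h that by (auto simp: constraint_def)
  have "\<exists>z\<in>K. h w z = 0 \<and> (\<forall>x\<in>K. h w x = 0 \<longrightarrow> r w z \<le> r w x)" if w: "w \<in> space G" for w
  proof -
    let ?Z = "{x\<in>K. h w x = 0}"
    have ch: "continuous_on K (h w)" and cr: "continuous_on K (r w)"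
      using h r w by (auto simp: caratheodory_def constraint_def)
    have "closed ?Z"
      using continuous_closed_preimage[OF ch compact_imp_closed[OF K] closed_singleton[of 0]]
      by (auto simp: vimage_def Int_def)
    then have Z: "compact ?Z"
      using compact_Int_closed[OF K, of ?Z] by (simp add: Int_absorb1 subset_eq)
    have "?Z \<noteq> {}" using h w by (auto simp: constraint_def)
    moreover have "continuous_on ?Z (r w)" by (rule continuous_on_subset[OF cr]) auto
    ultimately obtain z where "z \<in> ?Z" "\<forall>x\<in>?Z. r w z \<le> r w x"
      using continuous_attains_inf[OF Z, of "r w"] by blast
    then show ?thesis by auto
  qed
  then obtain z where z: "\<forall>w\<in>space G. z w \<in> K \<and> h w (z w) = 0 \<and>
      (\<forall>x\<in>K. h w x = 0 \<longrightarrow> r w (z w) \<le> r w x)"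
    by metis
  have "(\<lambda>w. r w (z w)) \<in> borel_measurable G"
  proof (rule borel_measurableI_le)
    fix a
    have "{w\<in>space G. r w (z w) \<le> a} = {w\<in>space G. \<exists>x\<in>K. h w x + max 0 (r w x - a) = 0}"
    proof (intro Collect_cong conj_cong refl)
      fix w assume w: "w \<in> space G"
      have "h w x + max 0 (r w x - a) = 0 \<longleftrightarrow> h w x = 0 \<and> r w x \<le> a" if "x \<in> K" for x
        using pos[OF w that] by (auto simp: max_def)
      then show "r w (z w) \<le> a \<longleftrightarrow> (\<exists>x\<in>K. h w x + max 0 (r w x - a) = 0)"
        using z w by (metis order.trans)
    qed
    moreover have "caratheodory G K (\<lambda>w x. h w x + max 0 (r w x - a))"
      using h r by (auto simp: caratheodory_def constraint_def intro!: continuous_intros borel_measurable_add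
          borel_measurable_max borel_measurable_diff)
    then have "{w\<in>space G. \<exists>x\<in>K. h w x + max 0 (r w x - a) = 0} \<in> sets G"
      using pos by (intro zero_exists_sets[OF K]) auto
    ultimately show "{w\<in>space G. r w (z w) \<le> a} \<in> sets G" by simp
  qed
  with z show ?thesis by (intro bexI[of _ "\<lambda>w. r w (z w)"]) auto
qed

text \<open>The minimisers of \<open>r\<close> among the zeros of \<open>h\<close> are the zeros of \<open>h'\<close>, so they can be constrained
  further. Minimising all coordinates in turn leaves a single point.\<close>

lemma constrain_to_min:
  fixes K :: "'b::euclidean_space set"
  assumes K: "compact K" and h: "constraint G K h" and r: "caratheodory G K r"
  shows "\<exists>h' s. constraint G K h' \<and> s \<in> borel_measurable G \<and> (\<forall>w\<in>space G. \<forall>x\<in>K.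
           (h' w x = 0 \<longrightarrow> h w x = 0 \<and> r w x = s w) \<and> (h w x = 0 \<longrightarrow> s w \<le> r w x))"
proof -
  obtain s where s: "s \<in> borel_measurable G" "\<forall>w\<in>space G.
      (\<exists>x\<in>K. h w x = 0 \<and> r w x = s w) \<and> (\<forall>x\<in>K. h w x = 0 \<longrightarrow> s w \<le> r w x)"
    using constrained_min_measurable[OF K h r] by blast
  have "constraint G K (\<lambda>w x. h w x + \<bar>r w x - s w\<bar>)"
    unfolding constraint_def
  proof (intro conjI ballI)
    show "caratheodory G K (\<lambda>w x. h w x + \<bar>r w x - s w\<bar>)"
      using h r s(1) by (auto simp: caratheodory_def constraint_def intro!: continuous_intros
          borel_measurable_add borel_measurable_abs borel_measurable_diff)
    fix w assume "w \<in> space G"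
    then obtain x where "x \<in> K" "h w x = 0" "r w x = s w" using s(2) by blast
    then show "\<exists>x\<in>K. h w x + \<bar>r w x - s w\<bar> = 0" by (intro bexI[of _ x]) auto
  qed (use h in \<open>auto simp: constraint_def intro!: add_nonneg_nonneg\<close>)
  moreover have "h w x = 0 \<and> r w x = s w"
    if "w \<in> space G" "x \<in> K" "h w x + \<bar>r w x - s w\<bar> = 0" for w x
  proof -
    have "h w x \<ge> 0" using h that by (auto simp: constraint_def)
    then show ?thesis using that(3) by linarith
  qed
  ultimately show ?thesis
    using s by (intro exI[of _ "\<lambda>w x. h w x + \<bar>r w x - s w\<bar>"] exI[of _ s]) blast
qed

lemma measurable_zero_selection:
  fixes K :: "'b::euclidean_space set"
  assumes K: "compact K" and h: "constraint G K h"
  shows "\<exists>\<xi>\<in>borel_measurable G. \<forall>w\<in>space G. \<xi> w \<in> K \<and> h w (\<xi> w) = 0"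
proof -
  have "\<exists>h' c. constraint G K h' \<and> (\<forall>b\<in>B. c b \<in> borel_measurable G) \<and>
      (\<forall>w\<in>space G. \<forall>x\<in>K. h' w x = 0 \<longrightarrow> h w x = 0 \<and> (\<forall>b\<in>B. x \<bullet> b = c b w))"
    if "finite B" for B :: "'b set"
    using that
  proof (induction B)
    case empty
    then show ?case using h by (intro exI[of _ h]) auto
  next
    case (insert b B)
    then obtain h1 and c :: "'b \<Rightarrow> 'a \<Rightarrow> real" where h1: "constraint G K h1"
      "\<forall>b\<in>B. c b \<in> borel_measurable G"
      "\<forall>w\<in>space G. \<forall>x\<in>K. h1 w x = 0 \<longrightarrow> h w x = 0 \<and> (\<forall>b\<in>B. x \<bullet> b = c b w)"
      by blast
    have r: "caratheodory G K (\<lambda>w x. x \<bullet> b)"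
      by (auto simp: caratheodory_def intro!: continuous_intros)
    obtain h' s where h': "constraint G K h'" "s \<in> borel_measurable G"
      "\<forall>w\<in>space G. \<forall>x\<in>K. h' w x = 0 \<longrightarrow> h1 w x = 0 \<and> x \<bullet> b = s w"
      using constrain_to_min[OF K h1(1) r] by blast
    show ?case
    proof (intro exI[of _ h'] exI[of _ "c(b := s)"] conjI ballI impI)
      fix b' assume "b' \<in> insert b B"
      then show "(c(b := s)) b' \<in> borel_measurable G" using h1(2) h'(2) by (cases "b' = b") auto
    next
      fix w x b' assume w: "w \<in> space G" "x \<in> K" "h' w x = 0"
      then have *: "h1 w x = 0" "x \<bullet> b = s w" using h'(3) by blast+
      then show "h w x = 0" using h1(3) w by blast
      assume "b' \<in> insert b B"
      then show "x \<bullet> b' = (c(b := s)) b' w" using h1(3) w * by (cases "b' = b") auto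
    qed (use h' in blast)+
  qed
  \<comment> \<open>With every coordinate prescribed by a measurable function, the surviving zero
    can be rebuilt from its coordinates.\<close>
  from this[OF finite_Basis] obtain h' and c :: "'b \<Rightarrow> 'a \<Rightarrow> real" where h': "constraint G K h'"
    "\<forall>b\<in>Basis. c b \<in> borel_measurable G"
    "\<forall>w\<in>space G. \<forall>x\<in>K. h' w x = 0 \<longrightarrow> h w x = 0 \<and> (\<forall>b\<in>Basis. x \<bullet> b = c b w)"
    by blast
  show ?thesis
  proof (intro bexI[of _ "\<lambda>w. \<Sum>b\<in>Basis. c b w *\<^sub>R b"] ballI)
    show "(\<lambda>w. \<Sum>b\<in>Basis. c b w *\<^sub>R b) \<in> borel_measurable G"
      using h'(2) by (intro borel_measurable_sum borel_measurable_scaleR) auto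
    fix w assume w: "w \<in> space G"
    then obtain x where x: "x \<in> K" "h' w x = 0" using h'(1) by (auto simp: constraint_def)
    then have *: "h w x = 0" "\<forall>b\<in>Basis. x \<bullet> b = c b w" using h'(3) w by auto
    have "(\<Sum>b\<in>Basis. c b w *\<^sub>R b) = (\<Sum>b\<in>Basis. (x \<bullet> b) *\<^sub>R b)"
      using *(2) by (intro sum.cong) auto
    then show "(\<Sum>b\<in>Basis. c b w *\<^sub>R b) \<in> K \<and> h w (\<Sum>b\<in>Basis. c b w *\<^sub>R b) = 0"
      using x *(1) by (simp add: euclidean_representation)
  qed
qed

text \<open>It serves two selections below: the point nearest to a given vector in the kernel of
  \<open>abs_moment\<close>, and the direction of vanishing \<open>lower_moment\<close> with the
  largest \<open>abs_moment\<close>.\<close>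

lemma measurable_argmin_selection:
  fixes K :: "'b::euclidean_space set"
  assumes K: "compact K" and h: "constraint G K h" and r: "caratheodory G K r"
  shows "\<exists>\<xi>\<in>borel_measurable G. \<forall>w\<in>space G. \<xi> w \<in> K \<and> h w (\<xi> w) = 0 \<and>
           (\<forall>x\<in>K. h w x = 0 \<longrightarrow> r w (\<xi> w) \<le> r w x)"
proof -
  obtain h' s where h': "constraint G K h'" "\<forall>w\<in>space G. \<forall>x\<in>K.
      (h' w x = 0 \<longrightarrow> h w x = 0 \<and> r w x = s w) \<and> (h w x = 0 \<longrightarrow> s w \<le> r w x)"
    using constrain_to_min[OF K h r] by blast
  obtain \<xi> where \<xi>: "\<xi> \<in> borel_measurable G" "\<forall>w\<in>space G. \<xi> w \<in> K \<and> h' w (\<xi> w) = 0"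
    using measurable_zero_selection[OF K h'(1)] by blast
  show ?thesis
    by (rule bexI[OF _ \<xi>(1)]) (use \<xi>(2) h'(2) in fastforce)
qed

section \<open>Conditional laws and the local no-arbitrage estimate\<close>

locale cond_law = prob_space M for M :: "'a measure" +
  fixes G :: "'a measure" and Y :: "'a \<Rightarrow> 'b::euclidean_space" and \<kappa> :: "'a \<Rightarrow> 'b measure"
  assumes subalg: "subalgebra M G"
    and Y_meas[measurable]: "Y \<in> borel_measurable M"
    and rcd: "regular_cond_distr M G Y \<kappa>"
begin

abbreviation "L w \<equiv> span (measure_support (\<kappa> w))"

definition one_period_NA :: bool where
  "one_period_NA \<longleftrightarrow> (\<forall>\<xi>\<in>borel_measurable G. (AE w in M. \<xi> w \<bullet> Y w \<ge> 0) \<longrightarrow> (AE w in M. \<xi> w \<bullet> Y w = 0))"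

lemma space_G: "space G = space M"
  using subalg by (simp add: subalgebra_def)

lemma meas_G: "f \<in> measurable G N \<Longrightarrow> f \<in> measurable M N"
  by (rule measurable_from_subalg[OF subalg])

lemma kernel_meas[measurable]: "\<kappa> \<in> G \<rightarrow>\<^sub>M subprob_algebra borel"
  using rcd by (auto simp: regular_cond_distr_def intro: measurable_prob_algebraD)

lemma kernel_meas_M: "\<kappa> \<in> M \<rightarrow>\<^sub>M subprob_algebra borel"
  by (intro meas_G kernel_meas)

lemma borel_prob_kernel: "w \<in> space M \<Longrightarrow> borel_prob (\<kappa> w)"
proof -
  assume "w \<in> space M"
  then have "\<kappa> w \<in> space (prob_algebra borel)"
    using rcd space_G by (auto simp: regular_cond_distr_def dest: measurable_space)
  then show "borel_prob (\<kappa> w)"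
    by (auto simp: space_prob_algebra borel_prob_def borel_prob_axioms_def)
qed

text \<open>Both sides integrate \<open>f\<close> against a measure on
  \<open>G \<Otimes>\<^sub>M borel\<close>: the joint law of the identity and \<open>Y\<close>, and
  the mixture of the kernels. On rectangles the two agree by the defining property of conditional
  expectation, and rectangles are an intersection-stable generator.\<close>

lemma disintegration:
  assumes f[measurable]: "f \<in> borel_measurable (G \<Otimes>\<^sub>M borel)"
  shows "(\<integral>\<^sup>+w. f (w, Y w) \<partial>M) = (\<integral>\<^sup>+w. (\<integral>\<^sup>+y. f (w, y) \<partial>\<kappa> w) \<partial>M)"
proof -
  interpret G: sigma_finite_subalgebra M G
    by (rule finite_measure_subalgebra_is_sigma_finite)
       (unfold_locales, rule subalg)
  have id[measurable]: "(\<lambda>w. w) \<in> M \<rightarrow>\<^sub>M G" by (rule meas_G) measurable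
  have [measurable]: "(\<lambda>x. x) \<in> M \<Otimes>\<^sub>M borel \<rightarrow>\<^sub>M G \<Otimes>\<^sub>M (borel :: 'b measure)"
    using measurable_Pair[OF measurable_compose[OF measurable_fst id] measurable_snd[of M borel]] by simp
  define \<mu>1 where "\<mu>1 = distr M (G \<Otimes>\<^sub>M borel) (\<lambda>w. (w, Y w))"
  define N where "N = (\<lambda>w. distr (\<kappa> w) (G \<Otimes>\<^sub>M borel) (Pair w))"
  define \<mu>2 where "\<mu>2 = M \<bind> N"
  note [measurable] = kernel_meas_M
  have N: "N \<in> M \<rightarrow>\<^sub>M subprob_algebra (G \<Otimes>\<^sub>M borel)"
    unfolding N_def by (rule measurable_distr2[OF _ kernel_meas_M]) simp
  have s1: "sets \<mu>1 = sets (G \<Otimes>\<^sub>M borel)" by (simp add: \<mu>1_def)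
  have s2: "sets \<mu>2 = sets (G \<Otimes>\<^sub>M borel)"
    unfolding \<mu>2_def by (rule sets_bind[OF sets_kernel[OF N]]) (auto simp: not_empty)
  have pair_meas: "Pair w \<in> measurable (\<kappa> w) (G \<Otimes>\<^sub>M borel)" if "w \<in> space M" for w
    using that space_G sets_kernel[OF kernel_meas_M that]
    by (metis measurable_Pair1' measurable_cong_sets)
  have rect: "emeasure \<mu>1 (A \<times> B) = emeasure \<mu>2 (A \<times> B)" if [measurable]: "A \<in> sets G" "B \<in> sets borel" for A B
  proof -
    have [measurable]: "A \<in> sets M" using that(1) subalg by (auto simp: subalgebra_def)
    have "emeasure \<mu>1 (A \<times> B) = (\<integral>\<^sup>+w. indicator (A \<times> B) (w, Y w) \<partial>M)"
    proof -
      have "emeasure \<mu>1 (A \<times> B) = (\<integral>\<^sup>+z. indicator (A \<times> B) z \<partial>\<mu>1)"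
        by (rule nn_integral_indicator[symmetric]) (simp add: s1)
      then show ?thesis unfolding \<mu>1_def by (simp only:) (rule nn_integral_distr; simp)
    qed
    also have "\<dots> = (\<integral>\<^sup>+w. indicator A w * indicator B (Y w) \<partial>M)"
      by (intro nn_integral_cong) (auto split: split_indicator)
    also have "\<dots> = (\<integral>\<^sup>+w. indicator A w * nn_cond_exp M G (\<lambda>w. indicator B (Y w)) w \<partial>M)"
      by (rule G.nn_cond_exp_intg[symmetric]) auto
    also have "\<dots> = (\<integral>\<^sup>+w. indicator A w * emeasure (\<kappa> w) B \<partial>M)"
    proof (rule nn_integral_cong_AE)
      have "AE w in M. emeasure (\<kappa> w) B = nn_cond_exp M G (\<lambda>w. indicator B (Y w)) w"
        using rcd that(2) by (auto simp: regular_cond_distr_def)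
      then show "AE w in M. indicator A w * nn_cond_exp M G (\<lambda>w. indicator B (Y w)) w =
          indicator A w * emeasure (\<kappa> w) B"
        by eventually_elim simp
    qed
    also have "\<dots> = (\<integral>\<^sup>+w. emeasure (N w) (A \<times> B) \<partial>M)"
    proof (rule nn_integral_cong)
      fix w assume w: "w \<in> space M"
      have "emeasure (N w) (A \<times> B) = emeasure (\<kappa> w) (Pair w -` (A \<times> B) \<inter> space (\<kappa> w))"
        unfolding N_def by (rule emeasure_distr[OF pair_meas[OF w]]) simp
      also have "Pair w -` (A \<times> B) \<inter> space (\<kappa> w) = (if w \<in> A then B else {})"
        using sets_eq_imp_space_eq[OF sets_kernel[OF kernel_meas_M w]] by auto
      finally show "indicator A w * emeasure (\<kappa> w) B = emeasure (N w) (A \<times> B)" by auto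
    qed
    also have "\<dots> = emeasure \<mu>2 (A \<times> B)"
      unfolding \<mu>2_def by (rule emeasure_bind[symmetric, OF _ N]) (auto simp: not_empty)
    finally show ?thesis .
  qed
  have "\<mu>1 = \<mu>2"
  proof (rule measure_eqI_generator_eq[where A="\<lambda>_. space G \<times> UNIV" and \<Omega>="space G \<times> UNIV"
        and E="{a \<times> b |a b. a \<in> sets G \<and> b \<in> sets borel}"])
    show "Int_stable {a \<times> b |a b. a \<in> sets G \<and> b \<in> sets (borel :: 'b measure)}"
      by (rule Int_stable_pair_measure_generator)
    show "{a \<times> b |a b. a \<in> sets G \<and> b \<in> sets (borel :: 'b measure)} \<subseteq> Pow (space G \<times> UNIV)"
      using pair_measure_closed[of G borel] by simp
    show "sets \<mu>1 = sigma_sets (space G \<times> UNIV) {a \<times> b |a b. a \<in> sets G \<and> b \<in> sets borel}"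
      by (simp add: s1 sets_pair_measure)
    show "sets \<mu>2 = sigma_sets (space G \<times> UNIV) {a \<times> b |a b. a \<in> sets G \<and> b \<in> sets borel}"
      by (simp add: s2 sets_pair_measure)
    show "emeasure \<mu>1 (space G \<times> UNIV) \<noteq> \<infinity>"
      unfolding \<mu>1_def by (subst emeasure_distr) auto
    show "range (\<lambda>_. space G \<times> UNIV) \<subseteq> {a \<times> b |a b. a \<in> sets G \<and> b \<in> sets (borel :: 'b measure)}"
      using sets.top[of G] space_borel sets.top[of borel] by blast
  qed (use rect in auto)
  then have "(\<integral>\<^sup>+z. f z \<partial>\<mu>1) = (\<integral>\<^sup>+z. f z \<partial>\<mu>2)" by simp
  also have "(\<integral>\<^sup>+z. f z \<partial>\<mu>1) = (\<integral>\<^sup>+w. f (w, Y w) \<partial>M)"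
    unfolding \<mu>1_def by (rule nn_integral_distr) auto
  also have "(\<integral>\<^sup>+z. f z \<partial>\<mu>2) = (\<integral>\<^sup>+w. (\<integral>\<^sup>+z. f z \<partial>N w) \<partial>M)"
    unfolding \<mu>2_def by (rule nn_integral_bind[OF f N])
  also have "\<dots> = (\<integral>\<^sup>+w. (\<integral>\<^sup>+y. f (w, y) \<partial>\<kappa> w) \<partial>M)"
    unfolding N_def by (intro nn_integral_cong nn_integral_distr pair_meas) auto
  finally show ?thesis .
qed

section \<open>Truncated moments and projections for the conditional law\<close>

lemma one_plus_norm_pos: "0 < 1 + norm (y :: 'b)"
  by (simp add: add_pos_nonneg)

lemma ennreal_truncated_eq_0: "ennreal (a / (1 + norm (y :: 'b))) = 0 \<longleftrightarrow> a \<le> 0"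
  using one_plus_norm_pos[of y] by (simp add: ennreal_eq_0_iff pos_divide_le_eq)

lemma ennreal_abs_moment:
  "w \<in> space M \<Longrightarrow> ennreal (abs_moment (\<kappa> w) x) = (\<integral>\<^sup>+y. ennreal (\<bar>x \<bullet> y\<bar> / (1 + norm y)) \<partial>\<kappa> w)"
proof -
  assume "w \<in> space M"
  then interpret k: borel_prob "\<kappa> w" by (rule borel_prob_kernel)
  show ?thesis
    unfolding abs_moment_def by (rule nn_integral_eq_integral[symmetric]) auto
qed

lemma ennreal_lower_moment:
  "w \<in> space M \<Longrightarrow>
     ennreal (lower_moment (\<kappa> w) x) = (\<integral>\<^sup>+y. ennreal (max 0 (- (x \<bullet> y)) / (1 + norm y)) \<partial>\<kappa> w)"
proof -
  assume "w \<in> space M"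
  then interpret k: borel_prob "\<kappa> w" by (rule borel_prob_kernel)
  show ?thesis
    unfolding lower_moment_def by (rule nn_integral_eq_integral[symmetric]) auto
qed

context
  fixes \<xi> :: "'a \<Rightarrow> 'b"
  assumes \<xi>[measurable]: "\<xi> \<in> borel_measurable G"
begin

lemma abs_moment_meas: "(\<lambda>w. abs_moment (\<kappa> w) (\<xi> w)) \<in> borel_measurable G"
proof -
  have "(\<lambda>w. enn2real (\<integral>\<^sup>+y. ennreal (\<bar>\<xi> w \<bullet> y\<bar> / (1 + norm y)) \<partial>\<kappa> w)) \<in> borel_measurable G"
    by (intro borel_measurable_enn2real nn_integral_measurable_subprob_algebra2[OF _ kernel_meas]) simp
  moreover have "enn2real (\<integral>\<^sup>+y. ennreal (\<bar>\<xi> w \<bullet> y\<bar> / (1 + norm y)) \<partial>\<kappa> w) = abs_moment (\<kappa> w) (\<xi> w)"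
    if "w \<in> space G" for w
    using borel_prob.abs_moment_nonneg[OF borel_prob_kernel, of w] that space_G
    by (simp flip: ennreal_abs_moment)
  ultimately show ?thesis by (simp cong: measurable_cong)
qed

lemma lower_moment_meas: "(\<lambda>w. lower_moment (\<kappa> w) (\<xi> w)) \<in> borel_measurable G"
proof -
  have "(\<lambda>w. enn2real (\<integral>\<^sup>+y. ennreal (max 0 (- (\<xi> w \<bullet> y)) / (1 + norm y)) \<partial>\<kappa> w)) \<in> borel_measurable G"
    by (intro borel_measurable_enn2real nn_integral_measurable_subprob_algebra2[OF _ kernel_meas]) simp
  moreover have "enn2real (\<integral>\<^sup>+y. ennreal (max 0 (- (\<xi> w \<bullet> y)) / (1 + norm y)) \<partial>\<kappa> w) =
      lower_moment (\<kappa> w) (\<xi> w)" if "w \<in> space G" for w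
    using borel_prob.lower_moment_nonneg[OF borel_prob_kernel, of w] that space_G
    by (simp flip: ennreal_lower_moment)
  ultimately show ?thesis by (simp cong: measurable_cong)
qed

lemma integral_abs_moment:
  "(\<integral>\<^sup>+w. ennreal (abs_moment (\<kappa> w) (\<xi> w)) \<partial>M) =
   (\<integral>\<^sup>+w. ennreal (\<bar>\<xi> w \<bullet> Y w\<bar> / (1 + norm (Y w))) \<partial>M)"
proof -
  have "(\<lambda>(w, y). ennreal (\<bar>\<xi> w \<bullet> y\<bar> / (1 + norm y))) \<in> borel_measurable (G \<Otimes>\<^sub>M borel)"
    by measurable
  from disintegration[OF this] show ?thesis
    by (simp add: ennreal_abs_moment cong: nn_integral_cong)
qed

lemma integral_lower_moment:
  "(\<integral>\<^sup>+w. ennreal (lower_moment (\<kappa> w) (\<xi> w)) \<partial>M) =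
   (\<integral>\<^sup>+w. ennreal (max 0 (- (\<xi> w \<bullet> Y w)) / (1 + norm (Y w))) \<partial>M)"
proof -
  have "(\<lambda>(w, y). ennreal (max 0 (- (\<xi> w \<bullet> y)) / (1 + norm y))) \<in> borel_measurable (G \<Otimes>\<^sub>M borel)"
    by measurable
  from disintegration[OF this] show ?thesis
    by (simp add: ennreal_lower_moment cong: nn_integral_cong)
qed

text \<open>Two non-negative functions with equal integrals vanish almost everywhere
  together.\<close>

lemma abs_moment_AE_0_iff:
  "(AE w in M. abs_moment (\<kappa> w) (\<xi> w) = 0) \<longleftrightarrow> (AE w in M. \<xi> w \<bullet> Y w = 0)"
proof -
  note [measurable] = meas_G[OF abs_moment_meas] meas_G[OF \<xi>]
  have "(AE w in M. abs_moment (\<kappa> w) (\<xi> w) = 0) \<longleftrightarrow>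
      (AE w in M. ennreal (abs_moment (\<kappa> w) (\<xi> w)) = 0)"
    by (intro AE_cong) (simp add: ennreal_eq_0_iff antisym_conv borel_prob.abs_moment_nonneg[OF borel_prob_kernel])
  also have "\<dots> \<longleftrightarrow> (AE w in M. ennreal (\<bar>\<xi> w \<bullet> Y w\<bar> / (1 + norm (Y w))) = 0)"
    using integral_abs_moment by (subst (1 2) nn_integral_0_iff_AE[symmetric]) auto
  also have "\<dots> \<longleftrightarrow> (AE w in M. \<xi> w \<bullet> Y w = 0)"
    by (intro AE_cong) (simp add: ennreal_truncated_eq_0)
  finally show ?thesis .
qed

text \<open>The subspace moves with \<open>w\<close>, so continuity of each projection does not give
  measurability in \<open>w\<close>. The residual is instead selected as the nearest zero of
  \<open>abs_moment\<close>. Selection needs a fixed compact set, hence the rescaling of \<xi> into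
  the unit ball, where the residual stays as well; homogeneity undoes the rescaling.\<close>

lemma support_proj_meas: "(\<lambda>w. support_proj (\<kappa> w) (\<xi> w)) \<in> borel_measurable G"
proof -
  define \<xi>0 where "\<xi>0 w = (1 / (1 + norm (\<xi> w))) *\<^sub>R \<xi> w" for w
  have [measurable]: "\<xi>0 \<in> borel_measurable G" unfolding \<xi>0_def by measurable
  have norm0: "norm (\<xi>0 w) \<le> 1" for w
    using one_plus_norm_pos[of "\<xi> w"] by (simp add: \<xi>0_def pos_divide_le_eq)
  have "constraint G (cball 0 1) (\<lambda>w. abs_moment (\<kappa> w))"
    unfolding constraint_def caratheodory_def
  proof (intro conjI ballI)
    fix x :: 'b
    have "(\<lambda>\<mu>. abs_moment \<mu> x) \<in> borel_measurable (subprob_algebra borel)"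
      unfolding abs_moment_def by measurable
    from measurable_compose[OF kernel_meas this]
    show "(\<lambda>w. abs_moment (\<kappa> w) x) \<in> borel_measurable G" .
  next
    fix w assume "w \<in> space G"
    then interpret k: borel_prob "\<kappa> w" using borel_prob_kernel space_G by simp
    show "continuous_on (cball 0 1) (abs_moment (\<kappa> w))" by (rule k.continuous_on_abs_moment)
    show "abs_moment (\<kappa> w) x \<ge> 0" for x by (rule k.abs_moment_nonneg)
    show "\<exists>x\<in>cball 0 1. abs_moment (\<kappa> w) x = 0"
      by (intro bexI[of _ 0]) (auto simp: k.abs_moment_eq_0_iff)
  qed
  moreover have "caratheodory G (cball 0 1) (\<lambda>w x. norm (\<xi>0 w - x))"
    unfolding caratheodory_def by (intro conjI ballI continuous_intros) measurable
  ultimately obtain \<eta> where [measurable]: "\<eta> \<in> borel_measurable G" and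
    \<eta>: "\<forall>w\<in>space G. \<eta> w \<in> cball 0 1 \<and> abs_moment (\<kappa> w) (\<eta> w) = 0 \<and>
      (\<forall>x\<in>cball 0 1. abs_moment (\<kappa> w) x = 0 \<longrightarrow> norm (\<xi>0 w - \<eta> w) \<le> norm (\<xi>0 w - x))"
    using measurable_argmin_selection[OF compact_cball] by blast
  have "support_proj (\<kappa> w) (\<xi> w) = (1 + norm (\<xi> w)) *\<^sub>R (\<xi>0 w - \<eta> w)" if w: "w \<in> space G" for w
  proof -
    interpret k: borel_prob "\<kappa> w" using borel_prob_kernel space_G w by simp
    let ?z = "\<xi>0 w - support_proj (\<kappa> w) (\<xi>0 w)"
    have "?z \<in> cball 0 1" "abs_moment (\<kappa> w) ?z = 0"
      using k.norm_residual_le[of "\<xi>0 w"] norm0[of w] k.abs_moment_proj by auto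
    then have "norm (\<xi>0 w - \<eta> w) \<le> norm (\<xi>0 w - ?z)" using \<eta> w by blast
    then have "\<eta> w = ?z"
      using \<eta> w by (intro k.norm_diff_support_proj) auto
    then have "\<xi>0 w - \<eta> w = (1 / (1 + norm (\<xi> w))) *\<^sub>R support_proj (\<kappa> w) (\<xi> w)"
      by (simp add: \<xi>0_def k.support_proj_scale)
    then show ?thesis by (simp add: add_nonneg_eq_0_iff)
  qed
  then show ?thesis by (subst measurable_cong) auto
qed

end

text \<open>The residual is orthogonal to the conditional support and therefore earns
  nothing.\<close>

lemma support_proj_gains:
  assumes [measurable]: "\<xi> \<in> borel_measurable G"
  shows "AE w in M. support_proj (\<kappa> w) (\<xi> w) \<bullet> Y w = \<xi> w \<bullet> Y w"
proof -
  note [measurable] = support_proj_meas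
  have "AE w in M. (\<xi> w - support_proj (\<kappa> w) (\<xi> w)) \<bullet> Y w = 0"
    by (subst abs_moment_AE_0_iff[symmetric])
       (auto intro!: AE_I2 borel_prob.abs_moment_proj borel_prob_kernel)
  then show ?thesis by eventually_elim (simp add: inner_diff_left)
qed

text \<open>Among the directions without conditional loss, select measurably one with the largest
  absolute moment. As a position it never loses, so no-arbitrage makes its gain and hence its
  absolute moment vanish; all competing moments are smaller.\<close>

lemma local_no_arbitrage:
  assumes NA: one_period_NA
  shows "AE w in M. \<forall>x. norm x \<le> 1 \<longrightarrow> lower_moment (\<kappa> w) x = 0 \<longrightarrow> abs_moment (\<kappa> w) x = 0"
proof -
  have cara: "caratheodory G (cball 0 1) (\<lambda>w. lower_moment (\<kappa> w))"
    "caratheodory G (cball 0 1) (\<lambda>w x. - abs_moment (\<kappa> w) x)"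
    unfolding caratheodory_def
    by (intro conjI ballI borel_measurable_uminus abs_moment_meas lower_moment_meas continuous_intros
        borel_prob.continuous_on_abs_moment borel_prob.continuous_on_lower_moment borel_prob_kernel;
        simp add: space_G)+
  then have "constraint G (cball 0 1) (\<lambda>w. lower_moment (\<kappa> w))"
    unfolding constraint_def
    by (auto intro!: borel_prob.lower_moment_nonneg borel_prob_kernel bexI[of _ 0] simp: space_G)
       (simp add: lower_moment_def)
  from measurable_argmin_selection[OF compact_cball this cara(2)]
  obtain \<xi> where \<xi>: "\<xi> \<in> borel_measurable G" "\<forall>w\<in>space G. \<xi> w \<in> cball 0 1 \<and>
      lower_moment (\<kappa> w) (\<xi> w) = 0 \<and> (\<forall>x\<in>cball 0 1. lower_moment (\<kappa> w) x = 0 \<longrightarrow>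
      abs_moment (\<kappa> w) x \<le> abs_moment (\<kappa> w) (\<xi> w))"
    by auto
  note [measurable] = meas_G[OF \<xi>(1)]
  have "(\<integral>\<^sup>+w. ennreal (max 0 (- (\<xi> w \<bullet> Y w)) / (1 + norm (Y w))) \<partial>M) =
      (\<integral>\<^sup>+w. ennreal (lower_moment (\<kappa> w) (\<xi> w)) \<partial>M)"
    by (rule integral_lower_moment[OF \<xi>(1), symmetric])
  also have "\<dots> = (\<integral>\<^sup>+w. 0 \<partial>M)"
    using \<xi>(2) space_G by (intro nn_integral_cong) auto
  finally have "AE w in M. ennreal (max 0 (- (\<xi> w \<bullet> Y w)) / (1 + norm (Y w))) = 0"
    by (subst nn_integral_0_iff_AE[symmetric]) auto
  then have "AE w in M. \<xi> w \<bullet> Y w \<ge> 0"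
    by eventually_elim (simp add: ennreal_truncated_eq_0)
  from NA[unfolded one_period_NA_def, rule_format, OF \<xi>(1) this] have "AE w in M. abs_moment (\<kappa> w) (\<xi> w) = 0"
    using abs_moment_AE_0_iff[OF \<xi>(1)] by simp
  with AE_space show ?thesis
  proof eventually_elim
    case (elim w)
    then interpret k: borel_prob "\<kappa> w" using borel_prob_kernel by simp
    show ?case using elim \<xi>(2) space_G k.abs_moment_nonneg by (fastforce intro: antisym)
  qed
qed

text \<open>\<open>lower_moment_coercive\<close> yields some constant for each \<open>w\<close>,
  without measurability. The infimum of the ratio over a countable dense set is measurable, at least
  as large as any such constant capped at 1, and continuity carries its bound from the dense set to
  all vectors. The cap fits the \<open>min 1\<close> in
  \<open>emeasure_halfspace_ge\<close>.\<close>

lemma coercivity_constant: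
  assumes NA: one_period_NA
  obtains m where "m \<in> borel_measurable G" "\<And>w. m w \<le> 1"
    "AE w in M. m w > 0 \<and> (\<forall>x. m w * norm (support_proj (\<kappa> w) x) \<le> lower_moment (\<kappa> w) x)"
proof -
  obtain X :: "'b set" where X: "countable X" "\<And>V. open V \<Longrightarrow> V \<noteq> {} \<Longrightarrow> \<exists>d\<in>X. d \<in> V"
    using countable_dense_setE by blast
  have Xne: "X \<noteq> {}" using X(2)[of UNIV] by auto
  have XU: "closure X = UNIV"
    using X(2)[of "- closure X"] closure_subset[of X] by (auto simp: open_Compl)
  \<comment> \<open>Where the projection vanishes the inequality is trivial; the default 1 keeps the
    infimum positive.\<close>
  define q where "q w x = (if support_proj (\<kappa> w) x = 0 then 1
      else lower_moment (\<kappa> w) x / norm (support_proj (\<kappa> w) x))" for w x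
  have q0: "q w x \<ge> 0" if "w \<in> space M" for w x
    using borel_prob.lower_moment_nonneg[OF borel_prob_kernel[OF that]] by (auto simp: q_def)
  have bdd: "bdd_below (q w ` X)" if "w \<in> space M" for w
    using q0[OF that] by (intro bdd_belowI[of _ 0]) auto
  define m where "m w = min 1 (INF x\<in>X. q w x)" for w
  have [measurable]: "(\<lambda>w. q w x) \<in> borel_measurable G" for x
  proof -
    have [measurable]: "(\<lambda>w. support_proj (\<kappa> w) x) \<in> borel_measurable G"
      "(\<lambda>w. lower_moment (\<kappa> w) x) \<in> borel_measurable G"
      by (auto intro: support_proj_meas lower_moment_meas)
    show ?thesis unfolding q_def by measurable
  qed
  have "m \<in> borel_measurable G"
    unfolding m_def using bdd space_G
    by (intro borel_measurable_min borel_measurable_const borel_measurable_cINF_real[OF X(1)]) auto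
  moreover have "AE w in M. m w > 0 \<and> (\<forall>x. m w * norm (support_proj (\<kappa> w) x) \<le> lower_moment (\<kappa> w) x)"
    using local_no_arbitrage[OF NA] AE_space
  proof eventually_elim
    case (elim w)
    then interpret k: borel_prob "\<kappa> w" using borel_prob_kernel by simp
    obtain \<delta> where \<delta>: "\<delta> > 0" "\<And>x. \<delta> * norm (support_proj (\<kappa> w) x) \<le> lower_moment (\<kappa> w) x"
      using k.lower_moment_coercive elim(1) by metis
    have "min 1 \<delta> \<le> q w x" for x
      using \<delta>(2)[of x] by (auto simp: q_def pos_le_divide_eq min_le_iff_disj)
    then have "min 1 \<delta> \<le> (INF x\<in>X. q w x)" using Xne by (intro cINF_greatest)
    then have pos: "m w > 0" using \<delta>(1) by (auto simp: m_def)
    have "X \<subseteq> {x. m w * norm (support_proj (\<kappa> w) x) \<le> lower_moment (\<kappa> w) x}"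
    proof safe
      fix x assume "x \<in> X"
      then have "(INF x\<in>X. q w x) \<le> q w x" using elim bdd by (intro cINF_lower)
      then have "m w \<le> q w x" by (auto simp: m_def)
      then show "m w * norm (support_proj (\<kappa> w) x) \<le> lower_moment (\<kappa> w) x"
        using k.lower_moment_nonneg[of x] by (auto simp: q_def field_simps split: if_splits)
    qed
    moreover have "closed {x. m w * norm (support_proj (\<kappa> w) x) \<le> lower_moment (\<kappa> w) x}"
      by (intro closed_Collect_le continuous_intros k.continuous_on_support_proj k.continuous_on_lower_moment)
    ultimately have "UNIV \<subseteq> {x. m w * norm (support_proj (\<kappa> w) x) \<le> lower_moment (\<kappa> w) x}"
      unfolding XU[symmetric] by (rule closure_minimal)
    with pos show ?case by auto
  qed
  ultimately show thesis by (intro that[of m]) (auto simp: m_def)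
qed

text \<open>One weight \<open>m\<close> serves both estimates. By the first, a position in
  \<open>L\<close> fails to gain with conditional probability at least \<open>m\<close>, which
  carries losses backwards in time. By the second, a position with small losses is itself
  small.\<close>

lemma no_arbitrage_estimates:
  assumes NA: one_period_NA
  shows "\<exists>m\<in>borel_measurable M. (AE w in M. m w > 0) \<and>
    (\<forall>\<xi>\<in>borel_measurable G. (AE w in M. \<xi> w \<in> L w) \<longrightarrow>
      (\<forall>Z\<in>borel_measurable G. (\<integral>\<^sup>+w. ennreal (m w) * ennreal (Z w) \<partial>M) \<le>
         (\<integral>\<^sup>+w. ennreal (Z w) * indicator {w. \<xi> w \<bullet> Y w \<le> 0} w \<partial>M)) \<and>
      (\<integral>\<^sup>+w. ennreal (m w) * ennreal (min 1 (norm (\<xi> w))) \<partial>M) \<le>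
         (\<integral>\<^sup>+w. ennreal (min 1 (max 0 (- (\<xi> w \<bullet> Y w)))) \<partial>M))"
proof -
  obtain m where m: "m \<in> borel_measurable G" "\<And>w. m w \<le> 1"
    "AE w in M. m w > 0 \<and> (\<forall>x. m w * norm (support_proj (\<kappa> w) x) \<le> lower_moment (\<kappa> w) x)"
    using coercivity_constant[OF NA] by blast
  show ?thesis
  proof (intro bexI[of _ m] conjI ballI impI)
    show "m \<in> borel_measurable M" by (rule meas_G[OF m(1)])
    show "AE w in M. m w > 0" using m(3) by auto
  next
    fix \<xi> :: "'a \<Rightarrow> 'b" and Z :: "'a \<Rightarrow> real"
    assume \<xi>[measurable]: "\<xi> \<in> borel_measurable G" and D: "AE w in M. \<xi> w \<in> L w"
      and Z[measurable]: "Z \<in> borel_measurable G"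
    have "(\<integral>\<^sup>+w. ennreal (m w) * ennreal (Z w) \<partial>M) \<le>
        (\<integral>\<^sup>+w. (\<integral>\<^sup>+y. ennreal (Z w) * indicator {y. \<xi> w \<bullet> y \<le> 0} y \<partial>\<kappa> w) \<partial>M)"
    proof (rule nn_integral_mono_AE)
      show "AE w in M. ennreal (m w) * ennreal (Z w) \<le>
          (\<integral>\<^sup>+y. ennreal (Z w) * indicator {y. \<xi> w \<bullet> y \<le> 0} y \<partial>\<kappa> w)"
        using D m(3) AE_space
      proof eventually_elim
        case (elim w)
        then interpret k: borel_prob "\<kappa> w" using borel_prob_kernel by simp
        have "ennreal (min 1 (m w)) \<le> emeasure (\<kappa> w) {y. \<xi> w \<bullet> y \<le> 0}"
          using elim by (intro k.emeasure_halfspace_ge) auto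
        then show ?case
          using m(2)[of w] by (simp add: nn_integral_cmult_indicator k.sets_eq mult.commute mult_left_mono)
      qed
    qed
    also have "\<dots> = (\<integral>\<^sup>+w. ennreal (Z w) * indicator {y. \<xi> w \<bullet> y \<le> 0} (Y w) \<partial>M)"
    proof -
      have "(\<lambda>(w, y). ennreal (Z w) * indicator {y. \<xi> w \<bullet> y \<le> 0} y) \<in> borel_measurable (G \<Otimes>\<^sub>M borel)"
        by measurable
      from disintegration[OF this] show ?thesis by simp
    qed
    also have "\<dots> = (\<integral>\<^sup>+w. ennreal (Z w) * indicator {w. \<xi> w \<bullet> Y w \<le> 0} w \<partial>M)"
      by (simp add: indicator_def)
    finally show "(\<integral>\<^sup>+w. ennreal (m w) * ennreal (Z w) \<partial>M) \<le> \<dots>" .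
  next
    fix \<xi> :: "'a \<Rightarrow> 'b"
    assume \<xi>[measurable]: "\<xi> \<in> borel_measurable G" and D: "AE w in M. \<xi> w \<in> L w"
    \<comment> \<open>Cutting \<xi> back to norm at most 1 keeps it in the span and bounds the
      truncated loss both by 1 and by the loss of \<xi>.\<close>
    define \<xi>1 where "\<xi>1 w = (1 / max 1 (norm (\<xi> w))) *\<^sub>R \<xi> w" for w
    have [measurable]: "\<xi>1 \<in> borel_measurable G" unfolding \<xi>1_def by measurable
    have n1: "norm (\<xi>1 w) = min 1 (norm (\<xi> w))" for w
      by (auto simp: \<xi>1_def max_def min_def)
    have "(\<integral>\<^sup>+w. ennreal (m w) * ennreal (min 1 (norm (\<xi> w))) \<partial>M) \<le>
        (\<integral>\<^sup>+w. ennreal (lower_moment (\<kappa> w) (\<xi>1 w)) \<partial>M)"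
    proof (rule nn_integral_mono_AE)
      show "AE w in M. ennreal (m w) * ennreal (min 1 (norm (\<xi> w))) \<le> ennreal (lower_moment (\<kappa> w) (\<xi>1 w))"
        using D m(3) AE_space
      proof eventually_elim
        case (elim w)
        then interpret k: borel_prob "\<kappa> w" using borel_prob_kernel by simp
        have "support_proj (\<kappa> w) (\<xi>1 w) = \<xi>1 w"
          unfolding \<xi>1_def using elim(1) by (intro k.support_proj_self span_scale)
        then have "m w * norm (\<xi>1 w) \<le> lower_moment (\<kappa> w) (\<xi>1 w)" using elim(2) by metis
        then show ?case using elim(2) by (simp add: n1 ennreal_leI flip: ennreal_mult)
      qed
    qed
    also have "\<dots> = (\<integral>\<^sup>+w. ennreal (max 0 (- (\<xi>1 w \<bullet> Y w)) / (1 + norm (Y w))) \<partial>M)"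
      by (rule integral_lower_moment) simp
    also have "\<dots> \<le> (\<integral>\<^sup>+w. ennreal (min 1 (max 0 (- (\<xi> w \<bullet> Y w)))) \<partial>M)"
    proof (intro nn_integral_mono ennreal_leI)
      fix w
      have "max 0 (- (\<xi>1 w \<bullet> Y w)) \<le> \<bar>\<xi>1 w \<bullet> Y w\<bar>" by linarith
      then have "max 0 (- (\<xi>1 w \<bullet> Y w)) / (1 + norm (Y w)) \<le> \<bar>\<xi>1 w \<bullet> Y w\<bar> / (1 + norm (Y w))"
        by (intro divide_right_mono) auto
      also have "\<dots> \<le> 1" using truncated_inner_le[of "\<xi>1 w" "Y w"] n1[of w] by simp
      finally have 1: "max 0 (- (\<xi>1 w \<bullet> Y w)) / (1 + norm (Y w)) \<le> 1" .
      have "max 0 (- (\<xi>1 w \<bullet> Y w)) / (1 + norm (Y w)) \<le> max 0 (- (\<xi>1 w \<bullet> Y w)) / 1"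
        by (intro divide_left_mono) (auto simp: add_pos_nonneg)
      also have "- (\<xi>1 w \<bullet> Y w) = (1 / max 1 (norm (\<xi> w))) * (- (\<xi> w \<bullet> Y w))"
        by (simp add: \<xi>1_def)
      also have "max 0 \<dots> \<le> max 0 (- (\<xi> w \<bullet> Y w))"
      proof (cases "- (\<xi> w \<bullet> Y w) \<ge> 0")
        case True
        then have "(1 / max 1 (norm (\<xi> w))) * (- (\<xi> w \<bullet> Y w)) \<le> 1 * (- (\<xi> w \<bullet> Y w))"
          by (intro mult_right_mono) (auto simp: divide_simps)
        then show ?thesis by auto
      qed (auto simp: max_def mult_le_0_iff divide_simps)
      finally show "max 0 (- (\<xi>1 w \<bullet> Y w)) / (1 + norm (Y w)) \<le> min 1 (max 0 (- (\<xi> w \<bullet> Y w)))"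
        using 1 by (simp add: \<xi>1_def)
    qed
    finally show "(\<integral>\<^sup>+w. ennreal (m w) * ennreal (min 1 (norm (\<xi> w))) \<partial>M) \<le>
       (\<integral>\<^sup>+w. ennreal (min 1 (max 0 (- (\<xi> w \<bullet> Y w)))) \<partial>M)" .
  qed
qed

lemma AE_affine_hull_eq_span:
  assumes NA: one_period_NA
  shows "AE w in M. affine hull measure_support (\<kappa> w) = L w"
  using local_no_arbitrage[OF NA] AE_space
proof eventually_elim
  case (elim w)
  then interpret k: borel_prob "\<kappa> w" using borel_prob_kernel by simp
  show ?case
    using elim(1) by (intro affine_hull_span_0 k.zero_in_affine_hull_support) auto
qed

end

section \<open>Convergence in probability of strategies\<close>

text \<open>The scheme behind the limits in probability: \<open>n\<close> fixes an exceptional event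
  of size \<open>e n\<close>, and off that event \<open>b n\<close> controls the quantity.\<close>

lemma tendsto_0_of_approx:
  fixes a :: "'i \<Rightarrow> real"
  assumes "\<And>i. a i \<ge> 0" and "\<And>n::nat. (b n \<longlongrightarrow> 0) Fi" and "e \<longlonglongrightarrow> 0"
    and "\<And>n i. a i \<le> e n + b n i"
  shows "(a \<longlongrightarrow> 0) Fi"
proof (rule tendstoI)
  fix \<epsilon> :: real assume "\<epsilon> > 0"
  then have "eventually (\<lambda>n. e n < \<epsilon> / 2) sequentially"
    using assms(3) by (intro order_tendstoD) auto
  then obtain n where n: "e n < \<epsilon> / 2" by (auto simp: eventually_sequentially)
  have "eventually (\<lambda>i. b n i < \<epsilon> / 2) Fi"
    using assms(2)[of n] \<open>\<epsilon> > 0\<close> by (intro order_tendstoD) auto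
  then show "eventually (\<lambda>i. dist (a i) 0 < \<epsilon>) Fi"
  proof eventually_elim
    case (elim i)
    show ?case using elim n assms(1)[of i] assms(4)[of i n] by (simp add: dist_real_def)
  qed
qed

text \<open>The functional whose convergence to 0 is convergence to 0 in probability; it is finite
  without any integrability of \<open>f\<close>.\<close>

definition (in prob_space) prob_size :: "('a \<Rightarrow> real) \<Rightarrow> real" where
  "prob_size f = (\<integral>w. min 1 \<bar>f w\<bar> \<partial>M)"

context prob_space
begin

lemma prob_size_nonneg: "prob_size f \<ge> 0"
  unfolding prob_size_def by (intro Bochner_Integration.integral_nonneg) auto

lemma integrable_min_abs [simp]:
  "f \<in> borel_measurable M \<Longrightarrow> integrable M (\<lambda>w. min 1 \<bar>f w :: real\<bar>)"
  by (intro integrable_const_bound[where B=1]) auto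

lemma ennreal_prob_size:
  "f \<in> borel_measurable M \<Longrightarrow> ennreal (prob_size f) = (\<integral>\<^sup>+w. ennreal (min 1 \<bar>f w\<bar>) \<partial>M)"
  unfolding prob_size_def by (rule nn_integral_eq_integral[symmetric]) auto

lemma prob_size_mono:
  assumes "f \<in> borel_measurable M" "g \<in> borel_measurable M" "AE w in M. \<bar>f w\<bar> \<le> \<bar>g w\<bar>"
  shows "prob_size f \<le> prob_size g"
  unfolding prob_size_def
  by (intro integral_mono_AE integrable_min_abs assms eventually_mono[OF assms(3)]) auto

lemma prob_size_add:
  assumes [measurable]: "f \<in> borel_measurable M" "g \<in> borel_measurable M"
  shows "prob_size (\<lambda>w. f w + g w) \<le> prob_size f + prob_size g"
proof -
  have "prob_size (\<lambda>w. f w + g w) \<le> (\<integral>w. min 1 \<bar>f w\<bar> + min 1 \<bar>g w\<bar> \<partial>M)"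
    unfolding prob_size_def by (intro integral_mono Bochner_Integration.integrable_add integrable_min_abs) auto
  also have "\<dots> = prob_size f + prob_size g"
    unfolding prob_size_def by (intro Bochner_Integration.integral_add) auto
  finally show ?thesis .
qed

lemma prob_size_tendsto_mono:
  assumes "\<And>i. f i \<in> borel_measurable M" "\<And>i. g i \<in> borel_measurable M"
    "\<And>i. AE w in M. \<bar>f i w\<bar> \<le> \<bar>g i w\<bar>" "((\<lambda>i. prob_size (g i)) \<longlongrightarrow> 0) Fi"
  shows "((\<lambda>i. prob_size (f i)) \<longlongrightarrow> 0) Fi"
  by (rule tendsto_sandwich[OF _ _ tendsto_const assms(4)])
     (auto intro!: always_eventually prob_size_nonneg prob_size_mono assms)

lemma prob_size_tendsto_add:
  assumes "\<And>i. f i \<in> borel_measurable M" "\<And>i. g i \<in> borel_measurable M"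
    "((\<lambda>i. prob_size (f i)) \<longlongrightarrow> 0) Fi" "((\<lambda>i. prob_size (g i)) \<longlongrightarrow> 0) Fi"
  shows "((\<lambda>i. prob_size (\<lambda>w. f i w + g i w)) \<longlongrightarrow> 0) Fi"
proof (rule tendsto_sandwich[OF _ _ tendsto_const])
  show "((\<lambda>i. prob_size (f i) + prob_size (g i)) \<longlongrightarrow> 0) Fi"
    using tendsto_add[OF assms(3,4)] by simp
qed (auto intro!: always_eventually prob_size_nonneg prob_size_add assms)

lemma prob_decseq_tendsto_0:
  assumes "\<And>n. A n \<in> events" "decseq A" "AE w in M. w \<notin> (\<Inter>n. A n)"
  shows "(\<lambda>n. prob (A n)) \<longlonglongrightarrow> 0"
proof -
  have "(\<lambda>n. prob (A n)) \<longlonglongrightarrow> prob (\<Inter>n. A n)"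
    using assms by (intro finite_Lim_measure_decseq) auto
  moreover have "prob (\<Inter>n. A n) = 0"
    using assms by (subst prob_eq_0) auto
  ultimately show ?thesis by simp
qed

text \<open>\<open>Y\<close> is only known to be finite, but it exceeds \<open>n\<close> on an event
  whose probability tends to 0. The factor \<open>1 + real n\<close> is at least 1, which allows it
  to be pulled out of \<open>min 1\<close>.\<close>

lemma prob_size_tendsto_mult:
  assumes [measurable]: "\<And>i. f i \<in> borel_measurable M" "Y \<in> borel_measurable M"
    and lim: "((\<lambda>i. prob_size (f i)) \<longlongrightarrow> 0) Fi"
  shows "((\<lambda>i. prob_size (\<lambda>w. f i w * Y w)) \<longlongrightarrow> 0) Fi"
proof (rule tendsto_0_of_approx[where b="\<lambda>n i. (1 + real n) * prob_size (f i)"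
      and e="\<lambda>n. prob {w\<in>space M. real n < \<bar>Y w\<bar>}"])
  show "((\<lambda>i. (1 + real n) * prob_size (f i)) \<longlongrightarrow> 0) Fi" for n
    using tendsto_mult_left[OF lim, of "1 + real n"] by simp
  show "(\<lambda>n. prob {w\<in>space M. real n < \<bar>Y w\<bar>}) \<longlonglongrightarrow> 0"
  proof (rule prob_decseq_tendsto_0)
    show "AE w in M. w \<notin> (\<Inter>n. {w\<in>space M. real n < \<bar>Y w\<bar>})"
    proof (rule AE_I2)
      fix w
      obtain n :: nat where "\<bar>Y w\<bar> < real n" using reals_Archimedean2 by blast
      then show "w \<notin> (\<Inter>n. {w\<in>space M. real n < \<bar>Y w\<bar>})" by (auto intro!: exI[of _ n])
    qed
  qed (auto simp: decseq_def)
  show "prob_size (\<lambda>w. f i w * Y w) \<le>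
      prob {w\<in>space M. real n < \<bar>Y w\<bar>} + (1 + real n) * prob_size (f i)" for n i
  proof -
    have "prob_size (\<lambda>w. f i w * Y w) \<le>
        (\<integral>w. indicator {w\<in>space M. real n < \<bar>Y w\<bar>} w + (1 + real n) * min 1 \<bar>f i w\<bar> \<partial>M)"
      unfolding prob_size_def
    proof (intro integral_mono Bochner_Integration.integrable_add integrable_min_abs
        integrable_mult_right integrable_real_indicator)
      fix w assume w: "w \<in> space M"
      show "min 1 \<bar>f i w * Y w\<bar> \<le>
          indicator {w\<in>space M. real n < \<bar>Y w\<bar>} w + (1 + real n) * min 1 \<bar>f i w\<bar>"
      proof (cases "real n < \<bar>Y w\<bar>")
        case False
        have "\<bar>f i w * Y w\<bar> \<le> \<bar>f i w\<bar> * (1 + real n)"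
          unfolding abs_mult using False by (intro mult_left_mono) auto
        moreover have "min 1 (\<bar>f i w\<bar> * (1 + real n)) \<le> (1 + real n) * min 1 \<bar>f i w\<bar>"
          using mult_nonneg_nonneg[of "\<bar>f i w\<bar>" "real n"] by (auto simp: min_def algebra_simps)
        ultimately show ?thesis using False by (auto simp: min_def mult.commute split: if_splits)
      qed (use w in \<open>auto simp: min_le_iff_disj\<close>)
    qed (auto simp: emeasure_eq_measure)
    also have "\<dots> = prob {w\<in>space M. real n < \<bar>Y w\<bar>} + (1 + real n) * prob_size (f i)"
      unfolding prob_size_def
      by (subst Bochner_Integration.integral_add) (auto simp: emeasure_eq_measure)
    finally show ?thesis .
  qed
qed (rule prob_size_nonneg)

text \<open>Removes the random weight of \<open>no_arbitrage_estimates\<close> in the limit: an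
  almost surely positive \<open>m\<close> is below \<open>1 / (1 + n)\<close> only on an event whose
  probability tends to 0.\<close>

lemma prob_size_tendsto_weight:
  assumes [measurable]: "\<And>i. f i \<in> borel_measurable M" "m \<in> borel_measurable M"
    and pos: "AE w in M. m w > 0"
    and le: "\<And>i. (\<integral>\<^sup>+w. ennreal (m w) * ennreal (min 1 \<bar>f i w\<bar>) \<partial>M) \<le> ennreal (a i)"
    and lim: "(a \<longlongrightarrow> 0) Fi" and a: "\<And>i. a i \<ge> 0"
  shows "((\<lambda>i. prob_size (f i)) \<longlongrightarrow> 0) Fi"
proof (rule tendsto_0_of_approx[where b="\<lambda>n i. (1 + real n) * a i"
      and e="\<lambda>n. prob {w\<in>space M. m w * (1 + real n) < 1}"])
  show "((\<lambda>i. (1 + real n) * a i) \<longlongrightarrow> 0) Fi" for n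
    using tendsto_mult_left[OF lim, of "1 + real n"] by simp
  show "(\<lambda>n. prob {w\<in>space M. m w * (1 + real n) < 1}) \<longlonglongrightarrow> 0"
  proof (rule prob_decseq_tendsto_0)
    show "AE w in M. w \<notin> (\<Inter>n. {w\<in>space M. m w * (1 + real n) < 1})"
      using pos
    proof eventually_elim
      case (elim w)
      obtain n :: nat where "1 / m w < real n" using reals_Archimedean2 by blast
      then have "1 \<le> m w * (1 + real n)" using elim by (simp add: field_simps)
      then show ?case by (auto intro!: exI[of _ n] simp: not_less)
    qed
    have "m w * (1 + real n) < 1" if "m w * (1 + real n') < 1" "n \<le> n'" for w n n'
    proof (cases "m w \<ge> 0")
      case True
      then have "m w * (1 + real n) \<le> m w * (1 + real n')" using that by (intro mult_left_mono) auto
      with that show ?thesis by simp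
    next
      case False
      then have "m w * (1 + real n) \<le> 0" by (auto simp: mult_le_0_iff)
      then show ?thesis by simp
    qed
    then show "decseq (\<lambda>n. {w\<in>space M. m w * (1 + real n) < 1})"
      by (auto simp: decseq_def)
  qed auto
  show "prob_size (f i) \<le> prob {w\<in>space M. m w * (1 + real n) < 1} + (1 + real n) * a i" for n i
  proof -
    let ?A = "{w\<in>space M. m w * (1 + real n) < 1}"
    have "ennreal (prob_size (f i)) \<le>
        (\<integral>\<^sup>+w. indicator ?A w + ennreal (1 + real n) * (ennreal (m w) * ennreal (min 1 \<bar>f i w\<bar>)) \<partial>M)"
      unfolding ennreal_prob_size[OF assms(1)]
    proof (rule nn_integral_mono)
      fix w assume w: "w \<in> space M"
      show "ennreal (min 1 \<bar>f i w\<bar>) \<le>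
          indicator ?A w + ennreal (1 + real n) * (ennreal (m w) * ennreal (min 1 \<bar>f i w\<bar>))"
      proof (cases "w \<in> ?A")
        case True
        have "ennreal (min 1 \<bar>f i w\<bar>) \<le> ennreal 1" by (intro ennreal_leI) auto
        with True show ?thesis by (simp add: add_increasing2)
      next
        case False
        then have ge: "m w * (1 + real n) \<ge> 1" using w by auto
        then have "m w \<ge> 0" by (smt (verit) mult_nonpos_nonneg of_nat_0_le_iff)
        have "1 * min 1 \<bar>f i w\<bar> \<le> (m w * (1 + real n)) * min 1 \<bar>f i w\<bar>"
          using ge by (intro mult_right_mono) auto
        then have "ennreal (min 1 \<bar>f i w\<bar>) \<le> ennreal ((1 + real n) * (m w * min 1 \<bar>f i w\<bar>))"
          by (intro ennreal_leI) (simp add: mult_ac)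
        also have "\<dots> = ennreal (1 + real n) * (ennreal (m w) * ennreal (min 1 \<bar>f i w\<bar>))"
          using \<open>m w \<ge> 0\<close> by (simp add: ennreal_mult del: ennreal_plus)
        finally show ?thesis by (simp add: add_increasing)
      qed
    qed
    also have "\<dots> = emeasure M ?A +
        ennreal (1 + real n) * (\<integral>\<^sup>+w. ennreal (m w) * ennreal (min 1 \<bar>f i w\<bar>) \<partial>M)"
      by (subst nn_integral_add) (auto simp: nn_integral_cmult)
    also have "\<dots> \<le> emeasure M ?A + ennreal (1 + real n) * ennreal (a i)"
      using le[of i] by (intro add_left_mono mult_left_mono) auto
    also have "\<dots> = ennreal (prob ?A + (1 + real n) * a i)"
      using a[of i] by (simp add: emeasure_eq_measure ennreal_plus ennreal_mult)
    finally show ?thesis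
      using a[of i] by (subst (asm) ennreal_le_iff) auto
  qed
qed (rule prob_size_nonneg)

end

section \<open>One-period consequences of no-arbitrage along a filter\<close>

context cond_law
begin

text \<open>Where the position does not gain, the loss after trading is at least the loss before.
  Given \<open>G\<close> this happens with probability at least \<open>m\<close>, so the weighted
  initial loss is bounded by the final one.\<close>

lemma initial_loss_tendsto_0:
  assumes NA: one_period_NA
    and X: "\<And>i. X i \<in> borel_measurable G" and \<xi>: "\<And>i. \<xi> i \<in> borel_measurable G"
    and D: "\<And>i. AE w in M. \<xi> i w \<in> L w"
    and lim: "((\<lambda>i. prob_size (\<lambda>w. max 0 (- (X i w + \<xi> i w \<bullet> Y w)))) \<longlongrightarrow> 0) Fi"
  shows "((\<lambda>i. prob_size (\<lambda>w. max 0 (- X i w))) \<longlongrightarrow> 0) Fi"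
proof -
  note [measurable] = X \<xi> meas_G[OF X] meas_G[OF \<xi>]
  obtain m where m[measurable]: "m \<in> borel_measurable M" and pos: "AE w in M. m w > 0" and
    le: "\<forall>\<xi>\<in>borel_measurable G. (AE w in M. \<xi> w \<in> L w) \<longrightarrow>
      (\<forall>Z\<in>borel_measurable G. (\<integral>\<^sup>+w. ennreal (m w) * ennreal (Z w) \<partial>M) \<le>
         (\<integral>\<^sup>+w. ennreal (Z w) * indicator {w. \<xi> w \<bullet> Y w \<le> 0} w \<partial>M))"
    using no_arbitrage_estimates[OF NA] by blast
  show ?thesis
  proof (rule prob_size_tendsto_weight[OF _ m pos _ lim prob_size_nonneg])
    fix i
    have "(\<integral>\<^sup>+w. ennreal (m w) * ennreal (min 1 \<bar>max 0 (- X i w)\<bar>) \<partial>M) \<le>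
        (\<integral>\<^sup>+w. ennreal (min 1 \<bar>max 0 (- X i w)\<bar>) * indicator {w. \<xi> i w \<bullet> Y w \<le> 0} w \<partial>M)"
      by (rule le[rule_format, OF \<xi> D]) measurable
    also have "\<dots> \<le> (\<integral>\<^sup>+w. ennreal (min 1 \<bar>max 0 (- (X i w + \<xi> i w \<bullet> Y w))\<bar>) \<partial>M)"
      by (intro nn_integral_mono) (auto split: split_indicator intro!: ennreal_leI)
    also have "\<dots> = ennreal (prob_size (\<lambda>w. max 0 (- (X i w + \<xi> i w \<bullet> Y w))))"
      by (rule ennreal_prob_size[symmetric]) measurable
    finally show "(\<integral>\<^sup>+w. ennreal (m w) * ennreal (min 1 \<bar>max 0 (- X i w)\<bar>) \<partial>M) \<le> \<dots>" .
  qed measurable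
qed

text \<open>With \<open>X\<close> negligible, the loss of the position alone is small too, and the
  second of the \<open>no_arbitrage_estimates\<close> turns this into a small position.\<close>

lemma position_tendsto_0:
  assumes NA: one_period_NA
    and X: "\<And>i. X i \<in> borel_measurable G" and \<xi>: "\<And>i. \<xi> i \<in> borel_measurable G"
    and D: "\<And>i. AE w in M. \<xi> i w \<in> L w"
    and lim: "((\<lambda>i. prob_size (\<lambda>w. max 0 (- (X i w + \<xi> i w \<bullet> Y w)))) \<longlongrightarrow> 0) Fi"
    and limX: "((\<lambda>i. prob_size (X i)) \<longlongrightarrow> 0) Fi"
  shows "((\<lambda>i. prob_size (\<lambda>w. norm (\<xi> i w))) \<longlongrightarrow> 0) Fi"
proof -
  note [measurable] = X \<xi> meas_G[OF X] meas_G[OF \<xi>]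
  obtain m where m[measurable]: "m \<in> borel_measurable M" and pos: "AE w in M. m w > 0" and
    le: "\<forall>\<xi>\<in>borel_measurable G. (AE w in M. \<xi> w \<in> L w) \<longrightarrow>
      (\<integral>\<^sup>+w. ennreal (m w) * ennreal (min 1 (norm (\<xi> w))) \<partial>M) \<le>
         (\<integral>\<^sup>+w. ennreal (min 1 (max 0 (- (\<xi> w \<bullet> Y w)))) \<partial>M)"
    using no_arbitrage_estimates[OF NA] by blast
  have "((\<lambda>i. prob_size (\<lambda>w. max 0 (- (X i w + \<xi> i w \<bullet> Y w)) + \<bar>X i w\<bar>)) \<longlongrightarrow> 0) Fi"
    using limX by (intro prob_size_tendsto_add lim) (auto simp: prob_size_def)
  then have lim': "((\<lambda>i. prob_size (\<lambda>w. max 0 (- (\<xi> i w \<bullet> Y w)))) \<longlongrightarrow> 0) Fi"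
    by (rule prob_size_tendsto_mono[rotated -1]) auto
  show ?thesis
  proof (rule prob_size_tendsto_weight[OF _ m pos _ lim' prob_size_nonneg])
    fix i
    have "(\<integral>\<^sup>+w. ennreal (m w) * ennreal (min 1 (norm (\<xi> i w))) \<partial>M) \<le>
       (\<integral>\<^sup>+w. ennreal (min 1 (max 0 (- (\<xi> i w \<bullet> Y w)))) \<partial>M)"
      by (rule le[rule_format, OF \<xi> D])
    also have "\<dots> = ennreal (prob_size (\<lambda>w. max 0 (- (\<xi> i w \<bullet> Y w))))"
      by (subst ennreal_prob_size) auto
    finally show "(\<integral>\<^sup>+w. ennreal (m w) * ennreal (min 1 \<bar>norm (\<xi> i w)\<bar>) \<partial>M) \<le> \<dots>" by simp
  qed measurable
qed

lemma gain_tendsto_0: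
  assumes \<xi>: "\<And>i. \<xi> i \<in> borel_measurable G"
    and lim: "((\<lambda>i. prob_size (\<lambda>w. norm (\<xi> i w))) \<longlongrightarrow> 0) Fi"
  shows "((\<lambda>i. prob_size (\<lambda>w. \<xi> i w \<bullet> Y w)) \<longlongrightarrow> 0) Fi"
proof -
  note [measurable] = \<xi> meas_G[OF \<xi>]
  have "((\<lambda>i. prob_size (\<lambda>w. norm (\<xi> i w) * norm (Y w))) \<longlongrightarrow> 0) Fi"
    by (rule prob_size_tendsto_mult[OF _ _ lim]) measurable
  then show ?thesis
    by (rule prob_size_tendsto_mono[rotated -1]) (auto simp: Cauchy_Schwarz_ineq2)
qed

end

context market
begin

abbreviation "\<Delta> \<equiv> increment S"

lemma space_F: "t \<le> T \<Longrightarrow> space (F t) = space M"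
  using subalgebra_F by (auto simp: subalgebra_def)

lemma meas_F_M: "t \<le> T \<Longrightarrow> f \<in> measurable (F t) N \<Longrightarrow> f \<in> measurable M N"
  by (rule measurable_from_subalg[OF subalgebra_F])

lemma subalgebra_F_F: "s \<le> t \<Longrightarrow> t \<le> T \<Longrightarrow> subalgebra (F t) (F s)"
  using filtration_F space_F by (auto simp: subalgebra_def)

lemma meas_F_F: "s \<le> t \<Longrightarrow> t \<le> T \<Longrightarrow> f \<in> measurable (F s) N \<Longrightarrow> f \<in> measurable (F t) N"
  by (rule measurable_from_subalg[OF subalgebra_F_F])

lemma increment_meas: "t \<le> T \<Longrightarrow> \<Delta> t \<in> borel_measurable (F t)"
  unfolding increment_def by (intro borel_measurable_diff adapted_S meas_F_F[OF _ _ adapted_S]) auto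

lemma strategy_meas: "\<phi> \<in> strategies F T \<Longrightarrow> t \<in> {1..T} \<Longrightarrow> \<phi> t \<in> borel_measurable (F (t - 1))"
  by (auto simp: strategies_def)

lemma wealth_meas:
  assumes "\<phi> \<in> strategies F T" "t \<le> T"
  shows "wealth S c \<phi> t \<in> borel_measurable (F t)"
proof -
  have "(\<lambda>w. \<phi> i w \<bullet> \<Delta> i w) \<in> borel_measurable (F t)" if "i \<in> {1..t}" for i
    using that assms
    by (intro borel_measurable_inner meas_F_F[OF _ _ strategy_meas] meas_F_F[OF _ _ increment_meas]) auto
  then show ?thesis
    unfolding wealth_def by (intro borel_measurable_add borel_measurable_sum) auto
qed

lemma wealth_meas_M: "\<phi> \<in> strategies F T \<Longrightarrow> t \<le> T \<Longrightarrow> wealth S c \<phi> t \<in> borel_measurable M"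
  by (rule meas_F_M[OF _ wealth_meas])

lemma wealth_Suc: "wealth S c \<phi> (Suc t) w = wealth S c \<phi> t w + \<phi> (Suc t) w \<bullet> \<Delta> (Suc t) w"
  by (simp add: wealth_def)

end

locale arbitrage_free_market = market M F S T
  for M :: "'a measure" and F :: "nat \<Rightarrow> 'a measure" and S :: "nat \<Rightarrow> 'a \<Rightarrow> real ^ 'd" and T +
  fixes \<kappa> :: "nat \<Rightarrow> 'a \<Rightarrow> (real ^ 'd) measure"
  assumes rcd: "\<And>t. t \<in> {1..T} \<Longrightarrow> regular_cond_distr M (F (t - 1)) (increment S t) (\<kappa> t)"
    and NA: "no_arbitrage M F S T"
begin

lemma cond_law_F: "t \<in> {1..T} \<Longrightarrow> cond_law M (F (t - 1)) (\<Delta> t) (\<kappa> t)"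
  using rcd subalgebra_F meas_F_M[OF _ increment_meas] prob_space_axioms
  by (auto simp: cond_law_def cond_law_axioms_def)

text \<open>A position in a single period extends to a strategy that holds nothing at other
  times.\<close>

lemma one_period_no_arbitrage:
  assumes t: "t \<in> {1..T}"
  shows "cond_law.one_period_NA M (F (t - 1)) (\<Delta> t)"
  unfolding cond_law.one_period_NA_def[OF cond_law_F[OF t]]
proof (intro ballI)
  fix \<xi> :: "'a \<Rightarrow> real ^ 'd" assume "\<xi> \<in> borel_measurable (F (t - 1))"
  then have str: "(\<lambda>i. if i = t then \<xi> else (\<lambda>_. 0)) \<in> strategies F T"
    by (auto simp: strategies_def)
  have "wealth S 0 (\<lambda>i. if i = t then \<xi> else (\<lambda>_. 0)) T w = \<xi> w \<bullet> \<Delta> t w" for w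
  proof -
    have "(\<Sum>i=1..T. (if i = t then \<xi> else (\<lambda>_. 0)) w \<bullet> \<Delta> i w) = (\<Sum>i=1..T. if i = t then \<xi> w \<bullet> \<Delta> t w else 0)"
      by (intro sum.cong) auto
    then show ?thesis using t by (simp add: wealth_def)
  qed
  then show "(AE w in M. \<xi> w \<bullet> \<Delta> t w \<ge> 0) \<longrightarrow> (AE w in M. \<xi> w \<bullet> \<Delta> t w = 0)"
    using bspec[OF NA[unfolded no_arbitrage_def] str] by simp
qed

text \<open>The linear form of the constraint by the spaces \<open>support_space\<close>;
  \<open>reduced_iff_support_space\<close> identifies the two.\<close>

definition reduced :: "(nat \<Rightarrow> 'a \<Rightarrow> real ^ 'd) \<Rightarrow> bool" where
  "reduced \<phi> \<longleftrightarrow> \<phi> \<in> strategies F T \<and>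
     (\<forall>t\<in>{1..T}. AE w in M. \<phi> t w \<in> span (measure_support (\<kappa> t w)))"

text \<open>The embedding of strategies into terminal wealths. A backward induction carries the
  smallness of losses from \<open>T\<close> to every earlier date. Starting from zero capital, a
  forward induction then makes the next position, its gain and the next wealth small.\<close>

lemma reduced_strategies_tendsto_0:
  assumes red: "\<And>i. reduced (\<phi> i)"
    and lim: "((\<lambda>i. prob_size (\<lambda>w. max 0 (- wealth S 0 (\<phi> i) T w))) \<longlongrightarrow> 0) Fi"
  shows "t \<in> {1..T} \<Longrightarrow> ((\<lambda>i. prob_size (\<lambda>w. norm (\<phi> i t w))) \<longlongrightarrow> 0) Fi"
    and "t \<le> T \<Longrightarrow> ((\<lambda>i. prob_size (wealth S 0 (\<phi> i) t)) \<longlongrightarrow> 0) Fi"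
proof -
  have str: "\<phi> i \<in> strategies F T" for i using red by (simp add: reduced_def)
  have neg: "((\<lambda>i. prob_size (\<lambda>w. max 0 (- wealth S 0 (\<phi> i) t w))) \<longlongrightarrow> 0) Fi" if "t \<le> T" for t
    using that
  proof (induction rule: inc_induct)
    case (step n)
    then have n: "Suc n \<in> {1..T}" by auto
    interpret cl: cond_law M "F n" "\<Delta> (Suc n)" "\<kappa> (Suc n)" using cond_law_F[OF n] by simp
    show ?case
    proof (rule cl.initial_loss_tendsto_0[where \<xi>="\<lambda>i. \<phi> i (Suc n)"])
      show "cond_law.one_period_NA M (F n) (\<Delta> (Suc n))"
        using one_period_no_arbitrage[OF n] by simp
      show "\<phi> i (Suc n) \<in> borel_measurable (F n)" for i using strategy_meas[OF str n] by simp
      show "AE w in M. \<phi> i (Suc n) w \<in> span (measure_support (\<kappa> (Suc n) w))" for i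
        using red n by (auto simp: reduced_def)
    qed (use step in \<open>auto simp: wealth_Suc intro!: wealth_meas str\<close>)
  qed (rule lim)
  have pos: "((\<lambda>i. prob_size (\<lambda>w. norm (\<phi> i (Suc n) w))) \<longlongrightarrow> 0) Fi"
    and gain: "((\<lambda>i. prob_size (\<lambda>w. \<phi> i (Suc n) w \<bullet> \<Delta> (Suc n) w)) \<longlongrightarrow> 0) Fi"
    if "Suc n \<le> T" "((\<lambda>i. prob_size (wealth S 0 (\<phi> i) n)) \<longlongrightarrow> 0) Fi" for n
  proof -
    have n: "Suc n \<in> {1..T}" using that by auto
    interpret cl: cond_law M "F n" "\<Delta> (Suc n)" "\<kappa> (Suc n)" using cond_law_F[OF n] by simp
    have m: "\<phi> i (Suc n) \<in> borel_measurable (F n)" for i using strategy_meas[OF str n] by simp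
    show "((\<lambda>i. prob_size (\<lambda>w. norm (\<phi> i (Suc n) w))) \<longlongrightarrow> 0) Fi"
    proof (rule cl.position_tendsto_0[OF _ _ m _ _ that(2)])
      show "cond_law.one_period_NA M (F n) (\<Delta> (Suc n))"
        using one_period_no_arbitrage[OF n] by simp
      show "AE w in M. \<phi> i (Suc n) w \<in> span (measure_support (\<kappa> (Suc n) w))" for i
        using red n by (auto simp: reduced_def)
      show "((\<lambda>i. prob_size (\<lambda>w. max 0 (- (wealth S 0 (\<phi> i) n w + \<phi> i (Suc n) w \<bullet> \<Delta> (Suc n) w)))) \<longlongrightarrow> 0) Fi"
        using neg[OF that(1)] by (simp add: wealth_Suc)
    qed (use that in \<open>auto intro!: wealth_meas str\<close>)
    then show "((\<lambda>i. prob_size (\<lambda>w. \<phi> i (Suc n) w \<bullet> \<Delta> (Suc n) w)) \<longlongrightarrow> 0) Fi"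
      by (rule cl.gain_tendsto_0[OF m])
  qed
  have w: "((\<lambda>i. prob_size (wealth S 0 (\<phi> i) t)) \<longlongrightarrow> 0) Fi" if "t \<le> T" for t
    using that
  proof (induction t)
    case 0
    then show ?case by (simp add: wealth_def prob_size_def)
  next
    case (Suc n)
    have "((\<lambda>i. prob_size (\<lambda>w. wealth S 0 (\<phi> i) n w + \<phi> i (Suc n) w \<bullet> \<Delta> (Suc n) w)) \<longlongrightarrow> 0) Fi"
      using Suc gain strategy_meas[OF str, of "Suc n"]
      by (intro prob_size_tendsto_add wealth_meas_M str borel_measurable_inner meas_F_M[OF _ increment_meas]
          meas_F_M[of n]) auto
    then show ?case by (simp add: wealth_Suc[abs_def])
  qed
  then show "t \<le> T \<Longrightarrow> ((\<lambda>i. prob_size (wealth S 0 (\<phi> i) t)) \<longlongrightarrow> 0) Fi" .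
  show "((\<lambda>i. prob_size (\<lambda>w. norm (\<phi> i t w))) \<longlongrightarrow> 0) Fi" if "t \<in> {1..T}"
    using that pos[of "t - 1"] w[of "t - 1"] by auto
qed

end

section \<open>Utility functions\<close>

lemma concave_imp_continuous:
  fixes f :: "real \<Rightarrow> real"
  assumes "concave_on UNIV f"
  shows "continuous_on UNIV f"
proof -
  have "continuous_on UNIV (\<lambda>x. - f x)"
    using assms by (intro convex_on_continuous) (auto simp: concave_on_def)
  from continuous_on_minus[OF this] show ?thesis by simp
qed

locale utility =
  fixes U :: "real \<Rightarrow> real"
  assumes concave: "concave_on UNIV U" and mono: "mono U" and zero: "U 0 = 0"
    and strict: "strictly_concave U"
begin

lemma concave_ge: "0 \<le> s \<Longrightarrow> s \<le> 1 \<Longrightarrow> U ((1 - s) * x + s * y) \<ge> (1 - s) * U x + s * U y"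
  using concave_onD[OF concave, of s x y] by simp

lemma midpoint_ge: "U ((x + y) / 2) \<ge> (U x + U y) / 2"
  using concave_ge[of "1/2" x y] by (simp add: field_simps)

lemma half_ge: "U (z / 2) \<ge> U z / 2"
  using midpoint_ge[of z 0] zero by simp

lemma nonneg: "x \<ge> 0 \<Longrightarrow> U x \<ge> 0" and nonpos: "x \<le> 0 \<Longrightarrow> U x \<le> 0"
  using monoD[OF mono, of 0 x] monoD[OF mono, of x 0] zero by auto

lemma continuous_U: "continuous_on A U"
  using concave_imp_continuous[OF concave] continuous_on_subset by blast

lemma meas_U[measurable]: "U \<in> borel_measurable borel"
  by (intro borel_measurable_continuous_onI continuous_U)

text \<open>Both growth conditions say that halving the wealth reduces gains by a smaller factor than losses
  (apart from a constant). This is all that is needed of them.\<close>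

lemma halving_gain:
  assumes "assumption_B U \<or> assumption_C U"
  obtains p q C where "p > 0" "q \<ge> 0" "\<And>z. U (z / 2) \<ge> q * U z + p * max 0 (U z) - C"
proof (cases "assumption_B U")
  case True
  then obtain x0 \<gamma> where x0: "x0 > 0" and \<gamma>: "0 < \<gamma>" "\<gamma> < 1" and
    le: "\<And>x l. x \<ge> x0 \<Longrightarrow> l \<ge> 1 \<Longrightarrow> U (l * x) \<le> l powr \<gamma> * U x"
    by (auto simp: assumption_B_def)
  \<comment> \<open>\<open>1 / 2 + p\<close> is the factor \<open>2 powr (- \<gamma>)\<close> that
    condition B guarantees for halved large gains, whereas concavity alone guarantees
    \<open>1 / 2\<close>.\<close>
  define p where "p = 2 powr (- \<gamma>) - 1 / 2"
  have "2 powr (- 1) < 2 powr (- \<gamma>)" using \<gamma> by (intro powr_less_mono) auto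
  then have p: "p > 0" by (simp add: p_def powr_minus)
  have "U (z / 2) \<ge> 1 / 2 * U z + p * max 0 (U z) - p * U (2 * x0)" for z
  proof (cases "z \<ge> 2 * x0")
    case True
    have "2 powr (- \<gamma>) * U z \<le> 2 powr (- \<gamma>) * (2 powr \<gamma> * U (z / 2))"
      using le[of "z / 2" 2] True by (intro mult_left_mono) auto
    also have "\<dots> = U (z / 2)" by (simp add: powr_minus)
    finally have "(1 / 2 + p) * U z \<le> U (z / 2)" by (simp add: p_def)
    moreover have "p * U (2 * x0) \<ge> 0" "U z \<ge> 0"
      using p x0 True by (auto intro!: mult_nonneg_nonneg nonneg)
    ultimately show ?thesis by (simp add: algebra_simps)
  next
    case False
    then have "max 0 (U z) \<le> U (2 * x0)"
      using x0 nonneg[of "2 * x0"] by (auto intro: monoD[OF mono])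
    then have "p * max 0 (U z) \<le> p * U (2 * x0)" using p by (intro mult_left_mono) auto
    then show ?thesis using half_ge[of z] by simp
  qed
  then show thesis by (intro that[OF p, of "1 / 2" "p * U (2 * x0)"]) auto
next
  case False
  with assms obtain x0 \<alpha> where x0: "x0 \<le> 0" and \<alpha>: "\<alpha> > 0" and
    le: "\<And>x l. x \<le> x0 \<Longrightarrow> l \<ge> 1 \<Longrightarrow> U (l * x) \<le> l powr (1 + \<alpha>) * U x"
    by (auto simp: assumption_C_def)
  \<comment> \<open>Here the gains keep the factor \<open>1 / 2\<close> from concavity, while
    condition C shrinks large losses to at most the smaller fraction \<open>q\<close>; the surplus
    for gains is \<open>1 / 2 - q\<close>.\<close>
  define q where "q = 2 powr (- (1 + \<alpha>))"
  have q: "q \<ge> 0" by (simp add: q_def)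
  have "2 powr (- (1 + \<alpha>)) < 2 powr (- 1)" using \<alpha> by (intro powr_less_mono) auto
  then have p: "1 / 2 - q > 0" by (simp add: q_def powr_minus)
  have C: "- ((1 / 2 - q) * U (2 * x0)) \<ge> 0"
    using p nonpos[of "2 * x0"] x0 by (simp add: mult_nonneg_nonpos)
  have "U (z / 2) \<ge> q * U z + (1 / 2 - q) * max 0 (U z) - (- ((1 / 2 - q) * U (2 * x0)))" for z
  proof (cases "z \<ge> 0")
    case True
    then show ?thesis using half_ge[of z] nonneg[of z] C by (simp add: algebra_simps)
  next
    case neg: False
    then have m: "max 0 (U z) = 0" using nonpos[of z] by auto
    show ?thesis
    proof (cases "z \<le> 2 * x0")
      case True
      have "q * U z \<le> q * (2 powr (1 + \<alpha>) * U (z / 2))"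
        using le[of "z / 2" 2] True q by (intro mult_left_mono) auto
      also have "\<dots> = U (z / 2)"
        using powr_add[of 2 "- (1 + \<alpha>)" "1 + \<alpha>"] by (simp add: q_def)
      finally show ?thesis using C m by simp
    next
      case False
      then have "(1 / 2 - q) * U (2 * x0) \<le> (1 / 2 - q) * U z"
        using p by (intro mult_left_mono monoD[OF mono]) auto
      then show ?thesis using half_ge[of z] m by (simp add: algebra_simps)
    qed
  qed
  then show thesis by (rule that[OF p q])
qed

text \<open>Strict concavity and monotonicity make \<open>U (-1)\<close> negative, and below -1 the
  graph lies under the line through the origin and that point. This turns bounds on expected utility
  losses into bounds on wealth losses.\<close>

lemma loss_le:
  obtains \<beta> where "\<beta> > 0" "\<And>x. max 0 (- x) \<le> 1 + \<beta> * max 0 (- U x)"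
proof -
  have "U ((1 - 1/2) * 0 + 1/2 * (-1)) > (1 - 1/2) * U 0 + 1/2 * U (-1)"
    using strict unfolding strictly_concave_def by (metis zero_neq_neg_one half_gt_zero_iff zero_less_one
        divide_less_eq_1_pos one_less_numeral_iff semiring_norm(76) zero_less_numeral)
  then have neg: "U (-1) < 0" using nonpos[of "-1/2"] zero by simp
  have "max 0 (- x) \<le> 1 + (1 / - U (-1)) * max 0 (- U x)" for x
  proof (cases "x \<le> -1")
    case True
    have "U ((1 - 1 / - x) * 0 + (1 / - x) * x) \<ge> (1 - 1 / - x) * U 0 + (1 / - x) * U x"
      using True by (intro concave_ge) (auto simp: field_simps)
    then have "U (-1) \<ge> (1 / - x) * U x" using True zero by simp
    then have "- x * - U (-1) \<le> - U x" using True by (simp add: field_simps)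
    then have "- x \<le> - U x / - U (-1)" using neg by (simp only: pos_le_divide_eq)
    then show ?thesis using True nonpos[of x] neg by (simp add: max_def)
  next
    case False
    have "(1 / - U (-1)) * max 0 (- U x) \<ge> 0" using neg by (intro mult_nonneg_nonneg) auto
    then show ?thesis using False by auto
  qed
  then show thesis using neg by (intro that[of "1 / - U (-1)"]) auto
qed

text \<open>The midpoint gap is continuous and positive off the diagonal, hence bounded below on a
  compact set of separated pairs. It may degenerate at infinity, so the wealths have to be bounded
  in probability before it can be applied.\<close>

lemma strict_concavity_modulus:
  assumes "\<epsilon> > 0"
  obtains \<delta> where "\<delta> > 0"
    "\<And>x y. \<bar>x\<bar> \<le> N \<Longrightarrow> \<bar>y\<bar> \<le> N \<Longrightarrow> \<epsilon> \<le> \<bar>x - y\<bar> \<Longrightarrow> \<delta> \<le> U ((x + y) / 2) - (U x + U y) / 2"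
proof -
  let ?K = "(cball 0 N \<times> cball 0 N) \<inter> {z. \<epsilon> \<le> \<bar>fst z - snd z\<bar>} :: (real \<times> real) set"
  let ?g = "\<lambda>z. U ((fst z + snd z) / 2) - (U (fst z) + U (snd z)) / 2"
  have comp: "compact ?K"
    by (intro compact_Int_closed compact_Times compact_cball closed_Collect_le continuous_intros)
  have cont: "continuous_on ?K ?g"
    by (intro continuous_intros continuous_on_compose2[OF continuous_U[of UNIV]]) auto
  show thesis
  proof (cases "?K = {}")
    case True
    show thesis
    proof (rule that[of 1])
      fix x y assume "\<bar>x\<bar> \<le> N" "\<bar>y\<bar> \<le> N" "\<epsilon> \<le> \<bar>x - y\<bar>"
      then have "(x, y) \<in> ?K" by auto
      with True show "1 \<le> U ((x + y) / 2) - (U x + U y) / 2" by blast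
    qed simp
  next
    case False
    obtain z where z: "z \<in> ?K" "\<forall>z'\<in>?K. ?g z \<le> ?g z'"
      using continuous_attains_inf[OF comp False cont] by blast
    have "fst z \<noteq> snd z" using z(1) assms by auto
    then have "U ((1 - 1/2) * fst z + 1/2 * snd z) > (1 - 1/2) * U (fst z) + 1/2 * U (snd z)"
      using strict[unfolded strictly_concave_def, rule_format, of "fst z" "snd z" "1/2"] by simp
    then have "?g z > 0" by (simp add: field_simps)
    then show thesis
    proof (rule that)
      fix x y assume "\<bar>x\<bar> \<le> N" "\<bar>y\<bar> \<le> N" "\<epsilon> \<le> \<bar>x - y\<bar>"
      then have "(x, y) \<in> ?K" by auto
      from z(2)[rule_format, OF this] show "?g z \<le> U ((x + y) / 2) - (U x + U y) / 2" by simp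
    qed
  qed
qed

lemma midpoint_strict: "x \<noteq> y \<Longrightarrow> U ((x + y) / 2) > (U x + U y) / 2"
  using strict[unfolded strictly_concave_def, rule_format, of x y "1/2"] by (simp add: field_simps)

end

section \<open>The supermartingale property of the value functions\<close>

text \<open>Moving the negative parts across leaves sums of non-negative terms, which can be
  integrated and added without meeting an undefined difference.\<close>

lemma ennreal_split_le:
  fixes p n :: ennreal
  assumes "enn2ereal p - enn2ereal n \<le> ereal v" "\<not> (p = \<infinity> \<and> n = \<infinity>)"
  shows "p < \<infinity>" "p + ennreal (- v) \<le> ennreal v + n"
proof -
  show p: "p < \<infinity>"
  proof (rule ccontr)
    assume "\<not> p < \<infinity>"
    then have "p = \<infinity>" by (auto simp: less_top[symmetric])
    moreover from this have "n \<noteq> \<infinity>" using assms(2) by simp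
    ultimately show False using assms(1) by (cases n) auto
  qed
  show "p + ennreal (- v) \<le> ennreal v + n"
  proof (cases n)
    case (real r)
    obtain s where s: "p = ennreal s" "s \<ge> 0" using p by (cases p) auto
    then have "s - r \<le> v" using assms(1) real by simp
    then have "s + max 0 (- v) \<le> max 0 v + r" by auto
    then have "ennreal (s + max 0 (- v)) \<le> ennreal (max 0 v + r)" by (rule ennreal_leI)
    then show ?thesis using s real by (simp add: ennreal_plus ennreal_max_0)
  qed simp
qed

locale value_market = market M F S T + utility U
  for M :: "'a measure" and F :: "nat \<Rightarrow> 'a measure" and S :: "nat \<Rightarrow> 'a \<Rightarrow> real ^ 'd" and T
    and U :: "real \<Rightarrow> real" +
  fixes V :: "nat \<Rightarrow> real \<Rightarrow> 'a \<Rightarrow> real"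
  assumes regular: "regular_value_functions M F S T U V"
    and V0: "\<And>x. expectation_defined M (V 0 x)" "\<And>x. gen_expectation M (V 0 x) < \<infinity>"
begin

lemma sigma_finite_F: "t \<le> T \<Longrightarrow> sigma_finite_subalgebra M (F t)"
  by (rule finite_measure_subalgebra_is_sigma_finite)
     (unfold_locales, rule subalgebra_F)

lemma V_T: "V T x w = U x"
  using regular by (simp add: regular_value_functions_def)

lemma V_joint_meas: "t \<le> T \<Longrightarrow> (\<lambda>(x, w). V t x w) \<in> borel_measurable (borel \<Otimes>\<^sub>M F t)"
proof (cases "t = T")
  case True
  then show ?thesis by (simp add: V_T split_beta')
next
  case False
  assume "t \<le> T"
  with False regular show ?thesis by (simp add: regular_value_functions_def)
qed

lemma V_comp_meas:
  assumes "t \<le> T" "X \<in> borel_measurable (F t)"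
  shows "(\<lambda>w. V t (X w) w) \<in> borel_measurable (F t)"
proof -
  have "(\<lambda>w. (X w, w)) \<in> F t \<rightarrow>\<^sub>M borel \<Otimes>\<^sub>M F t" using assms(2) by measurable
  from measurable_compose[OF this V_joint_meas[OF assms(1)]] show ?thesis by simp
qed

lemma V_regular: "t \<le> T \<Longrightarrow> AE w in M. mono (\<lambda>x. V t x w) \<and> continuous_on UNIV (\<lambda>x. V t x w)"
proof (cases "t = T")
  case True
  then show ?thesis using mono continuous_U by (simp add: V_T)
next
  case False
  assume "t \<le> T"
  with False have "AE w in M. mono (\<lambda>x. V t x w) \<and> concave_on UNIV (\<lambda>x. V t x w)"
    using regular by (simp add: regular_value_functions_def)
  then show ?thesis by eventually_elim (auto intro: concave_imp_continuous)
qed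

abbreviation next_value :: "nat \<Rightarrow> ('a \<Rightarrow> real) \<Rightarrow> ('a \<Rightarrow> real ^ 'd) \<Rightarrow> 'a \<Rightarrow> real" where
  "next_value t X \<xi> w \<equiv> V (Suc t) (X w + \<xi> w \<bullet> \<Delta> (Suc t) w) w"

lemma next_value_meas:
  assumes "t < T" "X \<in> borel_measurable (F t)" "\<xi> \<in> borel_measurable (F t)"
  shows "next_value t X \<xi> \<in> borel_measurable (F (Suc t))"
  using assms by (intro V_comp_meas borel_measurable_add borel_measurable_inner increment_meas meas_F_F[of t "Suc t"]) auto

text \<open>The essential supremum gives the inequality for constant initial wealth only. For a random
  wealth \<open>X\<close>, compare on \<open>{X \<le> q}\<close> with the constant \<open>q\<close>, and let the rationals \<open>q\<close> decrease to \<open>X\<close>.\<close>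

lemma one_step:
  assumes t: "t < T" and X: "X \<in> borel_measurable (F t)" and \<xi>: "\<xi> \<in> borel_measurable (F t)"
  shows "AE w in M. nn_cond_exp M (F t) (\<lambda>w. ennreal (next_value t X \<xi> w)) w < \<infinity> \<and>
    nn_cond_exp M (F t) (\<lambda>w. ennreal (next_value t X \<xi> w)) w + ennreal (- V t (X w) w) \<le>
    ennreal (V t (X w) w) + nn_cond_exp M (F t) (\<lambda>w. ennreal (- next_value t X \<xi> w)) w"
proof -
  interpret sf: sigma_finite_subalgebra M "F t" using sigma_finite_F t by simp
  let ?p = "\<lambda>X. nn_cond_exp M (F t) (\<lambda>w. ennreal (next_value t X \<xi> w))"
  let ?n = "\<lambda>X. nn_cond_exp M (F t) (\<lambda>w. ennreal (- next_value t X \<xi> w))"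
  have meas: "next_value t X \<xi> \<in> borel_measurable M" if "X \<in> borel_measurable (F t)" for X
    using next_value_meas[OF t that \<xi>] t by (intro meas_F_M[of "Suc t"]) auto
  note [measurable] = meas[OF X] meas[OF borel_measurable_const] X meas_F_M[OF less_imp_le[OF t] X]
  have const: "AE w in M. ?p (\<lambda>_. x) w < \<infinity> \<and>
    ?p (\<lambda>_. x) w + ennreal (- V t x w) \<le>
    ennreal (V t x w) + ?n (\<lambda>_. x) w" for x
  proof -
    have R: "\<forall>\<xi>\<in>borel_measurable (F t). cond_exp_defined M (F t) (next_value t (\<lambda>_. x) \<xi>)"
      "is_ess_sup M ((\<lambda>\<xi>. gen_cond_exp M (F t) (next_value t (\<lambda>_. x) \<xi>)) ` borel_measurable (F t))
             (\<lambda>w. ereal (V t x w))"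
      using regular t by (simp_all add: regular_value_functions_def)
    have "AE w in M. gen_cond_exp M (F t) (next_value t (\<lambda>_. x) \<xi>) w \<le> ereal (V t x w)"
      using R(2) \<xi> by (auto simp: is_ess_sup_def)
    moreover have "AE w in M. \<not> (?p (\<lambda>_. x) w = \<infinity> \<and>
        ?n (\<lambda>_. x) w = \<infinity>)"
      using R(1) \<xi> by (auto simp: cond_exp_defined_def)
    ultimately show ?thesis
    proof eventually_elim
      case (elim w)
      from ennreal_split_le[OF elim(1)[unfolded gen_cond_exp_def] elim(2)] show ?case by blast
    qed
  qed
  have comp: "AE w in M. X w \<le> x \<longrightarrow>
      ?p X w \<le> ?p (\<lambda>_. x) w \<and>
      ?n (\<lambda>_. x) w \<le> ?n X w" for x
  proof -
    \<comment> \<open>The event belongs to \<open>F t\<close>, so its indicator passes through the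
      conditional expectation; this localises the comparison of \<open>X\<close> with the
      constant.\<close>
    let ?A = "{w\<in>space (F t). X w \<le> x}"
    have [measurable]: "?A \<in> sets (F t)" by measurable
    then have [measurable]: "?A \<in> sets M" using subalgebra_F[of t] t by (auto simp: subalgebra_def)
    have le: "AE w in M. X w \<le> x \<longrightarrow> next_value t X \<xi> w \<le> next_value t (\<lambda>_. x) \<xi> w"
      using V_regular[OF Suc_leI[OF t]]
    proof eventually_elim
      case (elim w)
      show ?case by (rule impI, rule monoD[OF conjunct1[OF elim]]) simp
    qed
    have "AE w in M. indicator ?A w * ?p X w =
        nn_cond_exp M (F t) (\<lambda>w. indicator ?A w * ennreal (next_value t X \<xi> w)) w"
      by (rule sf.nn_cond_exp_prod) measurable
    moreover have "AE w in M. nn_cond_exp M (F t) (\<lambda>w. indicator ?A w * ennreal (next_value t X \<xi> w)) w \<le>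
        ?p (\<lambda>_. x) w"
      by (intro sf.nn_cond_exp_mono eventually_mono[OF le]) (auto split: split_indicator intro!: ennreal_leI)
    moreover have "AE w in M. indicator ?A w * ?n (\<lambda>_. x) w =
        nn_cond_exp M (F t) (\<lambda>w. indicator ?A w * ennreal (- next_value t (\<lambda>_. x) \<xi> w)) w"
      by (rule sf.nn_cond_exp_prod) measurable
    moreover have "AE w in M. nn_cond_exp M (F t) (\<lambda>w. indicator ?A w * ennreal (- next_value t (\<lambda>_. x) \<xi> w)) w \<le>
        ?n X w"
      by (intro sf.nn_cond_exp_mono eventually_mono[OF le]) (auto split: split_indicator intro!: ennreal_leI)
    ultimately show ?thesis
      using AE_space
    proof eventually_elim
      case (elim w)
      have "w \<in> space (F t)" using elim(5) subalgebra_F[of t] t by (simp add: subalgebra_def)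
      then show ?case using elim(1-4) by auto
    qed
  qed
  have "AE w in M. \<forall>q::rat. X w \<le> of_rat q \<longrightarrow>
      ?p X w < \<infinity> \<and>
      ?p X w + ennreal (- V t (of_rat q) w) \<le>
      ennreal (V t (of_rat q) w) + ?n X w"
    unfolding AE_all_countable
  proof
    fix q :: rat
    show "AE w in M. X w \<le> of_rat q \<longrightarrow>
      ?p X w < \<infinity> \<and>
      ?p X w + ennreal (- V t (of_rat q) w) \<le>
      ennreal (V t (of_rat q) w) + ?n X w"
      using const[of "of_rat q"] comp[of "of_rat q"]
    proof eventually_elim
      case (elim w)
      show ?case
      proof
        assume "X w \<le> of_rat q"
        with elim show "?p X w < \<infinity> \<and>
          ?p X w + ennreal (- V t (of_rat q) w) \<le>
          ennreal (V t (of_rat q) w) + ?n X w"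
          by (meson order.strict_trans1 order.trans add_right_mono add_left_mono)
      qed
    qed
  qed
  with V_regular[OF less_imp_le[OF t]] show ?thesis
  proof eventually_elim
    case (elim w)
    have "\<exists>q::rat. X w < of_rat q \<and> of_rat q < X w + inverse (real (Suc n))" for n
      by (rule of_rat_dense) simp
    then obtain q :: "nat \<Rightarrow> rat" where q: "\<And>n. X w < of_rat (q n)" "\<And>n. of_rat (q n) < X w + inverse (real (Suc n))"
      by metis
    have "(\<lambda>n. X w + inverse (real (Suc n))) \<longlonglongrightarrow> X w"
      using tendsto_add[OF tendsto_const LIMSEQ_inverse_real_of_nat, of "X w"] by simp
    then have qlim: "(\<lambda>n. real_of_rat (q n)) \<longlonglongrightarrow> X w"
      by (rule tendsto_sandwich[OF _ _ tendsto_const, rotated -1])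
         (auto intro!: always_eventually less_imp_le q simp del: of_nat_Suc)
    have "isCont (\<lambda>x. V t x w) (X w)"
      using elim(1) by (auto simp: continuous_on_eq_continuous_at)
    then have Vlim: "(\<lambda>n. V t (of_rat (q n)) w) \<longlonglongrightarrow> V t (X w) w"
      using qlim by (rule isCont_tendsto_compose)
    have "?p X w + ennreal (- V t (X w) w) \<le> ennreal (V t (X w) w) + ?n X w"
    proof (rule LIMSEQ_le)
      show "(\<lambda>n. ?p X w + ennreal (- V t (of_rat (q n)) w)) \<longlonglongrightarrow> ?p X w + ennreal (- V t (X w) w)"
        by (intro tendsto_intros Vlim)
      show "(\<lambda>n. ennreal (V t (of_rat (q n)) w) + ?n X w) \<longlonglongrightarrow> ennreal (V t (X w) w) + ?n X w"
        by (intro tendsto_intros Vlim)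
      show "\<exists>N. \<forall>n\<ge>N. ?p X w + ennreal (- V t (of_rat (q n)) w) \<le> ennreal (V t (of_rat (q n)) w) + ?n X w"
        using elim(2) q(1) less_imp_le by blast
    qed
    moreover have "?p X w < \<infinity>" using elim(2) q(1)[of 0] less_imp_le by blast
    ultimately show ?case by blast
  qed
qed

text \<open>Backward induction on the inequality between the conditional expected utility and the
  current value, integrated over sets of \<open>F t\<close> with negative parts moved across. The
  positive part of an intermediate value may have infinite integral. Finiteness of the negative part
  is carried along because the induction step cancels it.\<close>

lemma supermartingale:
  assumes \<phi>: "\<phi> \<in> strategies F T" and neg: "(\<integral>\<^sup>+w. ennreal (- U (wealth S c \<phi> T w)) \<partial>M) < \<infinity>" and "t \<le> T"
  shows "(\<integral>\<^sup>+w. ennreal (- V t (wealth S c \<phi> t w) w) \<partial>M) < \<infinity> \<and>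
    (\<forall>A\<in>sets (F t).
      (\<integral>\<^sup>+w\<in>A. ennreal (U (wealth S c \<phi> T w)) \<partial>M) + (\<integral>\<^sup>+w\<in>A. ennreal (- V t (wealth S c \<phi> t w) w) \<partial>M) \<le>
      (\<integral>\<^sup>+w\<in>A. ennreal (V t (wealth S c \<phi> t w) w) \<partial>M) + (\<integral>\<^sup>+w\<in>A. ennreal (- U (wealth S c \<phi> T w)) \<partial>M))"
  using \<open>t \<le> T\<close>
proof (induction rule: inc_induct)
  case base
  then show ?case using neg by (simp add: V_T)
next
  case (step n)
  interpret sf: sigma_finite_subalgebra M "F n" using sigma_finite_F step by simp
  let ?E = "nn_cond_exp M (F n)"
  let ?f = "\<lambda>w. U (wealth S c \<phi> T w)"
  let ?X = "wealth S c \<phi> n" and ?\<xi> = "\<phi> (Suc n)"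
  let ?g = "next_value n ?X ?\<xi>" and ?h = "\<lambda>w. V n (?X w) w"
  have X: "?X \<in> borel_measurable (F n)" using \<phi> step by (intro wealth_meas) auto
  have \<xi>: "?\<xi> \<in> borel_measurable (F n)"
    using \<phi> step by (auto simp: strategies_def dest!: bspec[of _ _ "Suc n"])
  have [measurable]: "?g \<in> borel_measurable M"
    using next_value_meas[OF _ X \<xi>] step by (intro meas_F_M[of "Suc n"]) auto
  have [measurable]: "?h \<in> borel_measurable M"
    using V_comp_meas[OF _ X] step by (intro meas_F_M[of n]) auto
  have IH1: "(\<integral>\<^sup>+w. ennreal (- ?g w) \<partial>M) < \<infinity>"
    using step.IH by (simp add: wealth_Suc)
  have IH2: "(\<integral>\<^sup>+w\<in>A. ennreal (?f w) \<partial>M) + (\<integral>\<^sup>+w\<in>A. ennreal (- ?g w) \<partial>M) \<le>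
      (\<integral>\<^sup>+w\<in>A. ennreal (?g w) \<partial>M) + (\<integral>\<^sup>+w\<in>A. ennreal (- ?f w) \<partial>M)"
    if "A \<in> sets (F (Suc n))" for A
    using step.IH that by (simp add: wealth_Suc)
  have one: "AE w in M. ?E (\<lambda>w. ennreal (?g w)) w + ennreal (- ?h w) \<le>
      ennreal (?h w) + ?E (\<lambda>w. ennreal (- ?g w)) w"
    using one_step[OF _ X \<xi>] step by auto
  show ?case
  proof (intro conjI ballI)
    have "AE w in M. ennreal (- ?h w) \<le> ?E (\<lambda>w. ennreal (- ?g w)) w"
      using one
    proof eventually_elim
      case (elim w)
      show ?case
      proof (cases "?h w \<ge> 0")
        case True
        then have "ennreal (- ?h w) = 0" by (simp add: ennreal_neg)
        then show ?thesis by simp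
      next
        case False
        then have "ennreal (?h w) = 0" by (simp add: ennreal_neg)
        with elim show ?thesis by (auto intro: order.trans[rotated] simp: add_increasing)
      qed
    qed
    then have "(\<integral>\<^sup>+w. ennreal (- ?h w) \<partial>M) \<le> (\<integral>\<^sup>+w. 1 * ?E (\<lambda>w. ennreal (- ?g w)) w \<partial>M)"
      by (intro nn_integral_mono_AE) simp
    also have "\<dots> = (\<integral>\<^sup>+w. 1 * ennreal (- ?g w) \<partial>M)"
      by (rule sf.nn_cond_exp_intg) measurable
    also have "\<dots> < \<infinity>" using IH1 by simp
    finally show "(\<integral>\<^sup>+w. ennreal (- ?h w) \<partial>M) < \<infinity>" .
  next
    fix A assume A[measurable]: "A \<in> sets (F n)"
    have [measurable]: "A \<in> sets M" using A subalgebra_F[of n] step by (auto simp: subalgebra_def)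
    have AS: "A \<in> sets (F (Suc n))" using A filtration_F[of n "Suc n"] step by auto
    have cexp: "(\<integral>\<^sup>+w\<in>A. ?E f w \<partial>M) = (\<integral>\<^sup>+w\<in>A. f w \<partial>M)" if "f \<in> borel_measurable M" for f
      using sf.nn_cond_exp_intg[of "indicator A" f] that by (simp add: mult.commute)
    have "(\<integral>\<^sup>+w\<in>A. (?E (\<lambda>w. ennreal (?g w)) w + ennreal (- ?h w)) \<partial>M) \<le>
        (\<integral>\<^sup>+w\<in>A. (ennreal (?h w) + ?E (\<lambda>w. ennreal (- ?g w)) w) \<partial>M)"
      using one by (intro nn_integral_mono_AE) (auto elim!: eventually_mono intro: mult_right_mono)
    then have gh: "(\<integral>\<^sup>+w\<in>A. ennreal (?g w) \<partial>M) + (\<integral>\<^sup>+w\<in>A. ennreal (- ?h w) \<partial>M) \<le>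
        (\<integral>\<^sup>+w\<in>A. ennreal (?h w) \<partial>M) + (\<integral>\<^sup>+w\<in>A. ennreal (- ?g w) \<partial>M)"
      by (simp add: distrib_right nn_integral_add cexp)
    have fin: "(\<integral>\<^sup>+w\<in>A. ennreal (- ?g w) \<partial>M) \<noteq> \<top>"
    proof -
      have "(\<integral>\<^sup>+w\<in>A. ennreal (- ?g w) \<partial>M) \<le> (\<integral>\<^sup>+w. ennreal (- ?g w) \<partial>M)"
        by (intro nn_integral_mono) (auto split: split_indicator)
      with IH1 show ?thesis by (auto simp: top_unique)
    qed
    \<comment> \<open>Transitivity of the two inequalities: the positive part \<open>g\<close> is
      bounded away and the finite \<open>g'\<close> is cancelled, so \<open>g\<close> is never
      subtracted.\<close>
    have cancel: "a + h' \<le> h + b" if "a + g' \<le> g + b" "g + h' \<le> h + g'" "g' \<noteq> \<top>" for a b g g' h h' :: ennreal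
    proof -
      have "g' + (a + h') = (a + g') + h'" by (simp add: ac_simps)
      also have "\<dots> \<le> (g + h') + b" using add_right_mono[OF that(1), of h'] by (simp add: ac_simps)
      also have "\<dots> \<le> g' + (h + b)" using add_right_mono[OF that(2), of b] by (simp add: ac_simps)
      finally show ?thesis using that(3) by (simp add: ennreal_add_left_cancel_le)
    qed
    show "(\<integral>\<^sup>+w\<in>A. ennreal (?f w) \<partial>M) + (\<integral>\<^sup>+w\<in>A. ennreal (- ?h w) \<partial>M) \<le>
      (\<integral>\<^sup>+w\<in>A. ennreal (?h w) \<partial>M) + (\<integral>\<^sup>+w\<in>A. ennreal (- ?f w) \<partial>M)"
      by (rule cancel[OF IH2[OF AS] gh fin])
  qed
qed

lemma V0_pos_finite: "(\<integral>\<^sup>+w. ennreal (V 0 x w) \<partial>M) < \<infinity>"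
proof (rule ccontr)
  assume "\<not> ?thesis"
  then have i: "(\<integral>\<^sup>+w. ennreal (V 0 x w) \<partial>M) = \<infinity>" by (auto simp: less_top[symmetric])
  then have "(\<integral>\<^sup>+w. ennreal (- V 0 x w) \<partial>M) \<noteq> \<infinity>"
    using V0(1)[of x] by (auto simp: expectation_defined_def)
  then obtain r where "(\<integral>\<^sup>+w. ennreal (- V 0 x w) \<partial>M) = ennreal r" "r \<ge> 0"
    by (cases "(\<integral>\<^sup>+w. ennreal (- V 0 x w) \<partial>M)") auto
  with i V0(2)[of x] show False by (simp add: gen_expectation_def)
qed

text \<open>At time 0 the wealth is the constant \<open>c\<close> for every strategy, so the
  supermartingale inequality bounds gains by losses plus one number depending on \<open>c\<close>
  alone. A finite expected loss therefore already gives integrability.\<close>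

lemma expected_utility_bounded:
  obtains B where "\<And>\<phi>. \<phi> \<in> strategies F T \<Longrightarrow> (\<integral>\<^sup>+w. ennreal (- U (wealth S c \<phi> T w)) \<partial>M) < \<infinity> \<Longrightarrow>
    integrable M (\<lambda>w. U (wealth S c \<phi> T w)) \<and> (\<integral>w. U (wealth S c \<phi> T w) \<partial>M) \<le> B"
proof (rule that[of "enn2real (\<integral>\<^sup>+w. ennreal (V 0 c w) \<partial>M)"])
  fix \<phi> assume \<phi>: "\<phi> \<in> strategies F T" and neg: "(\<integral>\<^sup>+w. ennreal (- U (wealth S c \<phi> T w)) \<partial>M) < \<infinity>"
  let ?f = "\<lambda>w. U (wealth S c \<phi> T w)" and ?B = "(\<integral>\<^sup>+w. ennreal (V 0 c w) \<partial>M)"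
  have [measurable]: "?f \<in> borel_measurable M"
    using meas_F_M[OF _ wealth_meas[OF \<phi>, of T c]] by measurable
  have "space M \<in> sets (F 0)" using subalgebra_F[of 0] by (metis subalgebra_def sets.top le0)
  then have *: "(\<integral>\<^sup>+w\<in>space M. ennreal (?f w) \<partial>M) + (\<integral>\<^sup>+w\<in>space M. ennreal (- V 0 (wealth S c \<phi> 0 w) w) \<partial>M) \<le>
      (\<integral>\<^sup>+w\<in>space M. ennreal (V 0 (wealth S c \<phi> 0 w) w) \<partial>M) + (\<integral>\<^sup>+w\<in>space M. ennreal (- ?f w) \<partial>M)"
    using supermartingale[OF \<phi> neg, of 0] by auto
  have whole: "(\<integral>\<^sup>+w\<in>space M. g w \<partial>M) = (\<integral>\<^sup>+w. g w \<partial>M)" for g :: "'a \<Rightarrow> ennreal"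
    by (intro nn_integral_cong) auto
  have le: "(\<integral>\<^sup>+w. ennreal (?f w) \<partial>M) \<le> ?B + (\<integral>\<^sup>+w. ennreal (- ?f w) \<partial>M)"
    using * unfolding whole by (auto simp: wealth_def intro: order.trans[rotated] simp: add_increasing2)
  also have "\<dots> < \<infinity>" using neg V0_pos_finite by simp
  finally have int: "integrable M ?f"
    using neg by (auto simp: real_integrable_def)
  moreover have "(\<integral>w. ?f w \<partial>M) \<le> enn2real ?B"
  proof -
    have "enn2real (\<integral>\<^sup>+w. ennreal (?f w) \<partial>M) \<le> enn2real (?B + (\<integral>\<^sup>+w. ennreal (- ?f w) \<partial>M))"
      using le neg V0_pos_finite by (intro enn2real_mono) auto
    also have "\<dots> = enn2real ?B + enn2real (\<integral>\<^sup>+w. ennreal (- ?f w) \<partial>M)"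
      using neg V0_pos_finite by (intro enn2real_plus) auto
    finally show ?thesis using int by (simp add: real_lebesgue_integral_def)
  qed
  ultimately show "integrable M ?f \<and> (\<integral>w. ?f w \<partial>M) \<le> enn2real ?B" by simp
qed

text \<open>The norm of an increment is not the gain of a fixed position, but each
  \<open>b \<bullet> y\<close> is. The norm is at most the sum of the absolute coordinates, so some
  coordinate reaches its fraction \<open>1 / DIM('b)\<close>.\<close>

lemma norm_le_basis_inner:
  fixes y :: "'b::euclidean_space"
  shows "\<exists>b\<in>Basis \<union> uminus ` Basis. norm y \<le> real DIM('b) * (b \<bullet> y)"
proof (rule ccontr)
  assume neg: "\<not> ?thesis"
  have "real DIM('b) * \<bar>y \<bullet> b\<bar> < norm y" if "b \<in> Basis" for b
  proof -
    have "\<not> norm y \<le> real DIM('b) * (b \<bullet> y)" "\<not> norm y \<le> real DIM('b) * ((- b) \<bullet> y)"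
      using neg that by blast+
    then show ?thesis by (auto simp: abs_if inner_commute)
  qed
  then have "(\<Sum>b\<in>Basis. real DIM('b) * \<bar>y \<bullet> b\<bar>) < (\<Sum>b\<in>(Basis :: 'b set). norm y)"
    by (intro sum_strict_mono) auto
  then have "real DIM('b) * (\<Sum>b\<in>Basis. \<bar>y \<bullet> b\<bar>) < real DIM('b) * norm y"
    by (simp add: sum_distrib_left)
  then show False using norm_le_l1[of y] by simp
qed

lemma nn_cond_exp_sum_finite:
  assumes "t \<le> T" "finite B" "\<And>b. b \<in> B \<Longrightarrow> f b \<in> borel_measurable M"
    "\<And>b. b \<in> B \<Longrightarrow> AE w in M. nn_cond_exp M (F t) (f b) w < \<infinity>"
  shows "AE w in M. nn_cond_exp M (F t) (\<lambda>w. \<Sum>b\<in>B. f b w) w < \<infinity>"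
  using assms(2-)
proof (induction B)
  interpret sf: sigma_finite_subalgebra M "F t" using sigma_finite_F assms(1) by simp
  case empty
  have "AE w in M. 0 = nn_cond_exp M (F t) (\<lambda>_. 0) w"
    by (rule sf.nn_cond_exp_F_meas) simp
  then show ?case by (auto elim!: eventually_mono simp: eq_commute[of 0])
next
  interpret sf: sigma_finite_subalgebra M "F t" using sigma_finite_F assms(1) by simp
  case (insert b B)
  have "AE w in M. nn_cond_exp M (F t) (f b) w + nn_cond_exp M (F t) (\<lambda>w. \<Sum>b\<in>B. f b w) w =
      nn_cond_exp M (F t) (\<lambda>w. f b w + (\<Sum>b\<in>B. f b w)) w"
    using insert.prems by (intro sf.nn_cond_exp_sum borel_measurable_sum) auto
  moreover have "AE w in M. nn_cond_exp M (F t) (\<lambda>w. \<Sum>b\<in>B. f b w) w < \<infinity>"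
    using insert by auto
  moreover have "AE w in M. nn_cond_exp M (F t) (f b) w < \<infinity>" using insert.prems by auto
  ultimately show ?case
      proof eventually_elim
    case (elim w)
    have "nn_cond_exp M (F t) (f b) w + nn_cond_exp M (F t) (\<lambda>w. \<Sum>b\<in>B. f b w) w < \<infinity>"
      using elim(2,3) by simp
    with elim(1) show ?case using insert.hyps by simp
  qed
qed

text \<open>Even when the investor gains from every price move, the next value stays conditionally
  integrable: such a wealth is dominated by finitely many ordinary strategies.\<close>

lemma cond_exp_gains_finite:
  assumes t: "t < T" and Z: "Z \<in> borel_measurable (F t)" and K: "K \<in> borel_measurable (F t)"
    and K0: "\<And>w. K w \<ge> 0"
  shows "AE w in M. nn_cond_exp M (F t)
    (\<lambda>w. ennreal (V (Suc t) (Z w + K w * norm (\<Delta> (Suc t) w)) w)) w < \<infinity>"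
proof -
  interpret sf: sigma_finite_subalgebra M "F t" using sigma_finite_F t by simp
  let ?B = "Basis \<union> uminus ` Basis :: (real ^ 'd) set"
  let ?\<xi> = "\<lambda>b w. (real DIM(real ^ 'd) * K w) *\<^sub>R b :: real ^ 'd"
  have \<xi>: "?\<xi> b \<in> borel_measurable (F t)" for b using K by measurable
  have m: "next_value t Z (?\<xi> b) \<in> borel_measurable M" for b
    using next_value_meas[OF t Z \<xi>] t by (intro meas_F_M[of "Suc t"]) auto
  let ?V = "\<lambda>w. V (Suc t) (Z w + K w * norm (\<Delta> (Suc t) w)) w"
  have m': "?V \<in> borel_measurable M"
    using t by (intro meas_F_M[of "Suc t"] V_comp_meas borel_measurable_add borel_measurable_times
        borel_measurable_norm increment_meas meas_F_F[of t "Suc t", OF _ _ Z] meas_F_F[of t "Suc t", OF _ _ K]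
        measurable_compose[OF increment_meas borel_measurable_norm]) auto
  have "AE w in M. nn_cond_exp M (F t) (\<lambda>w. \<Sum>b\<in>?B. ennreal (next_value t Z (?\<xi> b) w)) w < \<infinity>"
    using t one_step[OF t Z \<xi>] m
    by (intro nn_cond_exp_sum_finite) (auto elim!: eventually_mono)
  moreover have "AE w in M. nn_cond_exp M (F t)
    (\<lambda>w. ennreal (?V w)) w \<le>
    nn_cond_exp M (F t) (\<lambda>w. \<Sum>b\<in>?B. ennreal (next_value t Z (?\<xi> b) w)) w"
  proof (rule sf.nn_cond_exp_mono)
    show "AE w in M. ennreal (?V w) \<le>
        (\<Sum>b\<in>?B. ennreal (next_value t Z (?\<xi> b) w))"
      using V_regular[OF Suc_leI[OF t]]
    proof eventually_elim
      case (elim w)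
      let ?y = "\<Delta> (Suc t) w"
      \<comment> \<open>The vector \<open>b\<close> depends on \<open>w\<close>, so the bound takes
        the sum over all candidates instead of a single position.\<close>
      obtain b where b: "b \<in> ?B" "norm ?y \<le> real DIM(real ^ 'd) * (b \<bullet> ?y)"
        using norm_le_basis_inner by blast
      have "K w * norm ?y \<le> K w * (real DIM(real ^ 'd) * (b \<bullet> ?y))"
        using b(2) K0 by (intro mult_left_mono)
      also have "\<dots> = ?\<xi> b w \<bullet> ?y" by simp
      finally have "?V w \<le> next_value t Z (?\<xi> b) w"
        by (intro monoD[OF conjunct1[OF elim]]) simp
      then have "ennreal (?V w) \<le> ennreal (next_value t Z (?\<xi> b) w)"
        by (rule ennreal_leI)
      also have "\<dots> \<le> (\<Sum>b\<in>?B. ennreal (next_value t Z (?\<xi> b) w))"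
        using b(1) by (intro member_le_sum) auto
      finally show ?case .
    qed
    show "(\<lambda>w. ennreal (?V w)) \<in> borel_measurable M"
      using m' by measurable
    show "(\<lambda>w. \<Sum>b\<in>?B. ennreal (next_value t Z (?\<xi> b) w)) \<in> borel_measurable M"
      by (intro borel_measurable_sum measurable_compose[OF m measurable_ennreal])
  qed
  ultimately show ?thesis by eventually_elim (rule order.strict_trans1)
qed

end

section \<open>Existence and uniqueness of the optimal strategy\<close>

context market
begin

text \<open>The capitals are combined as well: weights 1 and -1 cancel a common capital, weights
  \<open>1 / 2\<close> keep it, and a single factor rescales it.\<close>

lemma wealth_lincomb:
  "wealth S (a * c + b * d) (\<lambda>t w. a *\<^sub>R \<phi> t w + b *\<^sub>R \<psi> t w) t w =
   a * wealth S c \<phi> t w + b * wealth S d \<psi> t w"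
  unfolding wealth_def
  by (simp add: inner_add_left sum.distrib sum_distrib_left algebra_simps)

lemma strategies_lincomb:
  "\<phi> \<in> strategies F T \<Longrightarrow> \<psi> \<in> strategies F T \<Longrightarrow> (\<lambda>t w. a *\<^sub>R \<phi> t w + b *\<^sub>R \<psi> t w) \<in> strategies F T"
  by (auto simp: strategies_def intro!: borel_measurable_add borel_measurable_scaleR)

lemma strategies_zero: "(\<lambda>_ _. 0) \<in> strategies F T"
  by (auto simp: strategies_def)

end

context arbitrage_free_market
begin

lemma reduced_strategies: "reduced \<phi> \<Longrightarrow> \<phi> \<in> strategies F T"
  by (simp add: reduced_def)

lemma reduced_lincomb: "reduced \<phi> \<Longrightarrow> reduced \<psi> \<Longrightarrow> reduced (\<lambda>t w. a *\<^sub>R \<phi> t w + b *\<^sub>R \<psi> t w)"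
  unfolding reduced_def
proof (intro conjI ballI strategies_lincomb)
  fix t assume red: "\<phi> \<in> strategies F T \<and> (\<forall>t\<in>{1..T}. AE w in M. \<phi> t w \<in> span (measure_support (\<kappa> t w)))"
    "\<psi> \<in> strategies F T \<and> (\<forall>t\<in>{1..T}. AE w in M. \<psi> t w \<in> span (measure_support (\<kappa> t w)))" and t: "t \<in> {1..T}"
  have "AE w in M. \<phi> t w \<in> span (measure_support (\<kappa> t w))" "AE w in M. \<psi> t w \<in> span (measure_support (\<kappa> t w))"
    using red t by auto
  then show "AE w in M. a *\<^sub>R \<phi> t w + b *\<^sub>R \<psi> t w \<in> span (measure_support (\<kappa> t w))"
    by eventually_elim (intro span_add span_scale)
qed auto

lemma reduce_strategy:
  assumes \<phi>: "\<phi> \<in> strategies F T"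
  obtains \<psi> where "reduced \<psi>" "\<And>c. AE w in M. wealth S c \<psi> T w = wealth S c \<phi> T w"
proof
  define \<psi> where "\<psi> t w = support_proj (\<kappa> t w) (\<phi> t w)" for t w
  have "\<psi> t \<in> borel_measurable (F (t - 1)) \<and> (AE w in M. \<psi> t w \<in> span (measure_support (\<kappa> t w))) \<and>
      (AE w in M. \<psi> t w \<bullet> \<Delta> t w = \<phi> t w \<bullet> \<Delta> t w)" if t: "t \<in> {1..T}" for t
  proof -
    interpret cl: cond_law M "F (t - 1)" "\<Delta> t" "\<kappa> t" by (rule cond_law_F[OF t])
    show ?thesis
      unfolding \<psi>_def using strategy_meas[OF \<phi> t]
      by (intro conjI cl.support_proj_meas cl.support_proj_gains AE_I2 borel_prob.support_proj_in
          cl.borel_prob_kernel)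
  qed
  then have *: "\<forall>t\<in>{1..T}. \<psi> t \<in> borel_measurable (F (t - 1))"
    "\<forall>t\<in>{1..T}. AE w in M. \<psi> t w \<in> span (measure_support (\<kappa> t w))"
    "\<forall>t\<in>{1..T}. AE w in M. \<psi> t w \<bullet> \<Delta> t w = \<phi> t w \<bullet> \<Delta> t w"
    by blast+
  then show "reduced \<psi>" by (simp add: reduced_def strategies_def)
  have "AE w in M. \<forall>t\<in>{1..T}. \<psi> t w \<bullet> \<Delta> t w = \<phi> t w \<bullet> \<Delta> t w"
    using *(3) by (intro AE_finite_allI) auto
  then show "AE w in M. wealth S c \<psi> T w = wealth S c \<phi> T w" for c
    by eventually_elim (simp add: wealth_def)
qed

lemma reduced_iff_support_space:
  assumes "\<phi> \<in> strategies F T"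
  shows "reduced \<phi> \<longleftrightarrow> (\<forall>t\<in>{1..T}. AE w in M. \<phi> t w \<in> support_space \<kappa> t w)"
proof -
  have "(AE w in M. \<phi> t w \<in> span (measure_support (\<kappa> t w))) \<longleftrightarrow> (AE w in M. \<phi> t w \<in> support_space \<kappa> t w)"
    if t: "t \<in> {1..T}" for t
  proof -
    interpret cl: cond_law M "F (t - 1)" "\<Delta> t" "\<kappa> t" by (rule cond_law_F[OF t])
    have eq: "AE w in M. support_space \<kappa> t w = span (measure_support (\<kappa> t w))"
      unfolding support_space_def by (rule cl.AE_affine_hull_eq_span[OF one_period_no_arbitrage[OF t]])
    show ?thesis
    proof
      assume "AE w in M. \<phi> t w \<in> span (measure_support (\<kappa> t w))"
      with eq show "AE w in M. \<phi> t w \<in> support_space \<kappa> t w" by eventually_elim simp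
    next
      assume "AE w in M. \<phi> t w \<in> support_space \<kappa> t w"
      with eq show "AE w in M. \<phi> t w \<in> span (measure_support (\<kappa> t w))" by eventually_elim simp
    qed
  qed
  with assms show ?thesis by (simp add: reduced_def)
qed

lemma AE_eq_0_of_prob_size:
  assumes "f \<in> borel_measurable M" "prob_size f = 0"
  shows "AE w in M. f w = 0"
proof -
  have "AE w in M. min 1 \<bar>f w\<bar> = 0"
    using assms integral_nonneg_eq_0_iff_AE[OF integrable_min_abs[OF assms(1)]]
    by (simp add: prob_size_def)
  then show ?thesis by eventually_elim (auto simp: min_def split: if_splits)
qed

text \<open>The embedding applied to a constant sequence, namely the difference of the two
  strategies started from zero capital.\<close>

lemma reduced_unique:
  assumes \<phi>: "reduced \<phi>" and \<psi>: "reduced \<psi>"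
    and eq: "AE w in M. wealth S c \<phi> T w = wealth S c \<psi> T w" and t: "t \<in> {1..T}"
  shows "AE w in M. \<phi> t w = \<psi> t w"
proof -
  let ?d = "\<lambda>t w. 1 *\<^sub>R \<phi> t w + (- 1) *\<^sub>R \<psi> t w"
  have d: "reduced ?d" by (rule reduced_lincomb[OF \<phi> \<psi>])
  have [measurable]: "wealth S 0 ?d T \<in> borel_measurable M"
    by (rule wealth_meas_M[OF reduced_strategies[OF d]]) simp
  have "AE w in M. wealth S 0 ?d T w = 0"
    using eq
  proof eventually_elim
    case (elim w)
    then show ?case using wealth_lincomb[of 1 c "-1" c \<phi> \<psi> T w] by simp
  qed
  then have "prob_size (\<lambda>w. max 0 (- wealth S 0 ?d T w)) = 0"
    unfolding prob_size_def by (intro integral_eq_zero_AE) (auto elim!: eventually_mono)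
  then have "((\<lambda>n::nat. prob_size (\<lambda>w. max 0 (- wealth S 0 ?d T w))) \<longlongrightarrow> 0) sequentially" by simp
  from reduced_strategies_tendsto_0(1)[OF d this t]
  have "prob_size (\<lambda>w. norm (?d t w)) = 0"
    by (simp add: tendsto_const_iff)
  moreover have "(\<lambda>w. norm (?d t w)) \<in> borel_measurable M"
    using strategy_meas[OF reduced_strategies[OF d] t] t
    by (intro borel_measurable_norm meas_F_M[of "t - 1"]) auto
  ultimately have "AE w in M. norm (?d t w) = 0" by (intro AE_eq_0_of_prob_size)
  then show ?thesis by eventually_elim simp
qed

text \<open>Convergence in probability is not pointwise, but along a subsequence with consecutive
  distances below \<open>(1 / 2) ^ k\<close> the distances are almost surely summable. Passing to
  versions that converge at every point makes limits and suprema of the positions finite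
  everywhere.\<close>

lemma reduced_Cauchy_subseq:
  assumes red: "\<And>n. reduced (\<phi> n)"
    and lim: "\<And>t. t \<in> {1..T} \<Longrightarrow>
      ((\<lambda>(n, m). prob_size (\<lambda>w. norm (\<phi> n t w - \<phi> m t w))) \<longlongrightarrow> 0) (sequentially \<times>\<^sub>F sequentially)"
  obtains r :: "nat \<Rightarrow> nat" and \<psi> where "filterlim r at_top sequentially"
    "\<And>k. reduced (\<psi> k)" "\<And>k c. AE w in M. wealth S c (\<psi> k) T w = wealth S c (\<phi> (r k)) T w"
    "\<And>t w. convergent (\<lambda>k. \<psi> k t w)"
proof -
  have m[measurable]: "\<phi> n t \<in> borel_measurable M" if "t \<in> {1..T}" for n t
    using strategy_meas[OF reduced_strategies[OF red] that] that by (intro meas_F_M[of "t - 1"]) auto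
  have "\<exists>N. \<forall>n\<ge>N. \<forall>m\<ge>N. \<forall>t\<in>{1..T}. prob_size (\<lambda>w. norm (\<phi> n t w - \<phi> m t w)) < (1 / 2) ^ k" for k :: nat
  proof -
    have "eventually (\<lambda>(n, m). \<forall>t\<in>{1..T}. prob_size (\<lambda>w. norm (\<phi> n t w - \<phi> m t w)) < (1 / 2) ^ k)
        (sequentially \<times>\<^sub>F sequentially)"
      using order_tendstoD(2)[OF lim, of _ "(1 / 2) ^ k"]
      by (auto simp: split_beta' intro!: eventually_ball_finite)
    then obtain P Q where PQ: "eventually P sequentially" "eventually Q sequentially"
      "\<And>n m. P n \<Longrightarrow> Q m \<Longrightarrow> \<forall>t\<in>{1..T}. prob_size (\<lambda>w. norm (\<phi> n t w - \<phi> m t w)) < (1 / 2) ^ k"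
      by (auto simp: eventually_prod_filter)
    obtain N1 N2 where "\<And>n. n \<ge> N1 \<Longrightarrow> P n" "\<And>n. n \<ge> N2 \<Longrightarrow> Q n"
      using PQ(1,2) by (auto simp: eventually_sequentially)
    with PQ(3) show ?thesis by (intro exI[of _ "max N1 N2"]) auto
  qed
  then obtain N where N: "\<And>k n m t. n \<ge> N k \<Longrightarrow> m \<ge> N k \<Longrightarrow> t \<in> {1..T} \<Longrightarrow>
      prob_size (\<lambda>w. norm (\<phi> n t w - \<phi> m t w)) < (1 / 2) ^ k"
    by metis
  \<comment> \<open>The sum puts \<open>r k\<close> and \<open>r (Suc k)\<close> beyond
    \<open>N k\<close>, and the summand \<open>k\<close> sends the index to infinity.\<close>
  define r where "r k = k + (\<Sum>j\<le>k. N j)" for k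
  have rN: "r k \<ge> N k" "r (Suc k) \<ge> N k" for k
    using member_le_sum[of k "{..k}" N] member_le_sum[of k "{..Suc k}" N] by (auto simp: r_def)
  have r: "filterlim r at_top sequentially"
    by (rule filterlim_at_top_mono[OF filterlim_ident]) (auto simp: r_def)
  have AEC: "AE w in M. Cauchy (\<lambda>k. \<phi> (r k) t w)" if t: "t \<in> {1..T}" for t
  proof -
    let ?d = "\<lambda>k w. norm (\<phi> (r (Suc k)) t w - \<phi> (r k) t w)"
    note [measurable] = m[OF t]
    have "(\<integral>\<^sup>+w. (\<Sum>k. ennreal (min 1 \<bar>?d k w\<bar>)) \<partial>M) = (\<Sum>k. \<integral>\<^sup>+w. ennreal (min 1 \<bar>?d k w\<bar>) \<partial>M)"
      by (rule nn_integral_suminf) measurable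
    also have "\<dots> = (\<Sum>k. ennreal (prob_size (?d k)))"
      by (intro suminf_cong ennreal_prob_size[symmetric]) measurable
    also have "\<dots> \<le> (\<Sum>k. ennreal ((1 / 2) ^ k))"
      using N[OF rN(2) rN(1) t] by (intro suminf_le ennreal_leI less_imp_le) auto
    also have "\<dots> = ennreal (\<Sum>k. (1 / 2) ^ k)"
      by (rule suminf_ennreal2) (auto intro: summable_geometric)
    also have "\<dots> < \<infinity>" by simp
    finally have "AE w in M. (\<Sum>k. ennreal (min 1 \<bar>?d k w\<bar>)) \<noteq> \<infinity>"
      by (intro nn_integral_noteq_infinite) auto
    then show ?thesis
    proof eventually_elim
      case (elim w)
      have sm: "summable (\<lambda>k. min 1 \<bar>?d k w\<bar>)"
        using elim by (intro summable_suminf_not_top) auto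
      then have "(\<lambda>k. min 1 \<bar>?d k w\<bar>) \<longlonglongrightarrow> 0" by (rule summable_LIMSEQ_zero)
      \<comment> \<open>The terms of a convergent series are eventually below 1, where the
        truncation by \<open>min 1\<close> has no effect.\<close>
      then have "eventually (\<lambda>k. min 1 \<bar>?d k w\<bar> < 1) sequentially" by (intro order_tendstoD) auto
      then have ev: "eventually (\<lambda>k. min 1 \<bar>?d k w\<bar> = ?d k w) sequentially"
        by eventually_elim auto
      have "summable (\<lambda>k. ?d k w)"
        using sm unfolding summable_cong[OF ev] .
      then have "summable (\<lambda>k. \<phi> (r (Suc k)) t w - \<phi> (r k) t w)" by (rule summable_norm_cancel)
      then have "convergent (\<lambda>k. \<phi> (r k) t w - \<phi> (r 0) t w)"
        unfolding summable_iff_convergent sum_lessThan_telescope[of "\<lambda>k. \<phi> (r k) t w"] .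
      then have "convergent (\<lambda>k. (\<phi> (r k) t w - \<phi> (r 0) t w) + \<phi> (r 0) t w)"
        by (intro convergent_add convergent_const)
      then show ?case by (auto intro: convergent_Cauchy)
    qed
  qed
  \<comment> \<open>The Cauchy event at time \<open>t\<close> lies in \<open>F (t - 1)\<close>, so
    replacing the position by 0 off it preserves predictability.\<close>
  define \<psi> where "\<psi> k t w = (if Cauchy (\<lambda>k. \<phi> (r k) t w) then \<phi> (r k) t w else 0)" for k t w
  have eq: "AE w in M. \<psi> k t w = \<phi> (r k) t w" if "t \<in> {1..T}" for k t
    using AEC[OF that] by eventually_elim (simp add: \<psi>_def)
  show thesis
  proof (rule that[OF r])
    show "convergent (\<lambda>k. \<psi> k t w)" for t w
      by (cases "Cauchy (\<lambda>k. \<phi> (r k) t w)") (auto simp: \<psi>_def Cauchy_convergent_iff convergent_const)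
    show "reduced (\<psi> k)" for k
      unfolding reduced_def strategies_def
    proof (intro conjI CollectI ballI)
      fix t assume t: "t \<in> {1..T}"
      have [measurable]: "\<phi> n t \<in> borel_measurable (F (t - 1))" for n
        by (rule strategy_meas[OF reduced_strategies[OF red] t])
      show "\<psi> k t \<in> borel_measurable (F (t - 1))"
        unfolding \<psi>_def by measurable
      have "AE w in M. \<phi> (r k) t w \<in> span (measure_support (\<kappa> t w))"
        using red t by (auto simp: reduced_def)
      with eq[OF t, of k] show "AE w in M. \<psi> k t w \<in> span (measure_support (\<kappa> t w))"
        by eventually_elim simp
    qed
    show "AE w in M. wealth S c (\<psi> k) T w = wealth S c (\<phi> (r k)) T w" for k c
    proof -
      have "AE w in M. \<forall>t\<in>{1..T}. \<psi> k t w = \<phi> (r k) t w"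
        using eq by (intro AE_finite_allI) auto
      then show ?thesis by eventually_elim (simp add: wealth_def)
    qed
  qed
qed

end

lemma (in prob_space) prob_ge_le_prob_size:
  assumes [measurable]: "f \<in> borel_measurable M" and "0 \<le> r" "r \<le> 1"
  shows "r * prob {w\<in>space M. r \<le> \<bar>f w\<bar>} \<le> prob_size f"
proof -
  have "r * prob {w\<in>space M. r \<le> \<bar>f w\<bar>} = (\<integral>w. r * indicator {w\<in>space M. r \<le> \<bar>f w\<bar>} w \<partial>M)"
    by simp
  also have "\<dots> \<le> (\<integral>w. min 1 \<bar>f w\<bar> \<partial>M)"
    using assms(2,3) by (intro integral_mono integrable_mult_right integrable_real_indicator integrable_min_abs)
      (auto simp: indicator_def emeasure_eq_measure)
  finally show ?thesis by (simp add: prob_size_def)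
qed

lemma integrable_indicator_times:
  fixes f :: "'a \<Rightarrow> real"
  assumes "A \<in> sets M" "integrable M f"
  shows "integrable M (\<lambda>w. indicator A w * f w)"
  using integrable_real_mult_indicator[OF assms] by (simp add: mult.commute)

locale utility_problem = arbitrage_free_market M F S T \<kappa> + value_market M F S T U V
  for M :: "'a measure" and F :: "nat \<Rightarrow> 'a measure" and S :: "nat \<Rightarrow> 'a \<Rightarrow> real ^ 'd" and T
    and \<kappa> :: "nat \<Rightarrow> 'a \<Rightarrow> (real ^ 'd) measure" and U :: "real \<Rightarrow> real" and V +
  fixes c :: real
  assumes growth: "assumption_B U \<or> assumption_C U"
begin

abbreviation "W \<phi> \<equiv> wealth S c \<phi> T"

text \<open>The admissible strategies of finite expected utility. Every other admissible one has
  value \<open>- \<infinity>\<close> while the zero strategy is feasible, so the extended-real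
  problem reduces to a real one.\<close>

definition feasible :: "(nat \<Rightarrow> 'a \<Rightarrow> real ^ 'd) \<Rightarrow> bool" where
  "feasible \<phi> \<longleftrightarrow> \<phi> \<in> strategies F T \<and> integrable M (\<lambda>w. U (W \<phi> w))"

abbreviation "EU \<phi> \<equiv> \<integral>w. U (W \<phi> w) \<partial>M"

lemma U_wealth_meas: "\<phi> \<in> strategies F T \<Longrightarrow> (\<lambda>w. U (wealth S d \<phi> T w)) \<in> borel_measurable M"
  by (intro measurable_compose[OF wealth_meas_M meas_U]) auto

text \<open>Gains are bounded by losses through the value at time 0, so integrability of midpoints
  and limits need only be checked on the losses.\<close>

lemma feasible_of_neg:
  "\<phi> \<in> strategies F T \<Longrightarrow> (\<integral>\<^sup>+w. ennreal (- U (W \<phi> w)) \<partial>M) < \<infinity> \<Longrightarrow> feasible \<phi>"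
  using expected_utility_bounded[of c] unfolding feasible_def by metis

lemma integrable_neg_finite:
  fixes f :: "'a \<Rightarrow> real"
  shows "integrable M f \<Longrightarrow> (\<integral>\<^sup>+w. ennreal (- f w) \<partial>M) < \<infinity>"
  by (auto simp: real_integrable_def less_top)

lemma EU_bounded: "\<exists>B. \<forall>\<phi>. feasible \<phi> \<longrightarrow> EU \<phi> \<le> B"
proof -
  obtain B where "\<And>\<phi>. \<phi> \<in> strategies F T \<Longrightarrow> (\<integral>\<^sup>+w. ennreal (- U (wealth S c \<phi> T w)) \<partial>M) < \<infinity> \<Longrightarrow>
    integrable M (\<lambda>w. U (wealth S c \<phi> T w)) \<and> (\<integral>w. U (wealth S c \<phi> T w) \<partial>M) \<le> B"
    by (rule expected_utility_bounded[of c]) blast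
  then show ?thesis unfolding feasible_def using integrable_neg_finite by blast
qed

lemma feasible_zero: "feasible (\<lambda>_ _. 0)"
  by (simp add: feasible_def strategies_zero wealth_def)

lemma gen_expectation_feasible: "feasible \<phi> \<Longrightarrow> gen_expectation M (\<lambda>w. U (W \<phi> w)) = ereal (EU \<phi>)"
proof -
  assume "feasible \<phi>"
  then have int: "integrable M (\<lambda>w. U (W \<phi> w))" by (simp add: feasible_def)
  then obtain p where p: "(\<integral>\<^sup>+w. ennreal (U (W \<phi> w)) \<partial>M) = ennreal p" "p \<ge> 0"
    by (cases "\<integral>\<^sup>+w. ennreal (U (W \<phi> w)) \<partial>M") (auto simp: real_integrable_def)
  from int obtain n where n: "(\<integral>\<^sup>+w. ennreal (- U (W \<phi> w)) \<partial>M) = ennreal n" "n \<ge> 0"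
    by (cases "\<integral>\<^sup>+w. ennreal (- U (W \<phi> w)) \<partial>M") (auto simp: real_integrable_def)
  from int p n show ?thesis
    by (simp add: gen_expectation_def real_lebesgue_integral_def)
qed

lemma feasible_admissible: "feasible \<phi> \<Longrightarrow> \<phi> \<in> admissible M F S T U c"
  by (auto simp: feasible_def admissible_def expectation_defined_def real_integrable_def)

lemma gen_expectation_not_feasible:
  assumes "\<phi> \<in> admissible M F S T U c" "\<not> feasible \<phi>"
  shows "gen_expectation M (\<lambda>w. U (W \<phi> w)) = - \<infinity>"
proof -
  have str: "\<phi> \<in> strategies F T" and def: "expectation_defined M (\<lambda>w. U (W \<phi> w))"
    using assms by (auto simp: admissible_def)
  have neg: "(\<integral>\<^sup>+w. ennreal (- U (W \<phi> w)) \<partial>M) = \<infinity>"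
    using feasible_of_neg[OF str] assms(2) by (auto simp: less_top[symmetric])
  then obtain p where "(\<integral>\<^sup>+w. ennreal (U (W \<phi> w)) \<partial>M) = ennreal p" "p \<ge> 0"
    using def by (cases "\<integral>\<^sup>+w. ennreal (U (W \<phi> w)) \<partial>M") (auto simp: expectation_defined_def)
  with neg show ?thesis by (simp add: gen_expectation_def)
qed

lemma optimal_iff:
  "optimal_strategy M F S T U c \<phi> \<longleftrightarrow> feasible \<phi> \<and> (\<forall>\<psi>. feasible \<psi> \<longrightarrow> EU \<psi> \<le> EU \<phi>)"
proof
  assume opt: "optimal_strategy M F S T U c \<phi>"
  have le: "ereal (EU \<psi>) \<le> gen_expectation M (\<lambda>w. U (W \<phi> w))" if "feasible \<psi>" for \<psi>
    using opt SUP_upper[OF feasible_admissible[OF that], of "\<lambda>\<phi>. gen_expectation M (\<lambda>w. U (W \<phi> w))"]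
    by (simp add: optimal_strategy_def optimal_value_def gen_expectation_feasible[OF that])
  have "feasible \<phi>"
  proof (rule ccontr)
    assume "\<not> feasible \<phi>"
    with opt have "gen_expectation M (\<lambda>w. U (W \<phi> w)) = - \<infinity>"
      by (intro gen_expectation_not_feasible) (auto simp: optimal_strategy_def)
    with le[OF feasible_zero] show False by simp
  qed
  with le show "feasible \<phi> \<and> (\<forall>\<psi>. feasible \<psi> \<longrightarrow> EU \<psi> \<le> EU \<phi>)"
    by (simp add: gen_expectation_feasible)
next
  assume *: "feasible \<phi> \<and> (\<forall>\<psi>. feasible \<psi> \<longrightarrow> EU \<psi> \<le> EU \<phi>)"
  have "gen_expectation M (\<lambda>w. U (W \<psi> w)) \<le> gen_expectation M (\<lambda>w. U (W \<phi> w))"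
    if "\<psi> \<in> admissible M F S T U c" for \<psi>
    using * that by (cases "feasible \<psi>") (auto simp: gen_expectation_feasible gen_expectation_not_feasible)
  then have "optimal_value M F S T U c = gen_expectation M (\<lambda>w. U (W \<phi> w))"
    unfolding optimal_value_def using * feasible_admissible
    by (intro antisym SUP_least SUP_upper) auto
  with * show "optimal_strategy M F S T U c \<phi>"
    by (simp add: optimal_strategy_def feasible_admissible)
qed

lemma feasible_AE_cong:
  assumes "feasible \<phi>" "\<psi> \<in> strategies F T" "AE w in M. W \<psi> w = W \<phi> w"
  shows "feasible \<psi>" "EU \<psi> = EU \<phi>"
proof -
  have "AE w in M. U (W \<psi> w) = U (W \<phi> w)" using assms(3) by eventually_elim simp
  moreover have "(\<lambda>w. U (W \<phi> w)) \<in> borel_measurable M" "(\<lambda>w. U (W \<psi> w)) \<in> borel_measurable M"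
    using assms by (auto simp: feasible_def intro!: U_wealth_meas)
  ultimately show "feasible \<psi>" "EU \<psi> = EU \<phi>"
    using assms by (auto simp: feasible_def intro: integrable_cong_AE_imp integral_cong_AE)
qed

lemma feasible_midpoint:
  assumes "feasible \<phi>" "feasible \<psi>"
  shows "feasible (\<lambda>t w. (1 / 2) *\<^sub>R \<phi> t w + (1 / 2) *\<^sub>R \<psi> t w)"
    and "W (\<lambda>t w. (1 / 2) *\<^sub>R \<phi> t w + (1 / 2) *\<^sub>R \<psi> t w) w = (W \<phi> w + W \<psi> w) / 2"
proof -
  let ?\<rho> = "\<lambda>t w. (1 / 2) *\<^sub>R \<phi> t w + (1 / 2) *\<^sub>R \<psi> t w"
  have W: "W ?\<rho> w = (W \<phi> w + W \<psi> w) / 2" for w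
    using wealth_lincomb[of "1/2" c "1/2" c \<phi> \<psi> T w] by simp
  then show "W ?\<rho> w = (W \<phi> w + W \<psi> w) / 2" .
  have "(\<integral>\<^sup>+w. ennreal (- U (W ?\<rho> w)) \<partial>M) \<le> (\<integral>\<^sup>+w. ennreal (- ((U (W \<phi> w) + U (W \<psi> w)) / 2)) \<partial>M)"
    using midpoint_ge by (intro nn_integral_mono ennreal_leI) (auto simp: W)
  also have "\<dots> < \<infinity>"
    using assms by (intro integrable_neg_finite) (auto simp: feasible_def)
  finally show "feasible ?\<rho>"
    using assms by (intro feasible_of_neg strategies_lincomb) (auto simp: feasible_def)
qed

definition max_EU :: real where "max_EU = (SUP \<phi>\<in>Collect feasible. EU \<phi>)"

lemma EU_le_max_EU: "feasible \<phi> \<Longrightarrow> EU \<phi> \<le> max_EU"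
proof -
  assume "feasible \<phi>"
  moreover obtain B where "\<forall>\<phi>. feasible \<phi> \<longrightarrow> EU \<phi> \<le> B" using EU_bounded by blast
  then have "bdd_above (EU ` Collect feasible)" by (intro bdd_aboveI2[of _ _ B]) auto
  ultimately show ?thesis unfolding max_EU_def by (intro cSUP_upper) auto
qed

lemma maximizing_sequence:
  obtains \<phi> where "\<And>n. reduced (\<phi> n)" "\<And>n. feasible (\<phi> n)" "\<And>n. EU (\<phi> n) > max_EU - 1 / real (Suc n)"
proof -
  have "\<exists>\<phi>. reduced \<phi> \<and> feasible \<phi> \<and> EU \<phi> > max_EU - 1 / real (Suc n)" for n
  proof -
    have "max_EU - 1 / real (Suc n) < (SUP \<phi>\<in>Collect feasible. EU \<phi>)"
      by (simp add: max_EU_def)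
    then obtain \<phi> where \<phi>: "feasible \<phi>" "EU \<phi> > max_EU - 1 / real (Suc n)"
      using feasible_zero EU_bounded by (subst (asm) less_cSUP_iff) (auto intro: bdd_aboveI2)
    obtain \<psi> where \<psi>: "reduced \<psi>" "\<And>c. AE w in M. wealth S c \<psi> T w = wealth S c \<phi> T w"
      using reduce_strategy[of \<phi>] \<phi>(1) by (auto simp: feasible_def)
    from feasible_AE_cong[OF \<phi>(1) reduced_strategies[OF \<psi>(1)] \<psi>(2)] \<psi>(1) \<phi>(2) show ?thesis by metis
  qed
  then show thesis using that by metis
qed

text \<open>Halving the strategy and the initial capital cannot push the expected utility above \<open>u (c / 2)\<close>,
  so the halving inequality bounds the expected gains.\<close>

lemma expected_loss_bounded:
  obtains L where "\<And>\<phi>. feasible \<phi> \<Longrightarrow> EU \<phi> \<ge> max_EU - 1 \<Longrightarrow> (\<integral>w. max 0 (- U (W \<phi> w)) \<partial>M) \<le> L"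
proof -
  obtain p q C where pq: "p > 0" "q \<ge> 0" and half: "\<And>z. U (z / 2) \<ge> q * U z + p * max 0 (U z) - C"
    using halving_gain[OF growth] by metis
  obtain B where B: "\<And>\<phi>. \<phi> \<in> strategies F T \<Longrightarrow> (\<integral>\<^sup>+w. ennreal (- U (wealth S (c / 2) \<phi> T w)) \<partial>M) < \<infinity> \<Longrightarrow>
    integrable M (\<lambda>w. U (wealth S (c / 2) \<phi> T w)) \<and> (\<integral>w. U (wealth S (c / 2) \<phi> T w) \<partial>M) \<le> B"
    by (rule expected_utility_bounded[of "c / 2"]) blast
  show thesis
  \<comment> \<open>The halved problem gives \<open>q * EU \<phi> + p * gains - C \<le> B\<close>.
    The constant comes from solving this for the expected gains and subtracting the expected
    utility, both times with \<open>max_EU - 1\<close> as its lower bound.\<close>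
  proof (rule that[of "(B + C - q * (max_EU - 1)) / p - (max_EU - 1)"])
    fix \<phi> assume \<phi>: "feasible \<phi>" and ge: "EU \<phi> \<ge> max_EU - 1"
    have int: "integrable M (\<lambda>w. U (W \<phi> w))" and str: "\<phi> \<in> strategies F T"
      using \<phi> by (auto simp: feasible_def)
    \<comment> \<open>The second summand is zero; it brings plain scaling under the lemmas on linear
      combinations.\<close>
    let ?\<psi> = "\<lambda>t w. (1 / 2) *\<^sub>R \<phi> t w + 0 *\<^sub>R \<phi> t w"
    have str': "?\<psi> \<in> strategies F T" by (intro strategies_lincomb str)
    have W: "wealth S (c / 2) ?\<psi> T w = W \<phi> w / 2" for w
      using wealth_lincomb[of "1/2" c 0 0 \<phi> \<phi> T w] by simp
    let ?g = "\<lambda>w. q * U (W \<phi> w) + p * max 0 (U (W \<phi> w)) - C"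
    have intg: "integrable M ?g" using int by auto
    have "(\<integral>\<^sup>+w. ennreal (- U (wealth S (c / 2) ?\<psi> T w)) \<partial>M) \<le> (\<integral>\<^sup>+w. ennreal (- ?g w) \<partial>M)"
      unfolding W by (intro nn_integral_mono ennreal_leI le_imp_neg_le half)
    also have "\<dots> < \<infinity>" by (intro integrable_neg_finite intg)
    finally have *: "integrable M (\<lambda>w. U (W \<phi> w / 2))" "(\<integral>w. U (W \<phi> w / 2) \<partial>M) \<le> B"
      using B[OF str'] unfolding W by blast+
    have "(\<integral>w. ?g w \<partial>M) \<le> B"
      using integral_mono[OF intg *(1)] half *(2) by fastforce
    then have "q * EU \<phi> + p * (\<integral>w. max 0 (U (W \<phi> w)) \<partial>M) - C \<le> B"
      using int by (simp add: prob_space)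
    moreover have "q * (max_EU - 1) \<le> q * EU \<phi>" using ge pq by (intro mult_left_mono)
    ultimately have "(\<integral>w. max 0 (U (W \<phi> w)) \<partial>M) \<le> (B + C - q * (max_EU - 1)) / p"
      using pq by (simp add: pos_le_divide_eq mult.commute)
    moreover have "(\<integral>w. max 0 (- U (W \<phi> w)) \<partial>M) = (\<integral>w. max 0 (U (W \<phi> w)) - U (W \<phi> w) \<partial>M)"
      by (intro Bochner_Integration.integral_cong) auto
    moreover have "\<dots> = (\<integral>w. max 0 (U (W \<phi> w)) \<partial>M) - EU \<phi>"
      using int by (intro Bochner_Integration.integral_diff) auto
    ultimately show "(\<integral>w. max 0 (- U (W \<phi> w)) \<partial>M) \<le> (B + C - q * (max_EU - 1)) / p - (max_EU - 1)"
      using ge by linarith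
  qed
qed

section \<open>Compactness of a reduced maximising sequence\<close>

context
  fixes \<phi> :: "nat \<Rightarrow> nat \<Rightarrow> 'a \<Rightarrow> real ^ 'd"
  assumes red: "\<And>n. reduced (\<phi> n)" and feas: "\<And>n. feasible (\<phi> n)"
    and max: "\<And>n. EU (\<phi> n) > max_EU - 1 / real (Suc n)"
begin

lemma max_ge: "EU (\<phi> n) \<ge> max_EU - 1"
proof -
  have "1 / real (Suc n) \<le> 1" by simp
  with max[of n] show ?thesis by linarith
qed

lemma str: "\<phi> n \<in> strategies F T"
  by (rule reduced_strategies[OF red])

lemma W_meas [measurable]: "W (\<phi> n) \<in> borel_measurable M"
  by (rule wealth_meas_M[OF str]) simp

text \<open>If mass escaped to infinity, dividing the escaping strategies by \<open>Suc N\<close>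
  would drive the losses of their wealths to 0, because the expected losses are bounded. The
  embedding then sends the rescaled wealths to 0 in probability, although they stay above
  \<open>1 / 2\<close> in absolute value with probability more than \<epsilon>.\<close>

lemma bounded_in_probability:
  assumes "\<epsilon> > 0"
  shows "\<exists>N::nat. \<forall>n. prob {w\<in>space M. real N < \<bar>W (\<phi> n) w\<bar>} \<le> \<epsilon>"
proof (rule ccontr)
  assume "\<not> ?thesis"
  then obtain s where s: "\<And>N. prob {w\<in>space M. real N < \<bar>W (\<phi> (s N)) w\<bar>} > \<epsilon>"
    by (metis not_le)
  obtain L where L: "\<And>\<phi>. feasible \<phi> \<Longrightarrow> EU \<phi> \<ge> max_EU - 1 \<Longrightarrow> (\<integral>w. max 0 (- U (W \<phi> w)) \<partial>M) \<le> L"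
    by (rule expected_loss_bounded) blast
  obtain \<beta> where \<beta>: "\<beta> > 0" "\<And>x. max 0 (- x) \<le> 1 + \<beta> * max 0 (- U x)"
    by (rule loss_le) blast
  define \<psi> where "\<psi> N = (\<lambda>t w. (1 / real (Suc N)) *\<^sub>R \<phi> (s N) t w + 0 *\<^sub>R \<phi> (s N) t w)" for N
  have red': "reduced (\<psi> N)" for N unfolding \<psi>_def by (intro reduced_lincomb red)
  have W': "wealth S 0 (\<psi> N) T w = (W (\<phi> (s N)) w - c) / real (Suc N)" for N w
  proof -
    have "wealth S 0 (\<phi> (s N)) T w = W (\<phi> (s N)) w - c" by (simp add: wealth_def)
    then show ?thesis
      unfolding \<psi>_def using wealth_lincomb[of "1 / real (Suc N)" 0 0 0 "\<phi> (s N)" "\<phi> (s N)" T w] by simp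
  qed
  have [measurable]: "wealth S 0 (\<psi> N) T \<in> borel_measurable M" for N
    by (rule wealth_meas_M[OF reduced_strategies[OF red']]) simp
  let ?\<psi> = "\<lambda>N w. max 0 (- wealth S 0 (\<psi> N) T w)" and ?\<phi> = "\<lambda>N w. max 0 (- U (W (\<phi> (s N)) w))"
  have "(\<lambda>N. prob_size (?\<psi> N)) \<longlonglongrightarrow> 0"
  proof (rule tendsto_sandwich[OF _ _ tendsto_const])
    show "(\<lambda>N. (1 + \<beta> * L + \<bar>c\<bar>) * (1 / real (Suc N))) \<longlonglongrightarrow> 0"
      using tendsto_mult_left[OF LIMSEQ_inverse_real_of_nat, of "1 + \<beta> * L + \<bar>c\<bar>"]
      by (simp add: inverse_eq_divide)
    show "eventually (\<lambda>N. prob_size (?\<psi> N) \<le> (1 + \<beta> * L + \<bar>c\<bar>) * (1 / real (Suc N))) sequentially"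
    proof (rule always_eventually, rule allI)
      fix N
      let ?g = "\<lambda>w. (1 + \<beta> * ?\<phi> N w + \<bar>c\<bar>) * (1 / real (Suc N))"
      have int: "integrable M (\<lambda>w. U (W (\<phi> (s N)) w))" using feas by (simp add: feasible_def)
      have "prob_size (?\<psi> N) \<le> (\<integral>w. ?g w \<partial>M)"
        unfolding prob_size_def
      proof (intro integral_mono integrable_min_abs)
        show "integrable M ?g" using int by (intro integrable_mult_left) auto
        fix w
        have "max 0 (- (W (\<phi> (s N)) w - c)) \<le> 1 + \<beta> * ?\<phi> N w + \<bar>c\<bar>"
          using \<beta>(2)[of "W (\<phi> (s N)) w"] by linarith
        then have "max 0 (- (W (\<phi> (s N)) w - c)) * (1 / real (Suc N)) \<le> ?g w"
          by (intro mult_right_mono) auto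
        moreover have "?\<psi> N w = max 0 (- (W (\<phi> (s N)) w - c)) * (1 / real (Suc N))"
          unfolding W' by (auto simp: max_def divide_simps)
        ultimately show "min 1 \<bar>?\<psi> N w\<bar> \<le> ?g w" by linarith
      qed measurable
      also have "\<dots> = (\<integral>w. 1 + \<beta> * ?\<phi> N w + \<bar>c\<bar> \<partial>M) * (1 / real (Suc N))"
        using int by (intro Bochner_Integration.integral_mult_left) auto
      also have "(\<integral>w. 1 + \<beta> * ?\<phi> N w + \<bar>c\<bar> \<partial>M) =
          1 + \<beta> * (\<integral>w. ?\<phi> N w \<partial>M) + \<bar>c\<bar>"
        using int by (simp add: prob_space)
      also have "(1 + \<beta> * (\<integral>w. ?\<phi> N w \<partial>M) + \<bar>c\<bar>) * (1 / real (Suc N)) \<le>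
          (1 + \<beta> * L + \<bar>c\<bar>) * (1 / real (Suc N))"
        using L[OF feas max_ge] \<beta>(1) by (intro mult_right_mono add_mono mult_left_mono order_refl) auto
      finally show "prob_size (?\<psi> N) \<le> (1 + \<beta> * L + \<bar>c\<bar>) * (1 / real (Suc N))" .
    qed
  qed (auto intro!: always_eventually prob_size_nonneg)
  from reduced_strategies_tendsto_0(2)[OF red' this order_refl]
  have "eventually (\<lambda>N. prob_size (wealth S 0 (\<psi> N) T) < \<epsilon> / 2) sequentially"
    using assms by (intro order_tendstoD) auto
  then obtain N0 where N0: "\<And>N. N \<ge> N0 \<Longrightarrow> prob_size (wealth S 0 (\<psi> N) T) < \<epsilon> / 2"
    by (auto simp: eventually_sequentially)
  \<comment> \<open>\<open>N \<ge> 2 * \<bar>c\<bar> + 1\<close> means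
    \<open>2 * (N - \<bar>c\<bar>) \<ge> N + 1\<close>, so a wealth beyond \<open>N\<close> still
    leaves \<open>1 / 2\<close> after the capital is removed and the rest is divided by
    \<open>Suc N\<close>.\<close>
  define N where "N = max N0 (nat \<lceil>2 * \<bar>c\<bar> + 1\<rceil>)"
  have N: "N \<ge> N0" "real N \<ge> 2 * \<bar>c\<bar> + 1" by (auto simp: N_def) linarith
  have "\<epsilon> / 2 \<le> 1 / 2 * prob {w\<in>space M. real N < \<bar>W (\<phi> (s N)) w\<bar>}" using s[of N] by simp
  also have "\<dots> \<le> 1 / 2 * prob {w\<in>space M. 1 / 2 \<le> \<bar>wealth S 0 (\<psi> N) T w\<bar>}"
  proof (intro mult_left_mono finite_measure_mono subsetI)
    fix w assume "w \<in> {w\<in>space M. real N < \<bar>W (\<phi> (s N)) w\<bar>}"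
    then have w: "w \<in> space M" "real N < \<bar>W (\<phi> (s N)) w\<bar>" by auto
    moreover have "\<bar>W (\<phi> (s N)) w\<bar> \<le> \<bar>W (\<phi> (s N)) w - c\<bar> + \<bar>c\<bar>" by linarith
    ultimately have "real (Suc N) \<le> 2 * \<bar>W (\<phi> (s N)) w - c\<bar>" using N(2) by simp
    then show "w \<in> {w\<in>space M. 1 / 2 \<le> \<bar>wealth S 0 (\<psi> N) T w\<bar>}"
      using w(1) unfolding W' by (simp add: abs_divide pos_le_divide_eq)
  qed auto
  also have "\<dots> \<le> prob_size (wealth S 0 (\<psi> N) T)" by (rule prob_ge_le_prob_size) auto
  finally show False using N0[OF N(1)] by simp
qed

text \<open>Strict concavity makes the terminal wealths Cauchy in probability: otherwise the midpoints of
  far-out pairs would beat the supremum.\<close>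

lemma wealth_Cauchy:
  "((\<lambda>(n, m). prob_size (\<lambda>w. W (\<phi> n) w - W (\<phi> m) w)) \<longlongrightarrow> 0) (sequentially \<times>\<^sub>F sequentially)"
proof -
  define gap where "gap n m w = U ((W (\<phi> n) w + W (\<phi> m) w) / 2) - (U (W (\<phi> n) w) + U (W (\<phi> m) w)) / 2" for n m w
  have gap0: "gap n m w \<ge> 0" for n m w using midpoint_ge by (simp add: gap_def)
  have int: "integrable M (\<lambda>w. U (W (\<phi> n) w))" for n using feas by (simp add: feasible_def)
  have mid: "integrable M (\<lambda>w. U ((W (\<phi> n) w + W (\<phi> m) w) / 2))"
    "(\<integral>w. U ((W (\<phi> n) w + W (\<phi> m) w) / 2) \<partial>M) \<le> max_EU" for n m
    using feasible_midpoint(1)[OF feas feas, of n m] EU_le_max_EU[OF feasible_midpoint(1)[OF feas feas], of n m]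
    by (simp_all add: feasible_def feasible_midpoint(2)[OF feas feas])
  have gap_int: "integrable M (gap n m)" for n m
    unfolding gap_def using int mid(1) by auto
  \<comment> \<open>The midpoint is feasible and cannot exceed \<open>max_EU\<close>, while the two
    expected utilities fall short of it by at most \<open>1 / Suc n\<close> and
    \<open>1 / Suc m\<close>.\<close>
  have gap_le: "(\<integral>w. gap n m w \<partial>M) \<le> 1 / real (Suc n) + 1 / real (Suc m)" for n m
  proof -
    have "(\<integral>w. gap n m w \<partial>M) = (\<integral>w. U ((W (\<phi> n) w + W (\<phi> m) w) / 2) \<partial>M) - (EU (\<phi> n) + EU (\<phi> m)) / 2"
      unfolding gap_def using int mid(1) by simp
    moreover have "0 \<le> 1 / real (Suc n)" "0 \<le> 1 / real (Suc m)" by auto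
    ultimately show ?thesis using mid(2)[of n m] max[of n] max[of m] by argo
  qed
  have "\<exists>N::nat. \<forall>n. prob {w\<in>space M. real N < \<bar>W (\<phi> n) w\<bar>} \<le> 1 / real (Suc k)" for k
    by (rule bounded_in_probability) simp
  then obtain N where N: "\<And>k n. prob {w\<in>space M. real (N k) < \<bar>W (\<phi> n) w\<bar>} \<le> 1 / real (Suc k)"
    by metis
  have "\<exists>\<delta>>0. \<forall>x y. \<bar>x\<bar> \<le> real (N k) \<longrightarrow> \<bar>y\<bar> \<le> real (N k) \<longrightarrow> 1 / real (Suc k) \<le> \<bar>x - y\<bar> \<longrightarrow>
      \<delta> \<le> U ((x + y) / 2) - (U x + U y) / 2" for k
    by (rule strict_concavity_modulus[of "1 / real (Suc k)" "real (N k)"]) auto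
  then obtain \<delta> where \<delta>: "\<And>k. \<delta> k > 0" "\<And>k x y. \<bar>x\<bar> \<le> real (N k) \<Longrightarrow> \<bar>y\<bar> \<le> real (N k) \<Longrightarrow>
      1 / real (Suc k) \<le> \<bar>x - y\<bar> \<Longrightarrow> \<delta> k \<le> U ((x + y) / 2) - (U x + U y) / 2"
    by metis
  show ?thesis
  \<comment> \<open>The three parts of \<open>e k\<close> stand for the first wealth exceeding
    \<open>N k\<close>, the second one exceeding it, and the two being within
    \<open>1 / Suc k\<close> of each other. In all other cases the gap is at least
    \<open>\<delta> k\<close>, and Markov's inequality for the gap gives \<open>b\<close>.\<close>
  proof (rule tendsto_0_of_approx[where e="\<lambda>k. 3 * (1 / real (Suc k))"
        and b="\<lambda>k (n, m). (1 / \<delta> k) * (1 / real (Suc n) + 1 / real (Suc m))"])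
    show "(\<lambda>k. 3 * (1 / real (Suc k))) \<longlonglongrightarrow> 0"
      using tendsto_mult_left[OF LIMSEQ_inverse_real_of_nat, of 3] by (simp add: inverse_eq_divide)
    show "((\<lambda>(n, m). (1 / \<delta> k) * (1 / real (Suc n) + 1 / real (Suc m))) \<longlongrightarrow> 0) (sequentially \<times>\<^sub>F sequentially)" for k
    proof -
      have "((\<lambda>z. 1 / real (Suc (fst z))) \<longlongrightarrow> 0) (sequentially \<times>\<^sub>F sequentially)"
        "((\<lambda>z. 1 / real (Suc (snd z))) \<longlongrightarrow> 0) (sequentially \<times>\<^sub>F sequentially)"
        by (rule filterlim_compose[OF LIMSEQ_inverse_real_of_nat[unfolded inverse_eq_divide]],
            rule filterlim_fst filterlim_snd)+
      from tendsto_mult_left[OF tendsto_add[OF this], of "1 / \<delta> k"] show ?thesis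
        by (simp add: split_beta')
    qed
    fix k and i :: "nat \<times> nat"
    obtain n m where i: "i = (n, m)" by (cases i)
    let ?A = "\<lambda>n. {w\<in>space M. real (N k) < \<bar>W (\<phi> n) w\<bar>}"
    have [measurable]: "gap n m \<in> borel_measurable M" using gap_int by auto
    have "prob_size (\<lambda>w. W (\<phi> n) w - W (\<phi> m) w) \<le>
        (\<integral>w. 1 / real (Suc k) + (indicator (?A n) w + indicator (?A m) w) + (1 / \<delta> k) * gap n m w \<partial>M)"
      unfolding prob_size_def
    proof (intro integral_mono Bochner_Integration.integrable_add integrable_min_abs integrable_mult_right
        gap_int integrable_real_indicator integrable_const)
      fix w assume w: "w \<in> space M"
      have g: "(1 / \<delta> k) * gap n m w \<ge> 0" using gap0 \<delta>(1)[of k] by (intro mult_nonneg_nonneg) auto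
      have k: "0 \<le> 1 / real (Suc k)" by simp
      let ?I = "indicator (?A n) w + indicator (?A m) w :: real"
      have I: "?I \<ge> 0" by simp
      consider "w \<in> ?A n \<union> ?A m" | "\<bar>W (\<phi> n) w - W (\<phi> m) w\<bar> < 1 / real (Suc k)"
        | "\<bar>W (\<phi> n) w\<bar> \<le> real (N k)" "\<bar>W (\<phi> m) w\<bar> \<le> real (N k)" "1 / real (Suc k) \<le> \<bar>W (\<phi> n) w - W (\<phi> m) w\<bar>"
        using w by force
      then show "min 1 \<bar>W (\<phi> n) w - W (\<phi> m) w\<bar> \<le> 1 / real (Suc k) + ?I + (1 / \<delta> k) * gap n m w"
      proof cases
        case 1
        then have "?I \<ge> 1" by (auto simp: indicator_def)
        then show ?thesis using g k by linarith
      next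
        case 2
        then show ?thesis using g I by linarith
      next
        case 3
        have "\<delta> k \<le> gap n m w" unfolding gap_def by (rule \<delta>(2)[OF 3])
        then have "1 \<le> (1 / \<delta> k) * gap n m w" using \<delta>(1)[of k] by (simp add: pos_le_divide_eq)
        then show ?thesis using k I by linarith
      qed
    qed (auto simp: emeasure_eq_measure)
    also have "\<dots> = 1 / real (Suc k) + (prob (?A n) + prob (?A m)) + (1 / \<delta> k) * (\<integral>w. gap n m w \<partial>M)"
      using gap_int by (simp add: prob_space emeasure_eq_measure)
    also have "\<dots> \<le> 1 / real (Suc k) + (1 / real (Suc k) + 1 / real (Suc k)) +
        (1 / \<delta> k) * (1 / real (Suc n) + 1 / real (Suc m))"
      using N[of k] gap_le[of n m] \<delta>(1)[of k] by (intro add_mono mult_left_mono order_refl) auto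
    finally show "(case i of (n, m) \<Rightarrow> prob_size (\<lambda>w. W (\<phi> n) w - W (\<phi> m) w)) \<le>
        3 * (1 / real (Suc k)) + (case i of (n, m) \<Rightarrow> (1 / \<delta> k) * (1 / real (Suc n) + 1 / real (Suc m)))"
      by (simp add: i)
  qed (auto simp: prob_size_nonneg split_beta')
qed

text \<open>Differences of reduced strategies are reduced and start from zero capital, so the
  embedding applies along the filter of pairs of indices.\<close>

lemma strategies_Cauchy:
  assumes t: "t \<in> {1..T}"
  shows "((\<lambda>(n, m). prob_size (\<lambda>w. norm (\<phi> n t w - \<phi> m t w))) \<longlongrightarrow> 0) (sequentially \<times>\<^sub>F sequentially)"
proof -
  let ?d = "\<lambda>(n, m) t w. 1 *\<^sub>R \<phi> n t w + (- 1) *\<^sub>R \<phi> m t w"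
  have red': "reduced (?d i)" for i by (cases i) (simp only: prod.case reduced_lincomb[OF red red])
  have W': "wealth S 0 (?d (n, m)) T w = W (\<phi> n) w - W (\<phi> m) w" for n m w
    using wealth_lincomb[of 1 c "- 1" c "\<phi> n" "\<phi> m" T w] by simp
  have "((\<lambda>i. prob_size (\<lambda>w. max 0 (- wealth S 0 (?d i) T w))) \<longlongrightarrow> 0) (sequentially \<times>\<^sub>F sequentially)"
  proof (rule prob_size_tendsto_mono[where g="\<lambda>i w. W (\<phi> (fst i)) w - W (\<phi> (snd i)) w"])
    show "((\<lambda>i. prob_size (\<lambda>w. W (\<phi> (fst i)) w - W (\<phi> (snd i)) w)) \<longlongrightarrow> 0) (sequentially \<times>\<^sub>F sequentially)"
      using wealth_Cauchy by (simp add: split_beta')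
    show "(\<lambda>w. max 0 (- wealth S 0 (?d i) T w)) \<in> borel_measurable M" for i
      using wealth_meas_M[OF reduced_strategies[OF red'[of i]] order_refl, of 0] by measurable
    show "AE w in M. \<bar>max 0 (- wealth S 0 (?d i) T w)\<bar> \<le> \<bar>W (\<phi> (fst i)) w - W (\<phi> (snd i)) w\<bar>" for i
      using W'[of "fst i" "snd i"] by (intro AE_I2) (auto simp: split_beta')
  qed measurable
  from reduced_strategies_tendsto_0(1)[OF red' this t] show ?thesis
    by (simp add: split_beta')
qed


text \<open>The wealths along a convergent modification of the maximising sequence are all dominated by
  \<open>Z\<close>. The value of \<open>Z\<close> is conditionally integrable one step ahead but in general not integrable, so
  Fatou's lemma cannot be applied to it globally; hence the backward induction over sets of the
  filtration on which it is integrable.\<close>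

lemma exists_optimal:
  "\<exists>\<xi>. reduced \<xi> \<and> feasible \<xi> \<and> (\<forall>\<psi>. feasible \<psi> \<longrightarrow> EU \<psi> \<le> EU \<xi>)"
proof -
  obtain r :: "nat \<Rightarrow> nat" and \<psi> where r: "filterlim r at_top sequentially"
    and red\<psi>: "\<And>k. reduced (\<psi> k)"
    and eq\<psi>: "\<And>k c. AE w in M. wealth S c (\<psi> k) T w = wealth S c (\<phi> (r k)) T w"
    and conv: "\<And>t w. convergent (\<lambda>k. \<psi> k t w)"
    using reduced_Cauchy_subseq[of \<phi>, OF red strategies_Cauchy] by blast
  have str\<psi>: "\<psi> k \<in> strategies F T" for k by (rule reduced_strategies[OF red\<psi>])
  have feas\<psi>: "feasible (\<psi> k)" and EU\<psi>: "EU (\<psi> k) = EU (\<phi> (r k))" for k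
    using feasible_AE_cong[OF feas str\<psi> eq\<psi>] by auto
  define \<xi> where "\<xi> t w = lim (\<lambda>k. \<psi> k t w)" for t w
  have lim: "(\<lambda>k. \<psi> k t w) \<longlonglongrightarrow> \<xi> t w" for t w
    using conv by (simp add: \<xi>_def convergent_LIMSEQ_iff)
  have \<psi>_meas: "\<psi> k t \<in> borel_measurable (F (t - 1))" if "t \<in> {1..T}" for k t
    by (rule strategy_meas[OF str\<psi> that])
  have red\<xi>: "reduced \<xi>"
    unfolding reduced_def strategies_def
  proof (intro conjI CollectI ballI)
    fix t assume t: "t \<in> {1..T}"
    show "\<xi> t \<in> borel_measurable (F (t - 1))"
      by (rule borel_measurable_LIMSEQ_metric[OF \<psi>_meas[OF t] lim])
    have "AE w in M. \<forall>k. \<psi> k t w \<in> span (measure_support (\<kappa> t w))"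
      using red\<psi> t by (auto simp: reduced_def AE_all_countable)
    then show "AE w in M. \<xi> t w \<in> span (measure_support (\<kappa> t w))"
    proof eventually_elim
      case (elim w)
      show ?case by (rule closed_sequentially[OF closed_span _ lim]) (use elim in auto)
    qed
  qed
  have str\<xi>: "\<xi> \<in> strategies F T" by (rule reduced_strategies[OF red\<xi>])
  have Wlim: "(\<lambda>k. W (\<psi> k) w) \<longlonglongrightarrow> W \<xi> w" for w
    unfolding wealth_def by (intro tendsto_intros lim)
  have Ulim: "(\<lambda>k. U (W (\<psi> k) w)) \<longlonglongrightarrow> U (W \<xi> w)" for w
    using Wlim by (intro continuous_on_tendsto_compose[OF continuous_U[of UNIV]]) auto
  note [measurable] = U_wealth_meas[OF str\<psi>] U_wealth_meas[OF str\<xi>]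
  have int\<psi>: "integrable M (\<lambda>w. U (W (\<psi> k) w))" for k using feas\<psi> by (simp add: feasible_def)

  \<comment> \<open>Fatou's lemma applies to the losses, whose expectations are bounded along the
    sequence; the gains follow from \<open>feasible_of_neg\<close>.\<close>
  have feas\<xi>: "feasible \<xi>"
  proof (rule feasible_of_neg[OF str\<xi>])
    obtain L where L: "\<And>\<phi>. feasible \<phi> \<Longrightarrow> EU \<phi> \<ge> max_EU - 1 \<Longrightarrow> (\<integral>w. max 0 (- U (W \<phi> w)) \<partial>M) \<le> L"
      by (rule expected_loss_bounded) blast
    have "(\<integral>\<^sup>+w. ennreal (- U (W \<xi> w)) \<partial>M) = (\<integral>\<^sup>+w. liminf (\<lambda>k. ennreal (- U (W (\<psi> k) w))) \<partial>M)"
      by (intro nn_integral_cong lim_imp_Liminf[symmetric] tendsto_intros Ulim) simp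
    also have "\<dots> \<le> liminf (\<lambda>k. \<integral>\<^sup>+w. ennreal (- U (W (\<psi> k) w)) \<partial>M)"
      by (rule nn_integral_liminf) measurable
    also have "\<dots> \<le> limsup (\<lambda>k. \<integral>\<^sup>+w. ennreal (- U (W (\<psi> k) w)) \<partial>M)"
      by (rule Liminf_le_Limsup) simp
    also have "\<dots> \<le> ennreal L"
    proof (rule Limsup_bounded, rule always_eventually, rule allI)
      fix k
      have "(\<integral>\<^sup>+w. ennreal (- U (W (\<psi> k) w)) \<partial>M) = (\<integral>\<^sup>+w. ennreal (max 0 (- U (W (\<psi> k) w))) \<partial>M)"
        by (simp add: ennreal_max_0)
      also have "\<dots> = ennreal (\<integral>w. max 0 (- U (W (\<psi> k) w)) \<partial>M)"
        using int\<psi> by (intro nn_integral_eq_integral) auto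
      also have "\<dots> \<le> ennreal L"
        using L[OF feas\<psi>] max_ge EU\<psi> by (intro ennreal_leI) auto
      finally show "(\<integral>\<^sup>+w. ennreal (- U (W (\<psi> k) w)) \<partial>M) \<le> ennreal L" .
    qed
    finally show "(\<integral>\<^sup>+w. ennreal (- U (W \<xi> w)) \<partial>M) < \<infinity>"
      using ennreal_less_top le_less_trans by fastforce
  qed
  then have int\<xi>: "integrable M (\<lambda>w. U (W \<xi> w))" by (simp add: feasible_def)

  \<comment> \<open>The supremum is finite because \<psi> converges at every point, and it is known
    one period ahead just like a position, as \<open>cond_exp_gains_finite\<close> requires of a
    coefficient.\<close>
  define K where "K t w = (SUP k. norm (\<psi> k t w))" for t w
  have bdd: "bdd_above (range (\<lambda>k. norm (\<psi> k t w)))" for t w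
    using convergent_imp_Bseq[OF conv[of t w]] by (auto simp: Bseq_def bdd_above_def)
  have K: "norm (\<psi> k t w) \<le> K t w" for k t w
    unfolding K_def by (rule cSUP_upper[OF _ bdd]) simp
  have K0: "K t w \<ge> 0" for t w using K[of 0 t w] norm_ge_zero order.trans by blast
  have K_meas: "K t \<in> borel_measurable (F (t - 1))" if "t \<in> {1..T}" for t
  proof -
    note [measurable] = \<psi>_meas[OF that]
    show ?thesis
      unfolding K_def by (rule borel_measurable_cSUP) (simp, measurable, rule bdd)
  qed
  define Z where "Z t w = c + (\<Sum>i=1..t. K i w * norm (\<Delta> i w))" for t w
  have Z_Suc: "Z (Suc t) w = Z t w + K (Suc t) w * norm (\<Delta> (Suc t) w)" for t w
    by (simp add: Z_def)
  have Z_meas: "Z t \<in> borel_measurable (F t)" if "t \<le> T" for t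
    unfolding Z_def using that
    by (intro borel_measurable_add borel_measurable_sum borel_measurable_times borel_measurable_const
        measurable_compose[OF _ borel_measurable_norm] meas_F_F[OF _ _ K_meas] meas_F_F[OF _ _ increment_meas]) auto
  have WZ: "wealth S c (\<psi> k) t w \<le> Z t w" for k t w
    unfolding Z_def wealth_def
  proof (intro add_left_mono sum_mono)
    fix i
    have "\<psi> k i w \<bullet> \<Delta> i w \<le> norm (\<psi> k i w) * norm (\<Delta> i w)" by (rule norm_cauchy_schwarz)
    also have "\<dots> \<le> K i w * norm (\<Delta> i w)" by (intro mult_right_mono K) simp
    finally show "\<psi> k i w \<bullet> \<Delta> i w \<le> K i w * norm (\<Delta> i w)" .
  qed

  let ?J = "\<lambda>A \<phi>. \<integral>w. indicator A w * U (W \<phi> w) \<partial>M"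
  \<comment> \<open>Upper semicontinuity of the expected utility, localised to sets on which the
    gain in value at \<open>Z t\<close> is integrable. At time 0 the process \<open>Z\<close> is the
    constant \<open>c\<close>, so by \<open>V0_pos_finite\<close> the whole space is such a
    set.\<close>
  have usc: "\<forall>A\<in>sets (F t). (\<integral>\<^sup>+w\<in>A. ennreal (V t (Z t w) w) \<partial>M) < \<infinity> \<longrightarrow>
      (\<forall>\<epsilon>>0. eventually (\<lambda>k. ?J A (\<psi> k) <
        ?J A \<xi> + \<epsilon>) sequentially)" if "t \<le> T" for t
    using that
  proof (induction rule: inc_induct)
    case base
    show ?case
    proof (intro ballI impI allI)
      fix A and \<epsilon> :: real assume A: "A \<in> sets (F T)" and fin: "(\<integral>\<^sup>+w\<in>A. ennreal (V T (Z T w) w) \<partial>M) < \<infinity>" and \<epsilon>: "\<epsilon> > 0"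
      have [measurable]: "A \<in> sets M" using A subalgebra_F[of T] by (auto simp: subalgebra_def)
      have [measurable]: "Z T \<in> borel_measurable M" by (rule meas_F_M[OF _ Z_meas]) auto
      let ?g = "\<lambda>w. indicator A w * max 0 (U (Z T w))"
      let ?f = "\<lambda>k w. indicator A w * U (W (\<psi> k) w)" and ?f' = "\<lambda>w. indicator A w * U (W \<xi> w)"
      have ennreal_g: "ennreal (?g w) = ennreal (V T (Z T w) w) * indicator A w" for w
        by (auto simp: V_T ennreal_max_0 split: split_indicator)
      have g: "integrable M ?g"
      proof (rule integrableI_bounded)
        show "(\<integral>\<^sup>+w. ennreal (norm (?g w)) \<partial>M) < \<infinity>"
          using fin by (simp add: ennreal_g flip: ennreal_g)
      qed measurable
      have f: "integrable M (?f k)" and f': "integrable M ?f'" for k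
        by (intro integrable_indicator_times int\<psi> int\<xi>; measurable)+
      have fg: "?f k w \<le> ?g w" for k w
        using monoD[OF mono WZ[of k T w]] by (auto split: split_indicator)
      have f'g: "?f' w \<le> ?g w" for w
        by (rule LIMSEQ_le_const2[of "\<lambda>k. ?f k w"]) (auto intro!: tendsto_intros Ulim fg)
      \<comment> \<open>Reverse Fatou: \<open>?g\<close> is integrable on \<open>A\<close> and
        dominates all terms, so Fatou's lemma applies to the differences.\<close>
      have "ennreal ((\<integral>w. ?g w \<partial>M) - (\<integral>w. ?f' w \<partial>M)) = (\<integral>\<^sup>+w. ennreal (?g w - ?f' w) \<partial>M)"
        using g f' f'g by (subst nn_integral_eq_integral) auto
      also have "\<dots> = (\<integral>\<^sup>+w. liminf (\<lambda>k. ennreal (?g w - ?f k w)) \<partial>M)"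
        by (intro nn_integral_cong lim_imp_Liminf[symmetric] tendsto_intros Ulim) simp
      also have "\<dots> \<le> liminf (\<lambda>k. \<integral>\<^sup>+w. ennreal (?g w - ?f k w) \<partial>M)"
        by (rule nn_integral_liminf) measurable
      also have "\<dots> = liminf (\<lambda>k. ennreal ((\<integral>w. ?g w \<partial>M) - (\<integral>w. ?f k w \<partial>M)))"
        using g f fg by (subst nn_integral_eq_integral) auto
      finally have le: "ennreal ((\<integral>w. ?g w \<partial>M) - (\<integral>w. ?f' w \<partial>M)) \<le> \<dots>" .
      \<comment> \<open>\<open>ennreal\<close> truncates at 0, so the limit inferior is informative
        only when the difference is at least \<epsilon>. A smaller difference is settled by
        domination alone.\<close>
      show "eventually (\<lambda>k. (\<integral>w. ?f k w \<partial>M) < (\<integral>w. ?f' w \<partial>M) + \<epsilon>) sequentially"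
      proof (cases "(\<integral>w. ?g w \<partial>M) - (\<integral>w. ?f' w \<partial>M) - \<epsilon> < 0")
        case True
        have "(\<integral>w. ?f k w \<partial>M) \<le> (\<integral>w. ?g w \<partial>M)" for k by (rule integral_mono[OF f g fg])
        then show ?thesis using True by (intro always_eventually allI) (smt (verit))
      next
        case False
        then have "ennreal ((\<integral>w. ?g w \<partial>M) - (\<integral>w. ?f' w \<partial>M) - \<epsilon>) < ennreal ((\<integral>w. ?g w \<partial>M) - (\<integral>w. ?f' w \<partial>M))"
          using \<epsilon> by (intro ennreal_lessI) auto
        from less_LiminfD[OF order.strict_trans2[OF this le]] show ?thesis
          by eventually_elim (use False in \<open>auto simp: ennreal_less_iff\<close>)
      qed
    qed
  next
    case (step n)
    let ?e = "nn_cond_exp M (F n) (\<lambda>w. ennreal (V (Suc n) (Z (Suc n) w) w))"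
    interpret sf: sigma_finite_subalgebra M "F n" using sigma_finite_F step by simp
    have VZ_meas: "(\<lambda>w. V t (Z t w) w) \<in> borel_measurable M" if "t \<le> T" for t
      by (rule meas_F_M[OF that V_comp_meas[OF that Z_meas[OF that]]])
    have [measurable]: "(\<lambda>w. V n (Z n w) w) \<in> borel_measurable M"
      "(\<lambda>w. V (Suc n) (Z (Suc n) w) w) \<in> borel_measurable M"
      using step by (auto intro: VZ_meas)
    have e_fin: "AE w in M. ?e w < \<infinity>"
    proof -
      have "K (Suc n) \<in> borel_measurable (F n)" using K_meas[of "Suc n"] step by simp
      from cond_exp_gains_finite[OF _ Z_meas this K0] step show ?thesis by (simp add: Z_Suc)
    qed
    show ?case
    proof (intro ballI impI allI)
      fix A and \<epsilon> :: real assume A: "A \<in> sets (F n)" and fin: "(\<integral>\<^sup>+w\<in>A. ennreal (V n (Z n w) w) \<partial>M) < \<infinity>" and \<epsilon>: "\<epsilon> > 0"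
      have spF: "space (F n) = space M" using space_F step by simp
      have F_M_sets: "B \<in> sets M" if "B \<in> sets (F n)" for B
        using that subalgebra_F[of n] step by (auto simp: subalgebra_def)
      have [measurable]: "A \<in> sets M" by (rule F_M_sets[OF A])
      \<comment> \<open>The conditional expectation \<open>?e\<close> is almost surely finite but
        perhaps not integrable. On \<open>B j\<close> it is at most \<open>j\<close>, so the
        induction hypothesis applies there, and these sets exhaust \<open>A\<close> up to a null
        set.\<close>
      define B where "B j = {w\<in>space (F n). w \<in> A \<and> ?e w \<le> of_nat j}" for j :: nat
      have B_F[measurable]: "B j \<in> sets (F n)" for j unfolding B_def using A by measurable
      have BM[measurable]: "B j \<in> sets M" for j by (rule F_M_sets[OF B_F])
      have BA: "B j \<subseteq> A" for j by (auto simp: B_def)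
      have ind_lim: "AE w in M. (\<lambda>j. indicator (B j) w :: real) \<longlonglongrightarrow> indicator A w"
        using e_fin AE_space
      proof eventually_elim
        case (elim w)
        obtain j0 :: nat where j0: "?e w \<le> of_nat j0"
          using ennreal_Ex_less_of_nat[of "?e w"] elim(1) by (auto intro: less_imp_le)
        have "eventually (\<lambda>j. indicator (B j) w = (indicator A w :: real)) sequentially"
          using eventually_ge_at_top[of j0]
        proof eventually_elim
          case (elim j)
          have "?e w \<le> of_nat j" by (rule order.trans[OF j0]) (use elim in simp)
          then show ?case using \<open>w \<in> space M\<close> spF by (auto simp: B_def indicator_def)
        qed
        then show ?case by (rule tendsto_eventually)
      qed
      let ?v = "\<lambda>w. indicator A w * max 0 (V n (Z n w) w)"
      have ennreal_v: "ennreal (?v w) = ennreal (V n (Z n w) w) * indicator A w" for w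
        by (auto simp: ennreal_max_0 split: split_indicator)
      have v: "integrable M ?v"
      proof (rule integrableI_bounded)
        show "(\<integral>\<^sup>+w. ennreal (norm (?v w)) \<partial>M) < \<infinity>"
          using fin by (simp add: ennreal_v flip: ennreal_v)
      qed measurable
      have "(\<lambda>j. ?J (B j) \<xi>) \<longlonglongrightarrow> ?J A \<xi>"
      proof (rule integral_dominated_convergence[where w="\<lambda>w. \<bar>U (W \<xi> w)\<bar>"])
        show "AE w in M. (\<lambda>j. indicator (B j) w * U (W \<xi> w)) \<longlonglongrightarrow> indicator A w * U (W \<xi> w)"
          using ind_lim by eventually_elim (intro tendsto_intros)
      qed (use int\<xi> in \<open>auto split: split_indicator\<close>)
      then have ev1: "eventually (\<lambda>j. ?J (B j) \<xi> <
          ?J A \<xi> + \<epsilon> / 3) sequentially"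
        using \<epsilon> by (intro order_tendstoD) auto
      have "(\<lambda>j. \<integral>w. (indicator A w - indicator (B j) w) * ?v w \<partial>M) \<longlonglongrightarrow> (\<integral>w. (indicator A w - indicator A w) * ?v w \<partial>M)"
      proof (rule integral_dominated_convergence[where w="?v"])
        show "AE w in M. (\<lambda>j. (indicator A w - indicator (B j) w) * ?v w) \<longlonglongrightarrow> (indicator A w - indicator A w) * ?v w"
          using ind_lim by eventually_elim (intro tendsto_intros)
        show "AE w in M. norm ((indicator A w - indicator (B j) w) * ?v w) \<le> ?v w" for j
          using BA by (intro AE_I2) (auto split: split_indicator)
      qed (use v in auto)
      then have ev2: "eventually (\<lambda>j. (\<integral>w. (indicator A w - indicator (B j) w) * ?v w \<partial>M) < \<epsilon> / 3) sequentially"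
        using \<epsilon> by (intro order_tendstoD) auto
      obtain j where j: "?J (B j) \<xi> < ?J A \<xi> + \<epsilon> / 3"
        "(\<integral>w. (indicator A w - indicator (B j) w) * ?v w \<partial>M) < \<epsilon> / 3"
        using eventually_happens'[OF sequentially_bot eventually_conj[OF ev1 ev2]] by blast
      have "(\<integral>\<^sup>+w\<in>B j. ennreal (V (Suc n) (Z (Suc n) w) w) \<partial>M) =
          (\<integral>\<^sup>+w. indicator (B j) w * ennreal (V (Suc n) (Z (Suc n) w) w) \<partial>M)"
        by (simp add: mult.commute)
      also have "\<dots> = (\<integral>\<^sup>+w. indicator (B j) w * ?e w \<partial>M)"
        by (rule sf.nn_cond_exp_intg[symmetric]) measurable
      also have "\<dots> \<le> (\<integral>\<^sup>+w. of_nat j \<partial>M)"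
        by (intro nn_integral_mono) (auto simp: B_def split: split_indicator)
      also have "\<dots> < \<infinity>" by (simp add: emeasure_space_1 of_nat_less_top)
      finally have fin': "(\<integral>\<^sup>+w\<in>B j. ennreal (V (Suc n) (Z (Suc n) w) w) \<partial>M) < \<infinity>" .
      have "B j \<in> sets (F (Suc n))" using B_F[of j] filtration_F[of n "Suc n"] step by auto
      then have ev3: "eventually (\<lambda>k. ?J (B j) (\<psi> k) <
          ?J (B j) \<xi> + \<epsilon> / 3) sequentially"
        using step.IH fin' \<epsilon> by auto
      \<comment> \<open>On the remainder the supermartingale property replaces terminal utility by
        the value at time \<open>n\<close>, which is bounded by the integrable \<open>?v\<close> for
        all \<open>k\<close> at once; for large \<open>j\<close> this contribution is small
        uniformly in \<open>k\<close>.\<close>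
      have rest: "?J (A - B j) (\<psi> k) \<le>
          (\<integral>w. (indicator A w - indicator (B j) w) * ?v w \<partial>M)" for k
      proof -
        let ?R = "A - B j" and ?f = "\<lambda>w. U (W (\<psi> k) w)" and ?h = "\<lambda>w. V n (wealth S c (\<psi> k) n w) w"
        let ?w = "\<lambda>w. (indicator A w - indicator (B j) w) * ?v w"
        have R: "?R \<in> sets (F n)" using A B_F by auto
        have w: "integrable M ?w"
        proof (rule Bochner_Integration.integrable_bound[OF v])
          show "AE w in M. norm (?w w) \<le> norm (?v w)"
            using BA by (intro AE_I2) (auto split: split_indicator)
        qed measurable
        have sup: "(\<integral>\<^sup>+w\<in>?R. ennreal (?f w) \<partial>M) + (\<integral>\<^sup>+w\<in>?R. ennreal (- ?h w) \<partial>M) \<le>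
            (\<integral>\<^sup>+w\<in>?R. ennreal (?h w) \<partial>M) + (\<integral>\<^sup>+w\<in>?R. ennreal (- ?f w) \<partial>M)"
          using supermartingale[OF str\<psi>[of k] integrable_neg_finite[OF int\<psi>[of k]], of n] step R by auto
        have hw: "(\<integral>\<^sup>+w\<in>?R. ennreal (?h w) \<partial>M) \<le> (\<integral>\<^sup>+w. ennreal (?w w) \<partial>M)"
        proof (rule nn_integral_mono_AE)
          have "AE w in M. mono (\<lambda>x. V n x w) \<and> continuous_on UNIV (\<lambda>x. V n x w)"
            using step by (intro V_regular) auto
          then show "AE w in M. ennreal (?h w) * indicator ?R w \<le> ennreal (?w w)"
          proof eventually_elim
            case (elim w)
            have "?h w \<le> V n (Z n w) w" by (rule monoD[OF conjunct1[OF elim] WZ])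
            then show ?case using BA[of j] by (auto split: split_indicator intro!: ennreal_leI)
          qed
        qed
        have le: "(\<integral>\<^sup>+w. ennreal (indicator ?R w * ?f w) \<partial>M) \<le>
            (\<integral>\<^sup>+w. ennreal (?w w) \<partial>M) + (\<integral>\<^sup>+w. ennreal (- (indicator ?R w * ?f w)) \<partial>M)"
        proof -
          have pm: "(\<integral>\<^sup>+w. ennreal (indicator ?R w * ?f w) \<partial>M) = (\<integral>\<^sup>+w\<in>?R. ennreal (?f w) \<partial>M)"
            "(\<integral>\<^sup>+w. ennreal (- (indicator ?R w * ?f w)) \<partial>M) = (\<integral>\<^sup>+w\<in>?R. ennreal (- ?f w) \<partial>M)"
            by (intro nn_integral_cong; auto split: split_indicator)+
          have "(\<integral>\<^sup>+w\<in>?R. ennreal (?f w) \<partial>M) \<le>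
              (\<integral>\<^sup>+w\<in>?R. ennreal (?f w) \<partial>M) + (\<integral>\<^sup>+w\<in>?R. ennreal (- ?h w) \<partial>M)" by simp
          also note sup
          also have "(\<integral>\<^sup>+w\<in>?R. ennreal (?h w) \<partial>M) + (\<integral>\<^sup>+w\<in>?R. ennreal (- ?f w) \<partial>M) \<le>
              (\<integral>\<^sup>+w. ennreal (?w w) \<partial>M) + (\<integral>\<^sup>+w\<in>?R. ennreal (- ?f w) \<partial>M)"
            by (rule add_right_mono[OF hw])
          finally show ?thesis unfolding pm .
        qed
        have intR: "integrable M (\<lambda>w. indicator ?R w * ?f w)" by (intro integrable_indicator_times int\<psi>) measurable
        have w0: "?w w \<ge> 0" for w using BA[of j] by (auto split: split_indicator)
        have fin_n: "(\<integral>\<^sup>+w. ennreal (- (indicator ?R w * ?f w)) \<partial>M) < \<infinity>" by (rule integrable_neg_finite[OF intR])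
        have wnn: "(\<integral>\<^sup>+w. ennreal (?w w) \<partial>M) = ennreal (\<integral>w. ?w w \<partial>M)"
          by (intro nn_integral_eq_integral[OF w] AE_I2 w0)
        have "enn2real (\<integral>\<^sup>+w. ennreal (indicator ?R w * ?f w) \<partial>M) \<le>
            enn2real (ennreal (\<integral>w. ?w w \<partial>M) + (\<integral>\<^sup>+w. ennreal (- (indicator ?R w * ?f w)) \<partial>M))"
          using le fin_n unfolding wnn by (intro enn2real_mono) auto
        also have "\<dots> = (\<integral>w. ?w w \<partial>M) + enn2real (\<integral>\<^sup>+w. ennreal (- (indicator ?R w * ?f w)) \<partial>M)"
          using fin_n by (subst enn2real_plus) (auto intro!: Bochner_Integration.integral_nonneg w0 enn2real_ennreal)
        finally show ?thesis unfolding real_lebesgue_integral_def[OF intR] by linarith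
      qed
      from ev3 show "eventually (\<lambda>k. ?J A (\<psi> k) <
          ?J A \<xi> + \<epsilon>) sequentially"
      proof eventually_elim
        case (elim k)
        have "?J A (\<psi> k) =
            (\<integral>w. indicator (B j) w * U (W (\<psi> k) w) + indicator (A - B j) w * U (W (\<psi> k) w) \<partial>M)"
          using BA[of j] by (intro Bochner_Integration.integral_cong) (auto split: split_indicator)
        also have "\<dots> = ?J (B j) (\<psi> k) + ?J (A - B j) (\<psi> k)"
          by (intro Bochner_Integration.integral_add integrable_indicator_times int\<psi>) measurable
        finally show ?case using elim j rest[of k] by linarith
      qed
    qed
  qed

  have "max_EU \<le> EU \<xi>"
  proof (rule field_le_epsilon)
    fix \<epsilon> :: real assume \<epsilon>: "\<epsilon> > 0"
    have sp: "space M \<in> sets (F 0)" using subalgebra_F[of 0] by (metis subalgebra_def sets.top le0)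
    have whole: "(\<integral>w. indicator (space M) w * f w \<partial>M) = (\<integral>w. f w \<partial>M)" for f :: "'a \<Rightarrow> real"
      by (intro Bochner_Integration.integral_cong) auto
    have "(\<integral>\<^sup>+w\<in>space M. ennreal (V 0 (Z 0 w) w) \<partial>M) = (\<integral>\<^sup>+w. ennreal (V 0 c w) \<partial>M)"
      by (intro nn_integral_cong) (simp add: Z_def)
    then have "eventually (\<lambda>k. EU (\<psi> k) < EU \<xi> + \<epsilon> / 2) sequentially"
      using usc[OF le0, rule_format, OF sp, of "\<epsilon> / 2"] V0_pos_finite[of c] \<epsilon> by (simp only: whole)
    moreover have "eventually (\<lambda>k. 1 / real (Suc (r k)) < \<epsilon> / 2) sequentially"
      using order_tendstoD(2)[OF filterlim_compose[OF LIMSEQ_inverse_real_of_nat r], of "\<epsilon> / 2"] \<epsilon>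
      by (simp add: inverse_eq_divide)
    ultimately have "eventually (\<lambda>k. max_EU \<le> EU \<xi> + \<epsilon>) sequentially"
    proof eventually_elim
      case (elim k)
      then show ?case using max[of "r k"] EU\<psi>[of k] by linarith
    qed
    then show "max_EU \<le> EU \<xi> + \<epsilon>" by simp
  qed
  then show ?thesis
    using red\<xi> feas\<xi> EU_le_max_EU order.trans by blast
qed

end

text \<open>The midpoint of two optimisers is feasible and no better than either, so the
  non-negative concavity gap has integral 0. Strict concavity then forces equal wealths almost
  surely.\<close>

lemma optimal_wealth_unique:
  assumes \<phi>: "feasible \<phi>" "\<forall>\<rho>. feasible \<rho> \<longrightarrow> EU \<rho> \<le> EU \<phi>"
    and \<psi>: "feasible \<psi>" "\<forall>\<rho>. feasible \<rho> \<longrightarrow> EU \<rho> \<le> EU \<psi>"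
  shows "AE w in M. W \<phi> w = W \<psi> w"
proof -
  let ?\<rho> = "\<lambda>t w. (1 / 2) *\<^sub>R \<phi> t w + (1 / 2) *\<^sub>R \<psi> t w"
  let ?g = "\<lambda>w. U (W ?\<rho> w) - (U (W \<phi> w) + U (W \<psi> w)) / 2"
  have int: "integrable M (\<lambda>w. U (W \<phi> w))" "integrable M (\<lambda>w. U (W \<psi> w))" "integrable M (\<lambda>w. U (W ?\<rho> w))"
    using \<phi>(1) \<psi>(1) feasible_midpoint(1)[OF \<phi>(1) \<psi>(1)] by (auto simp: feasible_def)
  have g0: "?g w \<ge> 0" for w
    using midpoint_ge by (simp add: feasible_midpoint(2)[OF \<phi>(1) \<psi>(1)])
  have "(\<integral>w. ?g w \<partial>M) = EU ?\<rho> - (EU \<phi> + EU \<psi>) / 2" using int by simp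
  moreover have "EU \<phi> = EU \<psi>" using \<phi> \<psi> by (meson antisym)
  moreover have "EU ?\<rho> \<le> EU \<phi>" using \<phi>(2) feasible_midpoint(1)[OF \<phi>(1) \<psi>(1)] by blast
  moreover have "(\<integral>w. ?g w \<partial>M) \<ge> 0" by (intro Bochner_Integration.integral_nonneg g0)
  ultimately have "(\<integral>w. ?g w \<partial>M) = 0" by simp
  then have "AE w in M. ?g w = 0"
    using int g0 by (subst (asm) integral_nonneg_eq_0_iff_AE) auto
  then show ?thesis
  proof eventually_elim
    case (elim w)
    show ?case
    proof (rule ccontr)
      assume "W \<phi> w \<noteq> W \<psi> w"
      from midpoint_strict[OF this] elim show False
        by (simp add: feasible_midpoint(2)[OF \<phi>(1) \<psi>(1)])
    qed
  qed
qed

lemma exists_unique_optimal: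
  "\<exists>\<phi>. optimal_strategy M F S T U c \<phi> \<and>
       (\<forall>t\<in>{1..T}. AE w in M. \<phi> t w \<in> support_space \<kappa> t w) \<and>
       (\<forall>\<psi>. optimal_strategy M F S T U c \<psi> \<and>
          (\<forall>t\<in>{1..T}. AE w in M. \<psi> t w \<in> support_space \<kappa> t w) \<longrightarrow>
          (\<forall>t\<in>{1..T}. AE w in M. \<psi> t w = \<phi> t w))"
proof -
  obtain \<phi> where \<phi>: "\<And>n. reduced (\<phi> n)" "\<And>n. feasible (\<phi> n)" "\<And>n. EU (\<phi> n) > max_EU - 1 / real (Suc n)"
    by (rule maximizing_sequence) blast
  obtain \<xi> where \<xi>: "reduced \<xi>" "feasible \<xi>" "\<forall>\<psi>. feasible \<psi> \<longrightarrow> EU \<psi> \<le> EU \<xi>"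
    using exists_optimal[OF \<phi>] by blast
  show ?thesis
  proof (intro exI[of _ \<xi>] conjI allI impI)
    show "optimal_strategy M F S T U c \<xi>" using \<xi> by (simp add: optimal_iff)
    show "\<forall>t\<in>{1..T}. AE w in M. \<xi> t w \<in> support_space \<kappa> t w"
      using \<xi>(1) reduced_iff_support_space[OF reduced_strategies[OF \<xi>(1)]] by blast
    fix \<psi> assume *: "optimal_strategy M F S T U c \<psi> \<and> (\<forall>t\<in>{1..T}. AE w in M. \<psi> t w \<in> support_space \<kappa> t w)"
    then have \<psi>: "feasible \<psi>" "\<forall>\<rho>. feasible \<rho> \<longrightarrow> EU \<rho> \<le> EU \<psi>" by (simp_all add: optimal_iff)
    then have "reduced \<psi>" using * reduced_iff_support_space by (auto simp: feasible_def)
    then show "\<forall>t\<in>{1..T}. AE w in M. \<psi> t w = \<xi> t w"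
      using reduced_unique[OF _ \<xi>(1) optimal_wealth_unique[OF \<psi> \<xi>(2,3)]] by blast
  qed
qed

end

theorem theorem2p8:
  fixes M :: "'a measure"
    and F :: "nat \<Rightarrow> 'a measure"
    and S :: "nat \<Rightarrow> 'a \<Rightarrow> real ^ 'd"
    and T :: nat
    and U :: "real \<Rightarrow> real"
    and c :: real
    and \<kappa> :: "nat \<Rightarrow> 'a \<Rightarrow> (real ^ 'd) measure"
  assumes "market M F S T"
    and "\<And>t. t \<in> {1..T} \<Longrightarrow> regular_cond_distr M (F (t - 1)) (increment S t) (\<kappa> t)"
    and "no_arbitrage M F S T"
    and "assumption_A M F S T U"
    and "assumption_B U \<or> assumption_C U"
    and "strictly_concave U"
  shows "\<exists>\<phi>. optimal_strategy M F S T U c \<phi> \<and>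
             (\<forall>t\<in>{1..T}. AE \<omega> in M. \<phi> t \<omega> \<in> support_space \<kappa> t \<omega>) \<and>
             (\<forall>\<psi>. optimal_strategy M F S T U c \<psi> \<and>
                  (\<forall>t\<in>{1..T}. AE \<omega> in M. \<psi> t \<omega> \<in> support_space \<kappa> t \<omega>) \<longrightarrow>
                  (\<forall>t\<in>{1..T}. AE \<omega> in M. \<psi> t \<omega> = \<phi> t \<omega>))"
proof -
  obtain V where V: "regular_value_functions M F S T U V"
    "\<And>x. expectation_defined M (V 0 x)" "\<And>x. gen_expectation M (V 0 x) < \<infinity>"
    using assms(4) unfolding assumption_A_def by blast
  interpret market M F S T by (rule assms(1))
  interpret utility_problem M F S T \<kappa> U V c
    using assms(2,3,5,6) V by unfold_locales (auto simp: assumption_B_def assumption_C_def)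
  show ?thesis by (rule exists_unique_optimal)
qed

end
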